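(* Let $d,n\in\mathbb{N}_{\geq1}$, $s\in\mathbb{N}_{\geq0}$, $0<\lambda\leq1$, $\gamma:=s+\lambda$, and let $1\leq t<\infty$. For any $0<\epsilon<1$ and any $\boldsymbol{f}:[0,1]^{d\times n}\to\mathbb{R}^{d\times n}$ whose components $f_{pq}$ all belong to $C^{s,\lambda}([0,1]^{d\times n})$, there exists a Transformer $\boldsymbol{T}:\mathbb{R}^{d\times n}\to\mathbb{R}^{d\times n}$ of length $n$ with size \begin{align*} &L_0=4,\quad W_0=\mathcal{O}(\epsilon^{-1/\gamma});\\ &H_1=(3d+1)\binom{s+dn-1}{dn-1},\quad S_1=\max\{dn,3\};\\ &L_l=3,\quad W_l=d\binom{s+dn-1}{dn-1}(4n+11),\quad l=1,\dots,n-1;\\ &H_l=3d\binom{s+dn-1}{dn-1},\quad S_l=3,\quad l=2,\dots,n;\\ &L_n=\mathcal{O}(\log\tfrac{1}{\epsilon}),\quad W_n=\mathcal{O}(\epsilon^{-dn/\gamma}) \end{align*} and dimension vector $\big(d,\ d+n+1,\ (2dn+5d)\binom{s+dn-1}{dn-1}\boldsymbol{1}_{1\times n},\ d\big)$ (i.e. $d_{in}=d$, $d_0=d+n+1$, $d_1=\dots=d_n=(2dn+5d)\binom{s+dn-1}{dn-1}$, $d_{out}=d$) such that for all $p\in[d],q\in[n]$, $$\|T_{pq}-f_{pq}\|_{L^t([0,1]^{d\times n})}\leq\epsilon.$$ Furthermore, the weight bounds of $\boldsymbol{T}$ are $B_{EB}=\mathcal{O}(1)$, $B_{FF}=\mathcal{O}(\epsilon^{-(7dn+\gamma+2)t/\gamma})$,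 $B_{SA}=\mathcal{O}(\log\frac{1}{\epsilon})$ and its numbers of parameters are $M_{EB}=\mathcal{O}(1)$, $M_{FF}=\mathcal{O}(\epsilon^{-dn/\gamma})$, $M_{SA}=\mathcal{O}(1)$. Here all $\mathcal{O}(\cdot)$ constants are independent of $\epsilon$.
   Context: Hölder space: for $\Omega\subset\mathbb{R}^D$, multi-indices $\boldsymbol{\mu}\in\mathbb{N}_{\geq0}^D$, $|\boldsymbol{\mu}|=\sum\mu_i$, $D^{\boldsymbol\mu}f$ the partial derivative; $\|f\|_{C^{s,\lambda}(\Omega)}:=\max\{\max_{|\boldsymbol\mu|\le s}\sup_{\Omega}|D^{\boldsymbol\mu}f|,\ \max_{|\boldsymbol\mu|=s}\sup_{x\neq y\in\Omega}|D^{\boldsymbol\mu}f(x)-D^{\boldsymbol\mu}f(y)|/\|x-y\|_2^\lambda\}$, and $C^{s,\lambda}(\Omega)$ is the set of functions with finite norm (here $[0,1]^{d\times n}$ is identified with $[0,1]^{dn}$). $L^t$ is w.r.t. Lebesgue measure. $[m]=\{1,\dots,m\}$. Transformers: $\sigma_R(x)=\max\{x,0\}$ entrywise; $\sigma_S$ is the column-wise softmax, $[\sigma_S(\boldsymbol x)]_i=e^{x_i}/\sum_{j=1}^n e^{x_j}$ applied to each column. A ReLU FNN $f:\mathbb{R}^a\to\mathbb{R}^b$ of depth $L$ and width $W$: $f_0=x$, $f_l=\sigma_R(W_lf_{l-1}+b_l)$ for $1\le l\le L-1$, $f=W_Lf_{L-1}+b_L$, with $W_1\in\mathbb{R}^{W\times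 a}$, $W_l\in\mathbb{R}^{W\times W}$ ($2\le l\le L-1$), $W_L\in\mathbb{R}^{b\times W}$, $b_l\in\mathbb{R}^W$, $b_L\in\mathbb{R}^b$. The feedforward block $\mathcal F_{FF}:\mathbb{R}^{a\times n}\to\mathbb{R}^{b\times n}$ generated by $f$ applies $f$ to each column (biases $b_l\boldsymbol 1_{1\times n}$). A self-attention layer $\mathcal F_{SA}:\mathbb{R}^{D\times n}\to\mathbb{R}^{D\times n}$ with head number $H$ and head size $S$: $\mathcal F_{SA}(X)=X+\sum_{h=1}^H W_O^{(h)}W_V^{(h)}X\sigma_S(X^\top W_K^{(h)\top}W_Q^{(h)}X)$, $W_O^{(h)}\in\mathbb{R}^{D\times S}$, $W_V^{(h)},W_K^{(h)},W_Q^{(h)}\in\mathbb{R}^{S\times D}$. An embedding layer is $\mathcal F_{EB}(X)=W_{EB}X+B_{EB}$. A Transformer of length $K$ is $\mathcal F_{FF}^{(K)}\circ\mathcal F_{SA}^{(K)}\circ\mathcal F_{FF}^{(K-1)}\circ\cdots\circ\mathcal F_{FF}^{(1)}\circ\mathcal F_{SA}^{(1)}\circ\mathcal F_{FF}^{(0)}\circ\mathcal F_{EB}$ with $\mathcal F_{EB}:\mathbb{R}^{d_{in}\times n}\to\mathbb{R}^{d_0\times n}$, $\mathcal F_{FF}^{(k)}:\mathbb{R}^{d_k\times n}\to\mathbb{R}^{d_{k+1}\times n}$ ($d_{K+1}:=d_{out}$), $\mathcal F_{SA}^{(k)}$ acting on $\mathbb{R}^{d_k\times n}$. Its size is $\{(L_0,W_0),(H_1,S_1),(L_1,W_1),\dots,(H_K,S_K),(L_K,W_K)\}$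 with $(L_k,W_k)$ depth/width of $\mathcal F_{FF}^{(k)}$ and $(H_k,S_k)$ head number/size of $\mathcal F_{SA}^{(k)}$; its dimension vector is $(d_{in},d_0,\dots,d_K,d_{out})$. $B_{EB},B_{FF},B_{SA}$ are upper bounds on absolute values of the parameters of the embedding layer, all feedforward blocks, and all self-attention layers respectively; $M_{EB},M_{FF},M_{SA}$ are the corresponding numbers of parameters. *)

theory Defs
  imports "HOL-Analysis.Analysis" "HOL-Probability.Probability"
begin

section \<open>Matrices and vectors (explicit dimensions, indices start at 0)\<close>

type_synonym mat = "nat \<Rightarrow> nat \<Rightarrow> real"
type_synonym vec = "nat \<Rightarrow> real"

definition mmul :: "nat \<Rightarrow> mat \<Rightarrow> mat \<Rightarrow> mat" where
  "mmul k A B = (\<lambda>i j. \<Sum>l<k. A i l * B l j)"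

definition mtrans :: "mat \<Rightarrow> mat" where
  "mtrans A = (\<lambda>i j. A j i)"

definition mtrunc :: "nat \<Rightarrow> nat \<Rightarrow> mat \<Rightarrow> mat" where
  "mtrunc r c A = (\<lambda>i j. if i < r \<and> j < c then A i j else 0)"

definition col_softmax :: "nat \<Rightarrow> mat \<Rightarrow> mat" where
  "col_softmax n A = (\<lambda>i j. exp (A i j) / (\<Sum>k<n. exp (A k j)))"

definition relu_vec :: "vec \<Rightarrow> vec" where
  "relu_vec x = (\<lambda>i. max (x i) 0)"

definition affine :: "nat \<Rightarrow> nat \<Rightarrow> mat \<Rightarrow> vec \<Rightarrow> vec \<Rightarrow> vec" where
  "affine r c M b x = (\<lambda>i. if i < r then (\<Sum>j<c. M i j * x j) + b i else 0)"

text \<open>A network is the list of its layers (W_l, b_l), l = 1..L.  Layer l maps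
  R^(cols) to R^(rows), where layer 1 has cols = a, the last layer has rows = b,
  all other dimensions equal the width W.\<close>
type_synonym fnn = "(mat \<times> vec) list"

fun fnn_run :: "nat \<Rightarrow> nat \<Rightarrow> nat \<Rightarrow> fnn \<Rightarrow> vec \<Rightarrow> vec" where
  "fnn_run c W b [] x = x"
| "fnn_run c W b [(M, v)] x = affine b c M v x"
| "fnn_run c W b ((M, v) # l # ls) x = fnn_run W W b (l # ls) (relu_vec (affine W c M v x))"

definition fnn_eval :: "nat \<Rightarrow> nat \<Rightarrow> nat \<Rightarrow> fnn \<Rightarrow> vec \<Rightarrow> vec" where
  "fnn_eval a b W net = fnn_run a W b net"

text \<open>(rows, cols) of layer i (0-based) of a depth-L network a -> b of width W\<close>
definition fnn_ldims :: "nat \<Rightarrow> nat \<Rightarrow> nat \<Rightarrow> nat \<Rightarrow> nat \<Rightarrow> nat \<times> nat" where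
  "fnn_ldims a b W L i = ((if i + 1 = L then b else W), (if i = 0 then a else W))"

text \<open>parameter positions: (layer, row, Some col) for weights, (layer, row, None) for biases\<close>
definition fnn_pos :: "nat \<Rightarrow> nat \<Rightarrow> nat \<Rightarrow> nat \<Rightarrow> (nat \<times> nat \<times> nat option) set" where
  "fnn_pos a b W L = {(i, r, co). i < L \<and> r < fst (fnn_ldims a b W L i) \<and>
      (case co of None \<Rightarrow> True | Some c \<Rightarrow> c < snd (fnn_ldims a b W L i))}"

definition fnn_val :: "fnn \<Rightarrow> nat \<times> nat \<times> nat option \<Rightarrow> real" where
  "fnn_val net = (\<lambda>(i, r, co). case co of None \<Rightarrow> snd (net ! i) r | Some c \<Rightarrow> fst (net ! i) r c)"

definition ff_block :: "nat \<Rightarrow> nat \<Rightarrow> nat \<Rightarrow> nat \<Rightarrow> fnn \<Rightarrow> mat \<Rightarrow> mat" where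
  "ff_block n a b W net X = mtrunc b n (\<lambda>i j. fnn_eval a b W net (\<lambda>k. X k j) i)"

text \<open>a head is (W_O, W_V, W_K, W_Q), W_O : D x S, the others S x D\<close>
type_synonym head = "mat \<times> mat \<times> mat \<times> mat"

definition sa_layer :: "nat \<Rightarrow> nat \<Rightarrow> nat \<Rightarrow> head list \<Rightarrow> mat \<Rightarrow> mat" where
  "sa_layer n D S hs X = mtrunc D n (\<lambda>i j. X i j +
     (\<Sum>h<length hs. case hs ! h of (WO, WV, WK, WQ) \<Rightarrow>
        mmul n (mmul S WO (mmul D WV X))
          (col_softmax n (mmul D (mtrans X) (mmul S (mtrans WK) (mmul D WQ X)))) i j))"

definition sa_pos :: "nat \<Rightarrow> nat \<Rightarrow> nat \<Rightarrow> (nat \<times> nat \<times> nat \<times> nat) set" where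
  "sa_pos H S D = {(h, m, r, c). h < H \<and> m < 4 \<and>
      (if m = 0 then r < D \<and> c < S else r < S \<and> c < D)}"

definition sa_val :: "head list \<Rightarrow> nat \<times> nat \<times> nat \<times> nat \<Rightarrow> real" where
  "sa_val hs = (\<lambda>(h, m, r, c). case hs ! h of (WO, WV, WK, WQ) \<Rightarrow>
      (if m = 0 then WO else if m = 1 then WV else if m = 2 then WK else WQ) r c)"

definition emb :: "nat \<Rightarrow> nat \<Rightarrow> nat \<Rightarrow> mat \<Rightarrow> mat \<Rightarrow> mat \<Rightarrow> mat" where
  "emb din d0 n W B X = mtrunc d0 n (\<lambda>i j. (\<Sum>k<din. W i k * X k j) + B i j)"

text \<open>(0,r,c): entry of W_EB (d0 x din); (1,r,c): entry of B_EB (d0 x n)\<close>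
definition eb_pos :: "nat \<Rightarrow> nat \<Rightarrow> nat \<Rightarrow> (nat \<times> nat \<times> nat) set" where
  "eb_pos din d0 n = {(m, r, c). (m = 0 \<and> r < d0 \<and> c < din) \<or> (m = 1 \<and> r < d0 \<and> c < n)}"

datatype transformer = Transformer
  (tf_WEB: mat) (tf_BEB: mat) (tf_FF: "fnn list") (tf_SA: "head list list")

text \<open>dv = [d_in, d_0, ..., d_K, d_out];  LW = [(L_0,W_0), ..., (L_K,W_K)];
  HS = [(H_1,S_1), ..., (H_K,S_K)].  K = length HS.\<close>
definition tf_shape :: "nat list \<Rightarrow> (nat \<times> nat) list \<Rightarrow> (nat \<times> nat) list \<Rightarrow> transformer \<Rightarrow> bool" where
  "tf_shape dv LW HS T \<longleftrightarrow> (let K = length HS in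
     length dv = K + 3 \<and> length LW = K + 1 \<and> length (tf_FF T) = K + 1 \<and> length (tf_SA T) = K \<and>
     (\<forall>k\<le>K. 1 \<le> fst (LW ! k) \<and> length (tf_FF T ! k) = fst (LW ! k)) \<and>
     (\<forall>k<K. length (tf_SA T ! k) = fst (HS ! k)))"

definition tf_eval :: "nat \<Rightarrow> nat list \<Rightarrow> (nat \<times> nat) list \<Rightarrow> (nat \<times> nat) list \<Rightarrow> transformer \<Rightarrow> mat \<Rightarrow> mat" where
  "tf_eval n dv LW HS T X = (let K = length HS; dd = (\<lambda>k. dv ! (k + 1));
     X0 = ff_block n (dd 0) (dd 1) (snd (LW ! 0)) (tf_FF T ! 0)
            (emb (dv ! 0) (dd 0) n (tf_WEB T) (tf_BEB T) X)
   in foldl (\<lambda>Y k. ff_block n (dd k) (dd (k + 1)) (snd (LW ! k)) (tf_FF T ! k)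
                    (sa_layer n (dd k) (snd (HS ! (k - 1))) (tf_SA T ! (k - 1)) Y))
        X0 [1..<K + 1])"

definition tf_EB_bound :: "nat \<Rightarrow> nat list \<Rightarrow> transformer \<Rightarrow> real \<Rightarrow> bool" where
  "tf_EB_bound n dv T B \<longleftrightarrow> (\<forall>(m, r, c) \<in> eb_pos (dv ! 0) (dv ! 1) n.
      \<bar>(if m = 0 then tf_WEB T else tf_BEB T) r c\<bar> \<le> B)"

definition tf_FF_bound :: "nat list \<Rightarrow> (nat \<times> nat) list \<Rightarrow> (nat \<times> nat) list \<Rightarrow> transformer \<Rightarrow> real \<Rightarrow> bool" where
  "tf_FF_bound dv LW HS T B \<longleftrightarrow> (\<forall>k \<le> length HS.
      \<forall>p \<in> fnn_pos (dv ! (k + 1)) (dv ! (k + 2)) (snd (LW ! k)) (fst (LW ! k)).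
        \<bar>fnn_val (tf_FF T ! k) p\<bar> \<le> B)"

definition tf_SA_bound :: "nat list \<Rightarrow> (nat \<times> nat) list \<Rightarrow> transformer \<Rightarrow> real \<Rightarrow> bool" where
  "tf_SA_bound dv HS T B \<longleftrightarrow> (\<forall>k < length HS.
      \<forall>p \<in> sa_pos (fst (HS ! k)) (snd (HS ! k)) (dv ! (k + 2)).
        \<bar>sa_val (tf_SA T ! k) p\<bar> \<le> B)"

definition tf_M_EB :: "nat \<Rightarrow> nat list \<Rightarrow> transformer \<Rightarrow> nat" where
  "tf_M_EB n dv T = card {(m, r, c) \<in> eb_pos (dv ! 0) (dv ! 1) n.
      (if m = 0 then tf_WEB T else tf_BEB T) r c \<noteq> 0}"

definition tf_M_FF :: "nat list \<Rightarrow> (nat \<times> nat) list \<Rightarrow> (nat \<times> nat) list \<Rightarrow> transformer \<Rightarrow> nat" where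
  "tf_M_FF dv LW HS T = (\<Sum>k \<le> length HS.
      card {p \<in> fnn_pos (dv ! (k + 1)) (dv ! (k + 2)) (snd (LW ! k)) (fst (LW ! k)).
        fnn_val (tf_FF T ! k) p \<noteq> 0})"

definition tf_M_SA :: "nat list \<Rightarrow> (nat \<times> nat) list \<Rightarrow> transformer \<Rightarrow> nat" where
  "tf_M_SA dv HS T = (\<Sum>k < length HS.
      card {p \<in> sa_pos (fst (HS ! k)) (snd (HS ! k)) (dv ! (k + 2)).
        sa_val (tf_SA T ! k) p \<noteq> 0})"

definition unit_cube :: "'i set \<Rightarrow> ('i \<Rightarrow> real) set" where
  "unit_cube I = {x. (\<forall>i\<in>I. 0 \<le> x i \<and> x i \<le> 1) \<and> (\<forall>i. i \<notin> I \<longrightarrow> x i = 0)}"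

text \<open>g' is the partial derivative of g in direction i on the cube (one-sided at the boundary)\<close>
definition partial_on :: "'i set \<Rightarrow> 'i \<Rightarrow> (('i \<Rightarrow> real) \<Rightarrow> real) \<Rightarrow> (('i \<Rightarrow> real) \<Rightarrow> real) \<Rightarrow> bool" where
  "partial_on I i g g' \<longleftrightarrow> (\<forall>x \<in> unit_cube I.
     ((\<lambda>h. g (x(i := x i + h))) has_real_derivative g' x)
       (at 0 within {h. x(i := x i + h) \<in> unit_cube I}))"

definition multi_index :: "'i set \<Rightarrow> ('i \<Rightarrow> nat) \<Rightarrow> bool" where
  "multi_index I mu \<longleftrightarrow> (\<forall>i. i \<notin> I \<longrightarrow> mu i = 0)"

definition mi_order :: "'i set \<Rightarrow> ('i \<Rightarrow> nat) \<Rightarrow> nat" where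
  "mi_order I mu = (\<Sum>i\<in>I. mu i)"

text \<open>Dg mu is D^mu g on the cube, for all multi-indices of order at most s\<close>
definition holder_derivs :: "'i set \<Rightarrow> nat \<Rightarrow> (('i \<Rightarrow> real) \<Rightarrow> real)
     \<Rightarrow> (('i \<Rightarrow> nat) \<Rightarrow> ('i \<Rightarrow> real) \<Rightarrow> real) \<Rightarrow> bool" where
  "holder_derivs I s g Dg \<longleftrightarrow>
     (\<forall>x \<in> unit_cube I. Dg (\<lambda>_. 0) x = g x) \<and>
     (\<forall>mu. multi_index I mu \<and> mi_order I mu < s \<longrightarrow>
        (\<forall>i \<in> I. partial_on I i (Dg mu) (Dg (mu(i := mu i + 1)))))"

definition euclid_dist :: "'i set \<Rightarrow> ('i \<Rightarrow> real) \<Rightarrow> ('i \<Rightarrow> real) \<Rightarrow> real" where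
  "euclid_dist I x y = sqrt (\<Sum>i\<in>I. (x i - y i)^2)"

definition holder :: "'i set \<Rightarrow> nat \<Rightarrow> real \<Rightarrow> (('i \<Rightarrow> real) \<Rightarrow> real) \<Rightarrow> bool" where
  "holder I s lam g \<longleftrightarrow> (\<exists>Dg. holder_derivs I s g Dg \<and>
     (\<exists>B. \<forall>mu. multi_index I mu \<and> mi_order I mu \<le> s \<longrightarrow>
         (\<forall>x \<in> unit_cube I. \<bar>Dg mu x\<bar> \<le> B)) \<and>
     (\<exists>B. \<forall>mu. multi_index I mu \<and> mi_order I mu = s \<longrightarrow>
         (\<forall>x \<in> unit_cube I. \<forall>y \<in> unit_cube I. x \<noteq> y \<longrightarrow>
            \<bar>Dg mu x - Dg mu y\<bar> \<le> B * euclid_dist I x y powr lam)))"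

definition cube_measure :: "'i set \<Rightarrow> ('i \<Rightarrow> real) measure" where
  "cube_measure I = PiM I (\<lambda>_. restrict_space lborel {0..1})"

text \<open>L^t norm of g on [0,1]^I (points of the product space are extended by 0 outside I)\<close>
definition Lt_norm :: "'i set \<Rightarrow> real \<Rightarrow> (('i \<Rightarrow> real) \<Rightarrow> real) \<Rightarrow> ereal" where
  "Lt_norm I t g = (let J = (\<integral>\<^sup>+ x. ennreal (\<bar>g (\<lambda>i. if i \<in> I then x i else 0)\<bar> powr t) \<partial>cube_measure I)
     in if J = \<infinity> then \<infinity> else ereal (enn2real J powr (1 / t)))"

definition mat_idx :: "nat \<Rightarrow> nat \<Rightarrow> (nat \<times> nat) set" where
  "mat_idx d n = {..<d} \<times> {..<n}"

end

theory Submission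
  imports Defs
begin

text \<open>A single attention layer suffices. The positional one-hot vector lets the first block write
  column \<open>q\<close> into the \<open>q\<close>-th slot of a larger vector; a head with vanishing keys and queries averages
  over the columns, so afterwards every column knows the whole matrix and its own position, and
  the remaining attention layers and middle blocks act as the identity. The last block approximates
  \<open>f\<close> columnwise: steep ramps locate the cell of a grid with \<open>N \<approx> \<epsilon> powr (- 1 / \<gamma>)\<close> steps, except in
  slabs of width \<open>\<delta>\<close> next to the grid planes; position and cell are packed into one integer, at which
  a piecewise linear function with \<open>n * N ^ (d * n)\<close> pieces looks up the Taylor coefficients; and the
  Taylor polynomial is evaluated with products obtained from sawtooth approximations of the square,
  whose error decays geometrically in the depth. On the slabs the error is merely bounded, which is
  harmless in \<open>L\<^sup>t\<close> once \<open>\<delta>\<close> is a power of \<open>\<epsilon>\<close>.\<close>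

section \<open>ReLU networks with named registers\<close>

text \<open>The width and the parameter count of the last block may only be of the order
  \<open>N ^ (d * n)\<close>, the number of cells. So the table of Taylor coefficients has to be
  read off by one wide layer, and two wide layers must never be adjacent: a full matrix between them
  would have about \<open>N ^ (2 * d * n)\<close> entries. Wide layers therefore alternate with
  layers of boundedly many registers. Only the products need depth, of order
  \<open>ln (1 / \<epsilon>)\<close>, and they run on boundedly many registers. The last block is
  the same for all columns while the target varies with the column; hence the column number is a
  digit of the integer that is looked up. A continuous network cannot jump between cells, which
  forces the ramps and the slabs. With about \<open>d * n * N\<close> slabs, \<open>\<delta>\<close>
  is of order \<open>\<epsilon> powr t / N\<close>; the large weights are the slopes
  \<open>1 / \<delta>\<close> and integers up to the order of \<open>n * N ^ (d * n)\<close>, and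
  both fit the permitted power of \<open>\<epsilon>\<close>. Registers are nonnegative throughout,
  so that a ReLU layer can copy them unchanged; signs are restored in the affine output
  layer.\<close>

definition nonzeros :: "mat \<times> vec \<Rightarrow> (nat \<times> nat option) set" where
  "nonzeros l = {(r, co). (case co of None \<Rightarrow> snd l r | Some c \<Rightarrow> fst l r c) \<noteq> 0}"

definition bounded_layer :: "real \<Rightarrow> mat \<times> vec \<Rightarrow> bool" where
  "bounded_layer B l \<longleftrightarrow> (\<forall>r c. \<bar>fst l r c\<bar> \<le> B) \<and> (\<forall>r. \<bar>snd l r\<bar> \<le> B)"

text \<open>Matrices are functions on all of \<open>nat\<close>, so weights are bounded and counted
  without reference to the layer dimensions. The nonzero positions in \<open>fnn_pos\<close> then
  form a subset of the counted ones.\<close>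

definition sparse_fnn :: "real \<Rightarrow> nat \<Rightarrow> fnn \<Rightarrow> bool" where
  "sparse_fnn B P net \<longleftrightarrow> (\<forall>l\<in>set net. bounded_layer B l \<and> finite (nonzeros l)) \<and>
     (\<Sum>l\<leftarrow>net. card (nonzeros l)) \<le> P"

lemma sparse_fnn_bound:
  assumes "sparse_fnn B P net" "p \<in> fnn_pos a b W (length net)"
  shows "\<bar>fnn_val net p\<bar> \<le> B"
  using assms nth_mem[of "fst p" net]
  by (auto simp: sparse_fnn_def bounded_layer_def fnn_pos_def fnn_val_def split: option.splits)

lemma sparse_fnn_count:
  assumes "sparse_fnn B P net"
  shows "card {p \<in> fnn_pos a b W (length net). fnn_val net p \<noteq> 0} \<le> P"
proof -
  let ?S = "SIGMA i:{..<length net}. nonzeros (net ! i)"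
  have fin: "\<forall>i\<in>{..<length net}. finite (nonzeros (net ! i))"
    using assms by (auto simp: sparse_fnn_def)
  have "{p \<in> fnn_pos a b W (length net). fnn_val net p \<noteq> 0} \<subseteq> ?S"
    by (auto simp: fnn_pos_def fnn_val_def nonzeros_def)
  then have "card {p \<in> fnn_pos a b W (length net). fnn_val net p \<noteq> 0} \<le> card ?S"
    using fin by (intro card_mono finite_SigmaI) auto
  also have "card ?S = (\<Sum>i<length net. card (nonzeros (net ! i)))"
    using fin by simp
  also have "\<dots> = (\<Sum>l\<leftarrow>net. card (nonzeros l))"
    by (simp add: sum_list_sum_nth atLeast0LessThan)
  also have "\<dots> \<le> P" using assms by (simp add: sparse_fnn_def)
  finally show ?thesis .
qed

text \<open>\<open>fnn_run\<close> recurses from the input and leaves its last layer without ReLU,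
  whereas the constructions below grow at the output end. With a ReLU after every layer, appending a
  layer has a clean rule; only the first layer sees the input dimension, hence the case
  \<open>ls = []\<close> there.\<close>

fun hidden_run :: "nat \<Rightarrow> nat \<Rightarrow> fnn \<Rightarrow> vec \<Rightarrow> vec" where
  "hidden_run c W [] x = x"
| "hidden_run c W ((M, v) # ls) x = hidden_run W W ls (relu_vec (affine W c M v x))"

lemma fnn_run_snoc:
  "fnn_run c W b (ls @ [(M, v)]) x = affine b (if ls = [] then c else W) M v (hidden_run c W ls x)"
proof (induction ls arbitrary: c x)
  case (Cons l ls)
  obtain M' v' where "l = (M', v')" by force
  then show ?case using Cons by (cases ls) auto
qed simp

lemma hidden_run_snoc:
  "hidden_run c W (ls @ [(M, v)]) x =
     relu_vec (affine W (if ls = [] then c else W) M v (hidden_run c W ls x))"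
proof (induction ls arbitrary: c x)
  case (Cons l ls)
  obtain M' v' where "l = (M', v')" by force
  then show ?case using Cons by (cases ls) auto
qed simp

text \<open>Registers are named by an arbitrary type; \<open>e\<close> and \<open>e'\<close> number
  the source and the target registers. Columns of neurons without a name vanish, so whatever such
  neurons contain is never read.\<close>

definition enc_mat :: "('w \<Rightarrow> nat) \<Rightarrow> 'w set \<Rightarrow> ('v \<Rightarrow> nat) \<Rightarrow> 'v set \<Rightarrow> ('w \<Rightarrow> 'v \<Rightarrow> real) \<Rightarrow> mat" where
  "enc_mat e' S' e S M = (\<lambda>r c. if r \<in> e' ` S' \<and> c \<in> e ` S
     then M (inv_into S' e' r) (inv_into S e c) else 0)"

definition enc_vec :: "('w \<Rightarrow> nat) \<Rightarrow> 'w set \<Rightarrow> ('w \<Rightarrow> real) \<Rightarrow> vec" where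
  "enc_vec e' S' b = (\<lambda>r. if r \<in> e' ` S' then b (inv_into S' e' r) else 0)"

lemma affine_enc:
  assumes "inj_on e S" "e ` S \<subseteq> {..<cn}" "inj_on e' S'" "e' ` S' \<subseteq> {..<rn}" "v \<in> S'"
  shows "affine rn cn (enc_mat e' S' e S M) (enc_vec e' S' b) X (e' v)
    = (\<Sum>a\<in>S. M v a * X (e a)) + b v"
proof -
  have "(\<Sum>j<cn. enc_mat e' S' e S M (e' v) j * X j) = (\<Sum>j\<in>e ` S. enc_mat e' S' e S M (e' v) j * X j)"
    using assms(2) by (intro sum.mono_neutral_right) (auto simp: enc_mat_def)
  also have "\<dots> = (\<Sum>a\<in>S. M v a * X (e a))"
    using assms by (subst sum.reindex) (auto simp: enc_mat_def intro!: sum.cong)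
  finally show ?thesis using assms by (auto simp: affine_def enc_vec_def)
qed

lemma enc_sparse:
  assumes "finite S" "finite S'"
    "\<forall>v\<in>S'. \<forall>a\<in>S. \<bar>M v a\<bar> \<le> B" "\<forall>v\<in>S'. \<bar>b v\<bar> \<le> B" "0 \<le> B"
  shows "bounded_layer B (enc_mat e' S' e S M, enc_vec e' S' b)"
    and "finite (nonzeros (enc_mat e' S' e S M, enc_vec e' S' b))"
    and "card (nonzeros (enc_mat e' S' e S M, enc_vec e' S' b)) \<le> card S' * (card S + 1)"
proof -
  let ?N = "nonzeros (enc_mat e' S' e S M, enc_vec e' S' b)"
  let ?T = "(e' ` S') \<times> insert None (Some ` e ` S)"
  show "bounded_layer B (enc_mat e' S' e S M, enc_vec e' S' b)"
    using assms(3-5) by (auto simp: bounded_layer_def enc_mat_def enc_vec_def inv_into_into)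
  have sub: "?N \<subseteq> ?T"
  proof
    fix p assume p: "p \<in> ?N"
    obtain r co where "p = (r, co)" by force
    then show "p \<in> ?T"
      using p by (cases co) (auto simp: nonzeros_def enc_mat_def enc_vec_def split: if_splits)
  qed
  have fin: "finite ?T" using assms by auto
  show "finite ?N" using sub fin by (rule finite_subset)
  have "card ?N \<le> card ?T" using sub fin by (intro card_mono)
  also have "\<dots> = card (e' ` S') * card (insert None (Some ` e ` S))" by (rule card_cartesian_product)
  also have "\<dots> \<le> card S' * (card S + 1)"
  proof (rule mult_le_mono)
    show "card (e' ` S') \<le> card S'" using assms by (simp add: card_image_le)
    have "card (insert None (Some ` e ` S)) \<le> Suc (card (Some ` e ` S))" by (rule card_insert_le_m1) auto
    also have "card (Some ` e ` S) \<le> card (e ` S)" using assms by (simp add: card_image_le)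
    also have "card (e ` S) \<le> card S" using assms by (simp add: card_image_le)
    finally show "card (insert None (Some ` e ` S)) \<le> card S + 1" by simp
  qed
  finally show "card ?N \<le> card S' * (card S + 1)" .
qed

text \<open>\<open>relu_comp W B D inp A S L P F\<close>: after \<open>L\<close> ReLU layers of width at most \<open>W\<close> with weights
  bounded by \<open>B\<close> and at most \<open>P\<close> nonzero weights, started on the registers \<open>A\<close> holding \<open>inp x\<close>,
  the registers \<open>S\<close> hold \<open>F x\<close>, for every \<open>x \<in> D\<close>.\<close>

inductive relu_comp :: "nat \<Rightarrow> real \<Rightarrow> 'x set \<Rightarrow> ('x \<Rightarrow> 'v \<Rightarrow> real) \<Rightarrow> 'v set \<Rightarrow>
    'v set \<Rightarrow> nat \<Rightarrow> nat \<Rightarrow> ('x \<Rightarrow> 'v \<Rightarrow> real) \<Rightarrow> bool"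
  for W B D inp A where
  init: "relu_comp W B D inp A A 0 0 inp"
| layer: "relu_comp W B D inp A S L P F \<Longrightarrow> finite S' \<Longrightarrow> card S' \<le> W \<Longrightarrow>
    (\<And>v a. v \<in> S' \<Longrightarrow> a \<in> S \<Longrightarrow> \<bar>M v a\<bar> \<le> B) \<Longrightarrow> (\<And>v. v \<in> S' \<Longrightarrow> \<bar>b v\<bar> \<le> B) \<Longrightarrow>
    P + card S' * (card S + 1) \<le> P' \<Longrightarrow>
    (\<And>x v. x \<in> D \<Longrightarrow> v \<in> S' \<Longrightarrow> G x v = max 0 ((\<Sum>a\<in>S. M v a * F x a) + b v)) \<Longrightarrow>
    relu_comp W B D inp A S' (Suc L) P' G"
| restrict: "relu_comp W B D inp A S L P F \<Longrightarrow> S' \<subseteq> S \<Longrightarrow>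
    (\<And>x v. x \<in> D \<Longrightarrow> v \<in> S' \<Longrightarrow> G x v = F x v) \<Longrightarrow> relu_comp W B D inp A S' L P G"

text \<open>Induction over the derivation. Each new layer picks its own numbering of the registers;
  \<open>restrict\<close> keeps the network and the numbering and only forgets names. The input
  numbering \<open>e0\<close> is prescribed, because it says in which rows of a matrix column the
  inputs are found.\<close>

lemma relu_comp_hidden:
  assumes "relu_comp W B D inp A S L P F" "finite A" "inj_on e0 A" "e0 ` A \<subseteq> {..<a}" "0 \<le> B"
  shows "finite S \<and> (\<exists>ls e. length ls = L \<and> sparse_fnn B P ls \<and> inj_on e S \<and>
     e ` S \<subseteq> {..<(if L = 0 then a else W)} \<and>
     (\<forall>x\<in>D. \<forall>X. (\<forall>v\<in>A. X (e0 v) = inp x v) \<longrightarrow>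
        (\<forall>v\<in>S. hidden_run a W ls X (e v) = F x v)))"
  using assms(1)
proof induction
  case init
  have "sparse_fnn B 0 []" by (simp add: sparse_fnn_def)
  moreover have "\<forall>x\<in>D. \<forall>X. (\<forall>v\<in>A. X (e0 v) = inp x v) \<longrightarrow> (\<forall>v\<in>A. hidden_run a W [] X (e0 v) = inp x v)"
    by simp
  moreover have "e0 ` A \<subseteq> {..<(if (0::nat) = 0 then a else W)}" using assms(4) by simp
  ultimately show ?case using assms(2,3)
    by (intro conjI exI[of _ "[]"] exI[of _ e0]) (assumption | rule list.size(3))+
next
  case (layer S L P F S' M b P' G)
  from layer.IH obtain ls e where fS: "finite S" and ls: "length ls = L" "sparse_fnn B P ls" "inj_on e S"
     "e ` S \<subseteq> {..<(if L = 0 then a else W)}"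
     "\<forall>x\<in>D. \<forall>X. (\<forall>v\<in>A. X (e0 v) = inp x v) \<longrightarrow> (\<forall>v\<in>S. hidden_run a W ls X (e v) = F x v)"
    by (elim conjE exE)
  obtain e' where e': "bij_betw e' S' {0..<card S'}"
    using ex_bij_betw_finite_nat[OF layer.hyps(2)] by blast
  have inj': "inj_on e' S'" and im': "e' ` S' \<subseteq> {..<W}"
    using e' layer.hyps(3) by (auto simp: bij_betw_def)
  let ?l = "(enc_mat e' S' e S M, enc_vec e' S' b)"
  have "\<forall>v\<in>S'. \<forall>a\<in>S. \<bar>M v a\<bar> \<le> B" "\<forall>v\<in>S'. \<bar>b v\<bar> \<le> B"
    using layer.hyps(4,5) by simp_all
  note sp = enc_sparse[OF fS layer.hyps(2) this assms(5), where e = e and e' = e']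
  have "sparse_fnn B P' (ls @ [?l])"
    using sp ls(2) layer.hyps(6) by (auto simp: sparse_fnn_def)
  moreover have "hidden_run a W (ls @ [?l]) X (e' v) = G x v"
    if "x \<in> D" "\<forall>v\<in>A. X (e0 v) = inp x v" "v \<in> S'" for x X v
  proof -
    have "hidden_run a W (ls @ [?l]) X (e' v) =
       max ((\<Sum>a'\<in>S. M v a' * hidden_run a W ls X (e a')) + b v) 0"
      unfolding hidden_run_snoc relu_vec_def
      by (subst affine_enc[OF ls(3) _ inj' im' that(3)]) (use ls(1,4) in auto)
    also have "(\<Sum>a'\<in>S. M v a' * hidden_run a W ls X (e a')) = (\<Sum>a'\<in>S. M v a' * F x a')"
      using ls(5)[rule_format, OF that(1), of X] that(2) by (intro sum.cong) simp_all
    also have "max (\<dots> + b v) 0 = G x v"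
      using layer.hyps(7)[OF that(1,3)] by (simp add: max.commute)
    finally show ?thesis .
  qed
  moreover have "length (ls @ [?l]) = Suc L" "e' ` S' \<subseteq> {..<(if Suc L = 0 then a else W)}"
    using ls(1) im' by simp_all
  ultimately show ?case using layer.hyps(2) inj'
    by (intro conjI exI[of _ "ls @ [?l]"] exI[of _ e']) (assumption | blast)+
next
  case (restrict S L P F S' G)
  from restrict.IH obtain ls e where fS: "finite S" and ls: "length ls = L" "sparse_fnn B P ls" "inj_on e S"
     "e ` S \<subseteq> {..<(if L = 0 then a else W)}"
     "\<forall>x\<in>D. \<forall>X. (\<forall>v\<in>A. X (e0 v) = inp x v) \<longrightarrow> (\<forall>v\<in>S. hidden_run a W ls X (e v) = F x v)"
    by (elim conjE exE)
  have "finite S'" "inj_on e S'" "e ` S' \<subseteq> {..<(if L = 0 then a else W)}"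
    using finite_subset[OF restrict.hyps(2) fS] inj_on_subset[OF ls(3) restrict.hyps(2)]
      order_trans[OF image_mono[OF restrict.hyps(2)] ls(4)] by simp_all
  moreover have "\<forall>x\<in>D. \<forall>X. (\<forall>v\<in>A. X (e0 v) = inp x v) \<longrightarrow> (\<forall>v\<in>S'. hidden_run a W ls X (e v) = G x v)"
    using ls(5) restrict.hyps(2,3) by (simp add: subset_iff)
  ultimately show ?case using ls(1,2) by blast
qed

text \<open>Appends the affine output layer. It carries no ReLU, so signed combinations of the
  registers survive only here.\<close>

lemma relu_comp_fnn:
  assumes "relu_comp W B D inp A S L P F" "finite A" "inj_on e0 A" "e0 ` A \<subseteq> {..<a}" "0 \<le> B"
    and "\<And>i v. i < b \<Longrightarrow> v \<in> S \<Longrightarrow> \<bar>M i v\<bar> \<le> B" "\<And>i. i < b \<Longrightarrow> \<bar>c i\<bar> \<le> B"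
  shows "\<exists>net. length net = Suc L \<and> sparse_fnn B (P + b * (card S + 1)) net \<and>
     (\<forall>x\<in>D. \<forall>X. (\<forall>v\<in>A. X (e0 v) = inp x v) \<longrightarrow>
        (\<forall>i<b. fnn_eval a b W net X i = (\<Sum>v\<in>S. M i v * F x v) + c i))"
proof -
  from relu_comp_hidden[OF assms(1-5)] obtain ls e where fS: "finite S" and
     ls: "length ls = L" "sparse_fnn B P ls" "inj_on e S" "e ` S \<subseteq> {..<(if L = 0 then a else W)}"
     "\<forall>x\<in>D. \<forall>X. (\<forall>v\<in>A. X (e0 v) = inp x v) \<longrightarrow> (\<forall>v\<in>S. hidden_run a W ls X (e v) = F x v)"
    by (elim conjE exE)
  let ?l = "(enc_mat (\<lambda>i. i) {..<b} e S M, enc_vec (\<lambda>i. i) {..<b} c)"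
  have "\<forall>i\<in>{..<b}. \<forall>v\<in>S. \<bar>M i v\<bar> \<le> B" "\<forall>i\<in>{..<b}. \<bar>c i\<bar> \<le> B"
    using assms(6,7) by simp_all
  note sp = enc_sparse[OF fS finite_lessThan this assms(5), where e = e and e' = "\<lambda>i. i"]
  have "sparse_fnn B (P + b * (card S + 1)) (ls @ [?l])"
    using sp ls(2) unfolding sparse_fnn_def by (auto intro: add_mono)
  moreover have "fnn_eval a b W (ls @ [?l]) X i = (\<Sum>v\<in>S. M i v * F x v) + c i"
    if "x \<in> D" "\<forall>v\<in>A. X (e0 v) = inp x v" "i < b" for x X i
  proof -
    have "fnn_eval a b W (ls @ [?l]) X i = (\<Sum>v\<in>S. M i v * hidden_run a W ls X (e v)) + c i"
      unfolding fnn_run_snoc fnn_eval_def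
      using affine_enc[OF ls(3), of "if ls = [] then a else W" "\<lambda>i. i" "{..<b}" b i M c] ls(1,4) that(3)
      by auto
    also have "(\<Sum>v\<in>S. M i v * hidden_run a W ls X (e v)) = (\<Sum>v\<in>S. M i v * F x v)"
      using ls(5)[rule_format, OF that(1), of X] that(2) by (intro sum.cong) simp_all
    finally show ?thesis .
  qed
  moreover have "length (ls @ [?l]) = Suc L" using ls(1) by simp
  ultimately show ?thesis by blast
qed

section \<open>Approximate multiplication\<close>

text \<open>The tent map in ReLU form. On the unit interval the outer maximum is inactive; it makes
  the map the output of a ReLU neuron.\<close>

definition tooth :: "real \<Rightarrow> real" where
  "tooth z = max 0 (2 * z - 4 * max 0 (z - 1/2))"

text \<open>This is the piecewise linear interpolant of the square at the multiples of
  \<open>1 / 2 ^ k\<close>; by convexity it lies above the square.\<close>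

definition sq_approx :: "nat \<Rightarrow> real \<Rightarrow> real" where
  "sq_approx k z = z - (\<Sum>j<k. (tooth ^^ Suc j) z / 4 ^ Suc j)"

text \<open>Polarisation through the midpoint \<open>(x + y) / 2\<close>, which stays in the unit
  interval, where \<open>sq_approx\<close> is accurate. The two nested maxima clip the result to the
  unit interval, so that products can be fed into further products.\<close>

definition mul_approx :: "nat \<Rightarrow> real \<Rightarrow> real \<Rightarrow> real" where
  "mul_approx k x y = max 0 (1 - max 0 (1 - 2 * sq_approx k ((x + y) / 2) + sq_approx k x / 2
     + sq_approx k y / 2))"

definition word_approx :: "nat \<Rightarrow> ('i \<Rightarrow> real) \<Rightarrow> 'i list \<Rightarrow> real \<Rightarrow> real" where
  "word_approx k y w c = foldr (\<lambda>i. mul_approx k (y i)) w c"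

lemma tooth_iter_unit: "0 \<le> z \<Longrightarrow> z \<le> 1 \<Longrightarrow> 0 \<le> (tooth ^^ k) z \<and> (tooth ^^ k) z \<le> 1"
  by (induction k) (auto simp: tooth_def max_def)

text \<open>With \<open>h z = z - z\<^sup>2\<close> and the tooth map \<open>g z = 2 min z (1 - z)\<close> one has
  \<open>h z = g z / 4 + h (g z) / 4\<close>; iterating this gives the remainder.\<close>

lemma sq_approx_remainder:
  assumes "0 \<le> z" "z \<le> 1"
  shows "sq_approx k z = z\<^sup>2 + ((tooth ^^ k) z - ((tooth ^^ k) z)\<^sup>2) / 4 ^ k"
proof (induction k)
  case (Suc k)
  let ?t = "(tooth ^^ k) z"
  have t: "0 \<le> ?t" "?t \<le> 1" using tooth_iter_unit[OF assms] by auto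
  have h: "?t - ?t\<^sup>2 = tooth ?t / 4 + (tooth ?t - (tooth ?t)\<^sup>2) / 4"
    using t by (auto simp: tooth_def max_def power2_eq_square field_simps)
  have "sq_approx (Suc k) z = sq_approx k z - tooth ?t / 4 ^ Suc k"
    by (simp add: sq_approx_def)
  also have "\<dots> = z\<^sup>2 + (tooth ?t / 4 + (tooth ?t - (tooth ?t)\<^sup>2) / 4) / 4 ^ k - tooth ?t / 4 ^ Suc k"
    unfolding Suc.IH h ..
  also have "\<dots> = z\<^sup>2 + (tooth ?t - (tooth ?t)\<^sup>2) / 4 ^ Suc k"
    by (simp add: field_simps)
  finally show ?case by simp
qed (simp add: sq_approx_def)

lemma sq_approx_bounds:
  assumes "0 \<le> z" "z \<le> 1"
  shows "z\<^sup>2 \<le> sq_approx k z" "sq_approx k z \<le> z\<^sup>2 + (1/4) * (1/4) ^ k"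
proof -
  let ?t = "(tooth ^^ k) z"
  have t: "0 \<le> ?t" "?t \<le> 1" using tooth_iter_unit[OF assms] by auto
  have "0 \<le> ?t * (1 - ?t)" using t by simp
  then show "z\<^sup>2 \<le> sq_approx k z"
    by (simp add: sq_approx_remainder[OF assms] power2_eq_square algebra_simps)
  have "0 \<le> (?t - 1/2)\<^sup>2" by simp
  then have "?t - ?t\<^sup>2 \<le> 1/4" by (simp add: power2_eq_square algebra_simps)
  then have "(?t - ?t\<^sup>2) / 4 ^ k \<le> (1/4) / 4 ^ k" by (intro divide_right_mono) auto
  then show "sq_approx k z \<le> z\<^sup>2 + (1/4) * (1/4) ^ k"
    by (simp add: sq_approx_remainder[OF assms] power_one_over)
qed

lemma mul_approx_unit: "0 \<le> mul_approx k x y" "mul_approx k x y \<le> 1"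
  by (auto simp: mul_approx_def)

text \<open>Every square is overestimated by at most \<open>(1/4) * (1/4) ^ k\<close>; the weights
  2, 1/2 and 1/2 keep the total below \<open>(1/4) ^ k\<close>. The clip cannot increase the
  distance to \<open>x * y\<close>, which lies in the unit interval itself.\<close>

lemma mul_approx_error:
  assumes "0 \<le> x" "x \<le> 1" "0 \<le> y" "y \<le> 1"
  shows "\<bar>mul_approx k x y - x * y\<bar> \<le> (1/4) ^ k"
proof -
  let ?z = "2 * sq_approx k ((x + y) / 2) - sq_approx k x / 2 - sq_approx k y / 2"
  have e: "x * y = 2 * ((x + y) / 2)\<^sup>2 - x\<^sup>2 / 2 - y\<^sup>2 / 2"
    by (simp add: power2_eq_square field_simps)
  have b: "\<bar>?z - x * y\<bar> \<le> (1/4) ^ k"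
    using sq_approx_bounds[of x k] sq_approx_bounds[of y k] sq_approx_bounds[of "(x + y) / 2" k] assms
    unfolding e abs_le_iff by simp
  have "0 \<le> x * y" "x * y \<le> 1" using assms by (auto intro: mult_le_one)
  then show ?thesis using b unfolding mul_approx_def by (auto simp: max_def abs_if)
qed

lemma word_approx_unit:
  assumes "0 \<le> c" "c \<le> 1"
  shows "0 \<le> word_approx k y w c" "word_approx k y w c \<le> 1"
  using assms mul_approx_unit by (cases w; auto simp: word_approx_def)+

text \<open>All factors are at most 1, so the error of the inner word is not amplified and the
  errors of the single multiplications merely add up.\<close>

lemma word_approx_error:
  assumes "0 \<le> c" "c \<le> 1" "\<And>i. i \<in> set w \<Longrightarrow> 0 \<le> y i \<and> y i \<le> 1"
  shows "\<bar>word_approx k y w c - prod_list (map y w) * c\<bar> \<le> length w * (1/4) ^ k"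
  using assms(3)
proof (induction w)
  case (Cons i w)
  let ?v = "word_approx k y w c" and ?p = "prod_list (map y w) * c"
  have y: "0 \<le> y i" "y i \<le> 1" using Cons.prems by auto
  have 1: "\<bar>mul_approx k (y i) ?v - y i * ?v\<bar> \<le> (1/4) ^ k"
    using y word_approx_unit[OF assms(1,2)] by (intro mul_approx_error) auto
  have "\<bar>y i * ?v - y i * ?p\<bar> \<le> 1 * \<bar>?v - ?p\<bar>"
    unfolding right_diff_distrib[symmetric] abs_mult using y by (intro mult_right_mono) auto
  also have "\<dots> \<le> length w * (1/4) ^ k" using Cons by auto
  finally have 2: "\<bar>y i * ?v - y i * ?p\<bar> \<le> length w * (1/4) ^ k" .
  have "\<bar>mul_approx k (y i) ?v - y i * ?p\<bar> \<le>
      \<bar>mul_approx k (y i) ?v - y i * ?v\<bar> + \<bar>y i * ?v - y i * ?p\<bar>"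
    by (rule order_trans[OF eq_refl abs_triangle_ineq]) simp
  also have "\<dots> \<le> (1/4) ^ k + length w * (1/4) ^ k" using 1 2 by (rule add_mono)
  finally have "\<bar>mul_approx k (y i) ?v - y i * ?p\<bar> \<le> (1/4) ^ k + length w * (1/4) ^ k" .
  then show ?case by (simp add: word_approx_def algebra_simps)
qed (simp add: word_approx_def)

section \<open>Straight-line programs with one ReLU layer per instruction\<close>

lemma sum_list_select:
  fixes G :: "'v \<Rightarrow> real"
  assumes "finite S" "fst ` set cs \<subseteq> S"
  shows "(\<Sum>a\<in>S. (\<Sum>(a', c)\<leftarrow>cs. if a' = a then c else 0) * G a) = (\<Sum>(a, c)\<leftarrow>cs. c * G a)"
  using assms(2)
proof (induction cs)
  case (Cons ac cs)
  have "(\<Sum>a\<in>S. (if fst ac = a then snd ac else 0) * G a) = (\<Sum>a\<in>S. if fst ac = a then snd ac * G a else 0)"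
    by (intro sum.cong) auto
  also have "\<dots> = snd ac * G (fst ac)" using assms(1) Cons.prems by simp
  finally show ?case using Cons
    by (simp add: distrib_right sum.distrib case_prod_beta)
qed simp

lemma sum_list_select_abs:
  fixes cs :: "('v \<times> real) list"
  shows "\<bar>\<Sum>(a', c)\<leftarrow>cs. if a' = a then c else 0\<bar> \<le> (\<Sum>(a', c)\<leftarrow>cs. \<bar>c\<bar>)"
  by (induction cs) auto

text \<open>\<open>L0\<close> and \<open>P0\<close> are the layers and parameters spent beforehand.
  \<open>R\<close> bounds the live registers, so an instruction costs at most
  \<open>R * (R + 1)\<close> parameters. The 6 is the largest absolute row sum of an instruction,
  that of \<open>2 * t - 4 * w\<close> in the tent map. Infinitely many names guarantee fresh
  temporaries.\<close>

locale relu_program =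
  fixes W R L0 P0 :: nat and B :: real and D :: "'x set" and inp :: "'x \<Rightarrow> 'v \<Rightarrow> real" and A :: "'v set"
  assumes fin_A: "finite A" and B6: "6 \<le> B" and RW: "R \<le> W" and inf: "infinite (UNIV :: 'v set)"
begin

definition prog :: "nat \<Rightarrow> 'v set \<Rightarrow> ('x \<Rightarrow> 'v \<Rightarrow> real) \<Rightarrow> bool" where
  "prog l S F \<longleftrightarrow> relu_comp W B D inp A S (L0 + l) (P0 + l * (R * (R + 1))) F \<and>
     finite S \<and> card S \<le> R \<and> (\<forall>x\<in>D. \<forall>v\<in>S. 0 \<le> F x v)"

lemma prog_weaken:
  assumes "prog l S F" "S' \<subseteq> S" "\<And>x v. x \<in> D \<Longrightarrow> v \<in> S' \<Longrightarrow> G x v = F x v"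
  shows "prog l S' G"
proof -
  have "card S' \<le> R" using assms card_mono[of S S'] by (auto simp: prog_def)
  moreover have "finite S'" using assms by (auto simp: prog_def intro: finite_subset)
  moreover have "relu_comp W B D inp A S' (L0 + l) (P0 + l * (R * (R + 1))) G"
    using assms by (auto simp: prog_def intro: relu_comp.restrict)
  ultimately show ?thesis using assms by (auto simp: prog_def subset_iff)
qed

text \<open>One layer computes the new value of \<open>v\<close>; every other register is copied by
  a unit row, which the ReLU leaves unchanged because contents are nonnegative. The target may
  already belong to \<open>S\<close>, and a register listed twice in \<open>cs\<close> contributes
  the sum of its weights.\<close>

lemma prog_assign:
  assumes "prog l S F" "fst ` set cs \<subseteq> S" "(\<Sum>(a, c)\<leftarrow>cs. \<bar>c\<bar>) \<le> 6" "\<bar>b\<bar> \<le> 6"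
    "S' = insert v S" "card S' \<le> R"
    and Gv: "\<And>x. x \<in> D \<Longrightarrow> G x v = max 0 (b + (\<Sum>(a, c)\<leftarrow>cs. c * F x a))"
    and Gu: "\<And>x u. x \<in> D \<Longrightarrow> u \<in> S \<Longrightarrow> u \<noteq> v \<Longrightarrow> G x u = F x u"
  shows "prog (Suc l) S' G"
proof -
  have fS: "finite S" and rc: "relu_comp W B D inp A S (L0 + l) (P0 + l * (R * (R + 1))) F"
    and cS: "card S \<le> R" and nn: "\<And>x v. x \<in> D \<Longrightarrow> v \<in> S \<Longrightarrow> 0 \<le> F x v"
    using assms(1) by (auto simp: prog_def)
  define M where "M u a = (if u = v then (\<Sum>(a', c)\<leftarrow>cs. if a' = a then c else 0)
      else if u = a then 1 else (0::real))" for u a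
  define b' where "b' u = (if u = v then b else 0)" for u
  have "relu_comp W B D inp A S' (Suc (L0 + l)) (P0 + Suc l * (R * (R + 1))) G"
  proof (rule relu_comp.layer[OF rc, where M = M and b = b'])
    show "finite S'" using fS assms(5) by simp
    show "card S' \<le> W" using assms(6) RW by simp
    show "\<bar>M u a\<bar> \<le> B" if "a \<in> S" for u a
      using order_trans[OF sum_list_select_abs assms(3), of a] B6 by (auto simp: M_def)
    show "\<bar>b' u\<bar> \<le> B" for u using assms(4) B6 by (auto simp: b'_def)
    show "P0 + l * (R * (R + 1)) + card S' * (card S + 1) \<le> P0 + Suc l * (R * (R + 1))"
      using mult_le_mono[OF assms(6), of "card S + 1" "R + 1"] cS by simp
    show "G x u = max 0 ((\<Sum>a\<in>S. M u a * F x a) + b' u)" if "x \<in> D" "u \<in> S'" for x u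
    proof (cases "u = v")
      case True
      then show ?thesis using sum_list_select[OF fS assms(2), of "F x"] Gv[OF that(1)]
        by (simp add: M_def b'_def add.commute)
    next
      case False
      then have u: "u \<in> S" using that assms(5) by simp
      have "(\<Sum>a\<in>S. M u a * F x a) = (\<Sum>a\<in>S. if u = a then F x a else 0)"
        using False by (intro sum.cong) (auto simp: M_def)
      also have "\<dots> = F x u" using fS u by simp
      finally show ?thesis using nn[OF that(1) u] False Gu[OF that(1) u] by (simp add: b'_def)
    qed
  qed
  moreover have "0 \<le> G x u" if "x \<in> D" "u \<in> S'" for x u
    using that nn Gv Gu assms(5) by (cases "u = v") auto
  ultimately show ?thesis using fS assms(5,6) by (auto simp: prog_def)
qed

lemma fresh:
  assumes "finite S"
  obtains v where "v \<notin> (S :: 'v set)"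
  using assms inf ex_new_if_finite by blast

text \<open>Two layers copy \<open>z\<close> into \<open>r\<close> (partial result) and
  \<open>t\<close> (iterated tent map). Each round takes three: \<open>w\<close> receives the kink
  of the tent map at 1/2, then \<open>r\<close> is corrected, then \<open>t\<close> is advanced. In
  this order both updates still see the old \<open>t\<close>.\<close>

lemma prog_sq:
  assumes "prog l S F" "z \<in> S" "r \<notin> S" "card S + 3 \<le> R"
    and u: "\<And>x. x \<in> D \<Longrightarrow> 0 \<le> F x z \<and> F x z \<le> 1"
    and G: "\<And>x. x \<in> D \<Longrightarrow> G x r = sq_approx k (F x z)"
      "\<And>x u. x \<in> D \<Longrightarrow> u \<in> S \<Longrightarrow> u \<noteq> r \<Longrightarrow> G x u = F x u"
  shows "prog (l + 3 * k + 2) (insert r S) G"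
proof -
  have fS: "finite S" using assms(1) by (simp add: prog_def)
  obtain t where t: "t \<notin> insert r S" using fresh[of "insert r S"] fS by auto
  obtain w where w: "w \<notin> insert t (insert r S)" using fresh[of "insert t (insert r S)"] fS by auto
  have "prog (l + 3 * k + 2) (insert t (insert r S))
      (\<lambda>x. (F x)(r := sq_approx k (F x z), t := (tooth ^^ k) (F x z)))"
  proof (induction k)
    case 0
    have "prog (Suc l) (insert r S) (\<lambda>x. (F x)(r := F x z))"
      by (rule prog_assign[OF assms(1), of "[(z, 1)]" 0 _ r]) (use assms(2-4) u fS in auto)
    then have "prog (Suc (Suc l)) (insert t (insert r S)) (\<lambda>x. (F x)(r := F x z, t := F x z))"
      by (rule prog_assign[of _ _ _ "[(z, 1)]" 0 _ t]) (use assms(2-4) u fS t in auto)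
    then have "prog (l + 3 * 0 + 2) (insert t (insert r S)) (\<lambda>x. (F x)(r := F x z, t := F x z))" by simp
    then show ?case by (rule prog_weaken) (simp_all add: sq_approx_def)
  next
    case (Suc k)
    let ?S = "insert t (insert r S)"
    define T where "T x = (tooth ^^ k) (F x z)" for x
    define Z where "Z x = sq_approx k (F x z)" for x
    define K :: real where "K = 1 / (4 * 4 ^ k)"
    have "(1::real) \<le> 4 ^ k" by simp
    then have K: "0 \<le> K" "K \<le> 1/4" by (auto simp: K_def field_simps)
    \<comment> \<open>The next partial result is again an upper bound of the square of
      \<open>F x z\<close>, hence nonnegative, and the ReLU of the update does not truncate
      it.\<close>
    have Z: "0 \<le> Z x - K * tooth (T x)" if "x \<in> D" for x
      using order_trans[OF zero_le_power2 sq_approx_bounds(1)[of "F x z" "Suc k"]] u[OF that]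
      by (simp add: sq_approx_def T_def Z_def K_def)
    have T: "T x \<le> 1" if "x \<in> D" for x using tooth_iter_unit u[OF that] by (auto simp: T_def)
    have c: "card (insert w ?S) \<le> R" using assms(3,4) t w fS by simp
    have ne: "t \<noteq> r" "w \<noteq> t" "w \<noteq> r" using t w by auto
    \<comment> \<open>Without the outer maximum the tent map is linear in \<open>t\<close> and
      \<open>w\<close>, so one layer can subtract its multiple from \<open>r\<close>.\<close>
    have tt: "tooth (T x) = 2 * T x - 4 * max 0 (T x - 1/2)" if "x \<in> D" for x
      using T[OF that] tooth_iter_unit u[OF that] by (auto simp: tooth_def max_def T_def)
    have "prog (Suc (l + 3 * k + 2)) (insert w ?S)
        (\<lambda>x. (F x)(r := Z x, t := T x, w := max 0 (T x - 1/2)))"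
      by (rule prog_assign[OF Suc.IH, of "[(t, 1)]" "- 1/2" _ w])
         (use c w ne in \<open>auto simp: T_def Z_def\<close>)
    then have "prog (Suc (Suc (l + 3 * k + 2))) (insert w ?S)
        (\<lambda>x. (F x)(r := Z x - K * tooth (T x), t := T x, w := max 0 (T x - 1/2)))"
    proof (rule prog_assign[of _ _ _ "[(r, 1), (t, - (2 * K)), (w, 4 * K)]" 0 _ r])
      fix x assume x: "x \<in> D"
      let ?F = "(F x)(r := Z x, t := T x, w := max 0 (T x - 1/2))"
      have "0 + (\<Sum>(a, c)\<leftarrow>[(r, 1), (t, - (2 * K)), (w, 4 * K)]. c * ?F a) = Z x - K * tooth (T x)"
        using ne unfolding tt[OF x] by (simp add: algebra_simps)
      then show "((F x)(r := Z x - K * tooth (T x), t := T x, w := max 0 (T x - 1/2))) r =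
          max 0 (0 + (\<Sum>(a, c)\<leftarrow>[(r, 1), (t, - (2 * K)), (w, 4 * K)]. c * ?F a))"
        using ne Z[OF x] by simp
    qed (use c ne K in auto)
    then have "prog (Suc (Suc (Suc (l + 3 * k + 2)))) (insert w ?S)
        (\<lambda>x. (F x)(r := Z x - K * tooth (T x), t := tooth (T x), w := max 0 (T x - 1/2)))"
      by (rule prog_assign[of _ _ _ "[(t, 2), (w, - 4)]" 0 _ t])
         (use c ne in \<open>auto simp: tooth_def\<close>)
    moreover have "Suc (Suc (Suc (l + 3 * k + 2))) = l + 3 * Suc k + 2" by simp
    ultimately have "prog (l + 3 * Suc k + 2) (insert w ?S)
        (\<lambda>x. (F x)(r := Z x - K * tooth (T x), t := tooth (T x), w := max 0 (T x - 1/2)))"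
      by (simp only:)
    then show ?case
      by (rule prog_weaken) (use w ne in \<open>auto simp: sq_approx_def T_def Z_def K_def\<close>)
  qed
  then show ?thesis by (rule prog_weaken) (use t G in auto)
qed

text \<open>Depth: one layer for the midpoint, \<open>3 * k + 2\<close> for each of the three
  squares, and one for each of the two nested maxima.\<close>

lemma prog_mul:
  assumes "prog l S F" "i \<in> S" "j \<in> S" "r \<notin> S" "card S + 8 \<le> R"
    and u: "\<And>x. x \<in> D \<Longrightarrow> 0 \<le> F x i \<and> F x i \<le> 1" "\<And>x. x \<in> D \<Longrightarrow> 0 \<le> F x j \<and> F x j \<le> 1"
  shows "prog (l + 9 * k + 9) (insert r S) (\<lambda>x. (F x)(r := mul_approx k (F x i) (F x j)))"
proof -
  have fS: "finite S" using assms(1) by (simp add: prog_def)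
  obtain t where t: "t \<notin> insert r S" using fresh[of "insert r S"] fS by auto
  obtain q0 where q0: "q0 \<notin> insert t (insert r S)" using fresh[of "insert t (insert r S)"] fS by auto
  obtain q1 where q1: "q1 \<notin> insert q0 (insert t (insert r S))"
    using fresh[of "insert q0 (insert t (insert r S))"] fS by auto
  obtain q2 where q2: "q2 \<notin> insert q1 (insert q0 (insert t (insert r S)))"
    using fresh[of "insert q1 (insert q0 (insert t (insert r S)))"] fS by auto
  obtain c where c: "c \<notin> insert q2 (insert q1 (insert q0 (insert t (insert r S))))"
    using fresh[of "insert q2 (insert q1 (insert q0 (insert t (insert r S))))"] fS by auto
  have ij: "i \<noteq> t" "j \<noteq> t" "i \<noteq> q0" "j \<noteq> q0" "i \<noteq> q1" "j \<noteq> q1" "i \<noteq> q2" "j \<noteq> q2"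
    using assms(2,3) t q0 q1 q2 by auto
  define h where "h x = (F x i + F x j) / 2" for x
  define Q where "Q x = sq_approx k (h x)" for x
  have h: "0 \<le> h x \<and> h x \<le> 1" if "x \<in> D" for x using u[OF that] by (auto simp: h_def)
  have "prog (Suc l) (insert t S) (\<lambda>x. (F x)(t := h x))"
    by (rule prog_assign[OF assms(1), of "[(i, 1/2), (j, 1/2)]" 0 _ t])
       (use assms(2-5) h fS t in \<open>auto simp: h_def field_simps\<close>)
  then have "prog (Suc l + 3 * k + 2) (insert q0 (insert t S)) (\<lambda>x. (F x)(t := h x, q0 := Q x))"
    by (rule prog_sq[of _ _ _ t]) (use h q0 t assms(5) fS in \<open>auto simp: Q_def\<close>)
  then have "prog (Suc l + 3 * k + 2 + 3 * k + 2) (insert q1 (insert q0 (insert t S)))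
     (\<lambda>x. (F x)(t := h x, q0 := Q x, q1 := sq_approx k (F x i)))"
    by (rule prog_sq[of _ _ _ i]) (use q0 q1 t assms(2,5) u fS ij in auto)
  then have "prog (Suc l + 3 * k + 2 + 3 * k + 2 + 3 * k + 2) (insert q2 (insert q1 (insert q0 (insert t S))))
     (\<lambda>x. (F x)(t := h x, q0 := Q x, q1 := sq_approx k (F x i), q2 := sq_approx k (F x j)))"
    by (rule prog_sq[of _ _ _ j]) (use q0 q1 q2 t assms(3,5) u fS ij in auto)
  then have "prog (Suc (Suc l + 3 * k + 2 + 3 * k + 2 + 3 * k + 2))
      (insert c (insert q2 (insert q1 (insert q0 (insert t S)))))
     (\<lambda>x. (F x)(t := h x, q0 := Q x, q1 := sq_approx k (F x i), q2 := sq_approx k (F x j),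
        c := max 0 (1 - 2 * Q x + sq_approx k (F x i) / 2 + sq_approx k (F x j) / 2)))"
    by (rule prog_assign[of _ _ _ "[(q0, - 2), (q1, 1/2), (q2, 1/2)]" 1 _ c])
       (use c q0 q1 q2 t assms(5) fS in auto)
  then have "prog (Suc (Suc (Suc l + 3 * k + 2 + 3 * k + 2 + 3 * k + 2)))
      (insert r (insert c (insert q2 (insert q1 (insert q0 (insert t S))))))
     (\<lambda>x. (F x)(t := h x, q0 := Q x, q1 := sq_approx k (F x i), q2 := sq_approx k (F x j),
        c := max 0 (1 - 2 * Q x + sq_approx k (F x i) / 2 + sq_approx k (F x j) / 2),
        r := mul_approx k (F x i) (F x j)))"
    by (rule prog_assign[of _ _ _ "[(c, - 1)]" 1 _ r])
       (use c q0 q1 q2 t assms(4,5) fS in \<open>auto simp: mul_approx_def Q_def h_def\<close>)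
  then have "prog (Suc (Suc (Suc l + 3 * k + 2 + 3 * k + 2 + 3 * k + 2))) (insert r S)
      (\<lambda>x. (F x)(r := mul_approx k (F x i) (F x j)))"
    by (rule prog_weaken) (use c q0 q1 q2 t in auto)
  moreover have "Suc (Suc (Suc l + 3 * k + 2 + 3 * k + 2 + 3 * k + 2)) = l + 9 * k + 9" by simp
  ultimately show ?thesis by (simp only:)
qed

text \<open>The innermost product comes first. The register of a partial product is dropped once it
  has been used, so the number of live registers does not grow with the length of the word.\<close>

lemma prog_word:
  assumes "prog l S F" "c \<in> S" "r \<notin> S" "card S + 9 \<le> R" "yr ` set w \<subseteq> S"
    and u: "\<And>x. x \<in> D \<Longrightarrow> 0 \<le> F x c \<and> F x c \<le> 1"
      "\<And>x i. x \<in> D \<Longrightarrow> i \<in> set w \<Longrightarrow> 0 \<le> F x (yr i) \<and> F x (yr i) \<le> 1"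
  shows "prog (l + length w * (9 * k + 9) + 1) (insert r S)
     (\<lambda>x. (F x)(r := word_approx k (\<lambda>i. F x (yr i)) w (F x c)))"
  using assms(3,5) u(2)
proof (induction w arbitrary: r)
  case Nil
  have fS: "finite S" using assms(1) by (simp add: prog_def)
  have "prog (Suc l) (insert r S) (\<lambda>x. (F x)(r := word_approx k (\<lambda>i. F x (yr i)) [] (F x c)))"
    by (rule prog_assign[OF assms(1), of "[(c, 1)]" 0 _ r])
       (use assms(2,4) Nil u(1) fS in \<open>auto simp: word_approx_def\<close>)
  then show ?case by (simp only: list.size mult_0 add_0_right Suc_eq_plus1)
next
  case (Cons i w)
  have fS: "finite S" using assms(1) by (simp add: prog_def)
  obtain r' where r': "r' \<notin> insert r S" using fresh[of "insert r S"] fS by auto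
  have i: "yr i \<in> S" using Cons.prems by auto
  let ?V = "\<lambda>x. word_approx k (\<lambda>i. F x (yr i)) w (F x c)"
  have IH: "prog (l + length w * (9 * k + 9) + 1) (insert r' S) (\<lambda>x. (F x)(r' := ?V x))"
    by (rule Cons.IH) (use Cons.prems r' in simp_all)
  have "prog (l + length w * (9 * k + 9) + 1 + 9 * k + 9) (insert r (insert r' S))
    (\<lambda>x. ((F x)(r' := ?V x))(r := mul_approx k (((F x)(r' := ?V x)) (yr i)) (((F x)(r' := ?V x)) r')))"
  proof (rule prog_mul[OF IH])
    show "0 \<le> ((F x)(r' := ?V x)) r' \<and> ((F x)(r' := ?V x)) r' \<le> 1" if "x \<in> D" for x
      using u(1)[OF that] word_approx_unit[of "F x c" k "\<lambda>i. F x (yr i)" w] by simp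
    show "0 \<le> ((F x)(r' := ?V x)) (yr i) \<and> ((F x)(r' := ?V x)) (yr i) \<le> 1" if "x \<in> D" for x
      using Cons.prems(3)[OF that, of i] i r' by auto
  qed (use i r' Cons.prems(1) assms(4) fS in auto)
  then have "prog (l + length w * (9 * k + 9) + 1 + 9 * k + 9) (insert r S)
     (\<lambda>x. (F x)(r := word_approx k (\<lambda>i. F x (yr i)) (i # w) (F x c)))"
    by (rule prog_weaken) (use r' i in \<open>auto simp: word_approx_def\<close>)
  moreover have "l + length w * (9 * k + 9) + 1 + 9 * k + 9 = l + length (i # w) * (9 * k + 9) + 1"
    by simp
  ultimately show ?case by (simp only:)
qed

text \<open>The words are evaluated one after the other, so their depths add up. This is affordable
  because the set of words will not depend on the accuracy. \<open>G\<close> is only pinned down on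
  the old registers and the results.\<close>

lemma prog_words:
  assumes "prog l S F" "finite J" "inj_on rv J" "rv ` J \<inter> S = {}" "card S + card J + 9 \<le> R"
    and "\<And>j. j \<in> J \<Longrightarrow> cr j \<in> S" "\<And>j. j \<in> J \<Longrightarrow> yr ` set (wd j) \<subseteq> S"
    and "\<And>x j. x \<in> D \<Longrightarrow> j \<in> J \<Longrightarrow> 0 \<le> F x (cr j) \<and> F x (cr j) \<le> 1"
      "\<And>x j i. x \<in> D \<Longrightarrow> j \<in> J \<Longrightarrow> i \<in> set (wd j) \<Longrightarrow> 0 \<le> F x (yr i) \<and> F x (yr i) \<le> 1"
  shows "\<exists>G. prog (l + (\<Sum>j\<in>J. length (wd j) * (9 * k + 9) + 1)) (S \<union> rv ` J) G \<and>
    (\<forall>x\<in>D. (\<forall>v\<in>S. G x v = F x v) \<and>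
       (\<forall>j\<in>J. G x (rv j) = word_approx k (\<lambda>i. F x (yr i)) (wd j) (F x (cr j))))"
  using assms(2-)
proof (induction J rule: finite_induct)
  case empty
  then show ?case using assms(1) by auto
next
  case (insert j J)
  have dj: "rv ` J \<inter> S = {}" using insert.prems(2) by auto
  have cj: "card S + card J + 9 \<le> R" using insert.prems(3) insert.hyps by simp
  have ij: "inj_on rv J" using insert.prems(1) by simp
  have "\<exists>G. prog (l + (\<Sum>j\<in>J. length (wd j) * (9 * k + 9) + 1)) (S \<union> rv ` J) G \<and>
    (\<forall>x\<in>D. (\<forall>v\<in>S. G x v = F x v) \<and>
       (\<forall>j\<in>J. G x (rv j) = word_approx k (\<lambda>i. F x (yr i)) (wd j) (F x (cr j))))"
  proof (rule insert.IH[OF ij dj cj])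
    fix x j' i assume "x \<in> D" "j' \<in> J" "i \<in> set (wd j')"
    then show "0 \<le> F x (yr i) \<and> F x (yr i) \<le> 1" using insert.prems(7)[of x j' i] by simp
  qed (use insert.prems(4-6) in simp_all)
  then obtain G where G1: "prog (l + (\<Sum>j\<in>J. length (wd j) * (9 * k + 9) + 1)) (S \<union> rv ` J) G"
    and G: "\<forall>x\<in>D. (\<forall>v\<in>S. G x v = F x v) \<and>
       (\<forall>j\<in>J. G x (rv j) = word_approx k (\<lambda>i. F x (yr i)) (wd j) (F x (cr j)))"
    by (elim exE conjE)
  have G2: "G x v = F x v" if "x \<in> D" "v \<in> S" for x v using G that by simp
  have G3: "G x (rv j) = word_approx k (\<lambda>i. F x (yr i)) (wd j) (F x (cr j))"
    if "x \<in> D" "j \<in> J" for x j using G that by simp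
  have cS: "cr j \<in> S" and yS: "\<And>i. i \<in> set (wd j) \<Longrightarrow> yr i \<in> S" using insert.prems by auto
  have rj: "rv j \<notin> S \<union> rv ` J" using insert.prems(1,2) insert.hyps by (auto simp: inj_on_def)
  have card: "card (S \<union> rv ` J) + 9 \<le> R"
    using insert.prems(3) insert.hyps card_Un_le[of S "rv ` J"] card_image_le[of J rv] by simp
  let ?G = "\<lambda>x. (G x)(rv j := word_approx k (\<lambda>i. G x (yr i)) (wd j) (G x (cr j)))"
  have "prog (l + (\<Sum>j\<in>J. length (wd j) * (9 * k + 9) + 1) + length (wd j) * (9 * k + 9) + 1)
     (insert (rv j) (S \<union> rv ` J)) ?G"
  proof (rule prog_word[OF G1])
    show "0 \<le> G x (cr j) \<and> G x (cr j) \<le> 1" if "x \<in> D" for x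
      using insert.prems(6)[OF that, of j] G2[OF that cS] by simp
    show "0 \<le> G x (yr i) \<and> G x (yr i) \<le> 1" if "x \<in> D" "i \<in> set (wd j)" for x i
      using insert.prems(7)[OF that(1), of j i] G2[OF that(1) yS[OF that(2)]] that(2) by simp
  qed (use cS yS rj card in auto)
  moreover have "l + (\<Sum>j\<in>J. length (wd j) * (9 * k + 9) + 1) + length (wd j) * (9 * k + 9) + 1
     = l + (\<Sum>j\<in>insert j J. length (wd j) * (9 * k + 9) + 1)"
    using insert.hyps by simp
  moreover have "insert (rv j) (S \<union> rv ` J) = S \<union> rv ` insert j J" by auto
  moreover have "?G x v = F x v" if "x \<in> D" "v \<in> S" for x v
    using that G2 rj by auto
  moreover have "?G x (rv j') = word_approx k (\<lambda>i. F x (yr i)) (wd j') (F x (cr j'))"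
    if "x \<in> D" "j' \<in> insert j J" for x j'
  proof (cases "j' = j")
    case True
    have "word_approx k (\<lambda>i. G x (yr i)) (wd j) (G x (cr j)) =
        word_approx k (\<lambda>i. F x (yr i)) (wd j) (F x (cr j))"
      unfolding word_approx_def using G2[OF that(1)] cS yS
      by (auto intro!: foldr_cong)
    then show ?thesis using True by simp
  next
    case False
    then have "j' \<in> J" using that by simp
    then have "rv j' \<in> rv ` J" by (rule imageI)
    then have "rv j' \<noteq> rv j" using rj UnI2[of "rv j'" "rv ` J" S] by metis
    then show ?thesis using G3[OF that(1) \<open>j' \<in> J\<close>] by simp
  qed
  ultimately show ?case by (intro exI[of _ ?G] conjI ballI) (simp_all only:)
qed

end

section \<open>Taylor expansion, one coordinate at a time\<close>

text \<open>The polynomial includes the term of order \<open>r\<close>, and the remainder is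
  controlled by the oscillation \<open>E\<close> of the \<open>r\<close>-th derivative: for a
  Hoelder function there is no further derivative to use. For \<open>r = 0\<close> the claim is the
  bound on the oscillation itself.\<close>

lemma taylor_one_dim:
  fixes \<phi> :: "nat \<Rightarrow> real \<Rightarrow> real"
  assumes "\<And>j z. j < r \<Longrightarrow> z \<in> {a..b} \<Longrightarrow> (\<phi> j has_real_derivative \<phi> (Suc j) z) (at z within {a..b})"
    and "\<And>z. z \<in> {a..b} \<Longrightarrow> \<bar>\<phi> r z - \<phi> r a\<bar> \<le> E" and "0 \<le> E" and "z \<in> {a..b}"
  shows "\<bar>\<phi> 0 z - (\<Sum>j\<le>r. \<phi> j a * (z - a) ^ j / fact j)\<bar> \<le> E * (z - a) ^ r"
  using assms(1,2,4)
proof (induction r arbitrary: \<phi> z)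
  case 0
  then show ?case by simp
next
  case (Suc r)
  \<comment> \<open>The derivative \<open>?d\<close> of this remainder is the remainder, one order
    lower, of the shifted sequence. The induction hypothesis bounds it, and the mean value
    inequality supplies the missing factor \<open>z - a\<close>.\<close>
  let ?\<psi> = "\<lambda>y. \<phi> 0 y - (\<phi> 0 a + (\<Sum>j\<le>r. \<phi> (Suc j) a * (y - a) ^ Suc j / fact (Suc j)))"
  let ?d = "\<lambda>y. \<phi> (Suc 0) y - (\<Sum>j\<le>r. \<phi> (Suc j) a * (y - a) ^ j / fact j)"
  have sub: "{a..z} \<subseteq> {a..b}" using Suc.prems(3) by auto
  have d: "\<bar>?d y\<bar> \<le> E * (z - a) ^ r" if "y \<in> {a..z}" for y
  proof -
    have "\<bar>?d y\<bar> \<le> E * (y - a) ^ r"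
      using Suc.IH[of "\<lambda>j. \<phi> (Suc j)" y] Suc.prems(1,2) sub that by auto
    also have "\<dots> \<le> E * (z - a) ^ r"
      using that assms(3) by (intro mult_left_mono power_mono) auto
    finally show ?thesis .
  qed
  have tm: "((\<lambda>y. \<phi> (Suc j) a * (y - a) ^ Suc j / fact (Suc j)) has_real_derivative
      \<phi> (Suc j) a * (y - a) ^ j / fact j) (at y within {a..z})" for j y
  proof -
    have "((\<lambda>y. y - a) has_real_derivative 1) (at y within {a..z})"
      by (auto intro!: derivative_eq_intros)
    from DERIV_power_Suc[OF this, of j]
    have "((\<lambda>y. (y - a) ^ Suc j) has_real_derivative (1 + real j) * (y - a) ^ j) (at y within {a..z})"
      by simp
    from DERIV_cmult[OF this, of "\<phi> (Suc j) a / fact (Suc j)"]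
    have "((\<lambda>y. \<phi> (Suc j) a / fact (Suc j) * (y - a) ^ Suc j) has_real_derivative
       \<phi> (Suc j) a / fact (Suc j) * ((1 + real j) * (y - a) ^ j)) (at y within {a..z})" .
    moreover have "1 + real j \<noteq> 0" by linarith
    then have "\<phi> (Suc j) a / fact (Suc j) * ((1 + real j) * (y - a) ^ j) = \<phi> (Suc j) a * (y - a) ^ j / fact j"
      by (simp add: fact_Suc divide_simps)
    ultimately show ?thesis unfolding times_divide_eq_left by metis
  qed
  have deriv: "(?\<psi> has_real_derivative ?d y) (at y within {a..z})" if "y \<in> {a..z}" for y
  proof -
    have "(\<phi> 0 has_real_derivative \<phi> (Suc 0) y) (at y within {a..z})"
      using Suc.prems(1)[of 0 y] that sub by (auto intro: has_field_derivative_subset)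
    moreover have "((\<lambda>y. \<phi> 0 a + (\<Sum>j\<le>r. \<phi> (Suc j) a * (y - a) ^ Suc j / fact (Suc j)))
       has_real_derivative 0 + (\<Sum>j\<le>r. \<phi> (Suc j) a * (y - a) ^ j / fact j)) (at y within {a..z})"
      by (intro DERIV_add DERIV_const DERIV_sum tm)
    ultimately show ?thesis using DERIV_diff by fastforce
  qed
  have az: "a \<in> {a..z}" "z \<in> {a..z}" using Suc.prems(3) by auto
  have "norm (?\<psi> z - ?\<psi> a) \<le> E * (z - a) ^ r * norm (z - a)"
    by (rule field_differentiable_bound[OF convex_real_interval(5) deriv _ az(2,1)])
       (use d in auto)
  also have "?\<psi> a = 0" by simp
  also have "?\<psi> z - 0 = \<phi> 0 z - (\<Sum>j\<le>Suc r. \<phi> j a * (z - a) ^ j / fact j)"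
    unfolding sum.atMost_Suc_shift[of _ r] by simp
  finally show ?case using az by (simp add: algebra_simps)
qed

text \<open>A term \<open>(\<nu>, w, \<kappa>)\<close> stands for \<open>\<kappa> * D\<^sup>\<nu> g a * (\<Prod>i\<leftarrow>w. x i - a i)\<close>.\<close>

fun taylor_terms :: "'i list \<Rightarrow> nat \<Rightarrow> ('i \<Rightarrow> nat) \<Rightarrow> (('i \<Rightarrow> nat) \<times> 'i list \<times> real) list" where
  "taylor_terms [] r mu = [(mu, [], 1)]"
| "taylor_terms (i # is) r mu = concat (map (\<lambda>j. map (\<lambda>(nu, w, \<kappa>). (nu, replicate j i @ w, \<kappa> / fact j))
     (taylor_terms is (r - j) (mu(i := mu i + j)))) [0..<Suc r])"

lemma mi_order_upd:
  assumes "finite I" "i \<in> I"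
  shows "mi_order I (mu(i := mu i + j)) = mi_order I mu + j"
proof -
  have "(\<Sum>k\<in>I - {i}. (mu(i := mu i + j)) k) = (\<Sum>k\<in>I - {i}. mu k)" by (intro sum.cong) auto
  then show ?thesis using assms by (simp add: mi_order_def sum.remove[of I i])
qed

text \<open>Words have at most \<open>r\<close> letters, which bounds the depth of their evaluation;
  factors \<open>\<kappa>\<close> are at most 1, which bounds the table entries by the derivatives;
  and no derivative exceeds the order up to which it is known to exist.\<close>

lemma taylor_terms_in:
  assumes "finite I" "(nu, w, \<kappa>) \<in> set (taylor_terms is r mu)" "set is \<subseteq> I" "multi_index I mu"
  shows "set w \<subseteq> set is \<and> length w \<le> r \<and> 0 \<le> \<kappa> \<and> \<kappa> \<le> 1 \<and> multi_index I nu \<and>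
    mi_order I nu \<le> mi_order I mu + r"
  using assms(2-4)
proof (induction "is" arbitrary: r mu w \<kappa>)
  case (Cons i "is")
  let ?f = "\<lambda>j (nu, w, \<kappa>). (nu, replicate j i @ w, \<kappa> / fact j)"
  have "(nu, w, \<kappa>) \<in> (\<Union>j\<in>{..r}. ?f j ` set (taylor_terms is (r - j) (mu(i := mu i + j))))"
    using Cons.prems(1) by (simp add: atLeast0LessThan lessThan_Suc_atMost del: upt_Suc)
  then obtain j t where jt: "j \<le> r" "t \<in> set (taylor_terms is (r - j) (mu(i := mu i + j)))"
     "(nu, w, \<kappa>) = ?f j t" by (elim UN_E imageE) simp
  obtain nu' w' k where t: "t = (nu', w', k)" by (cases t)
  have j: "j \<le> r" "(nu, w', k) \<in> set (taylor_terms is (r - j) (mu(i := mu i + j)))"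
     "w = replicate j i @ w'" "\<kappa> = k / fact j" using jt t by auto
  have mu: "multi_index I (mu(i := mu i + j))" using Cons.prems by (auto simp: multi_index_def)
  have sI: "set is \<subseteq> I" using Cons.prems(2) by simp
  from Cons.IH[OF j(2) sI mu] have IH: "set w' \<subseteq> set is" "length w' \<le> r - j" "0 \<le> k" "k \<le> 1"
    "multi_index I nu" "mi_order I nu \<le> mi_order I (mu(i := mu i + j)) + (r - j)" by blast+
  have "k / fact j \<le> 1" using order_trans[OF IH(4) fact_ge_1] by (simp add: divide_le_eq)
  moreover have "mi_order I nu \<le> mi_order I mu + r"
    using IH(6) mi_order_upd[OF assms(1), of i mu j] Cons.prems(2) j(1) by simp
  ultimately show ?case using IH j by (auto simp: set_replicate_conv_if)
qed auto

lemma sum_list_concat_map: "sum_list (map f (concat xss)) = (\<Sum>xs\<leftarrow>xss. sum_list (map f xs))"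
  by (induction xss) auto

definition taylor_value :: "(('i \<Rightarrow> nat) \<Rightarrow> ('i \<Rightarrow> real) \<Rightarrow> real) \<Rightarrow> ('i \<Rightarrow> real) \<Rightarrow> ('i \<Rightarrow> real) \<Rightarrow>
    (('i \<Rightarrow> nat) \<times> 'i list \<times> real) list \<Rightarrow> real" where
  "taylor_value Dg a z ts = (\<Sum>(nu, w, \<kappa>)\<leftarrow>ts. Dg nu a * \<kappa> * prod_list (map z w))"

lemma taylor_value_Cons:
  "taylor_value Dg a z (taylor_terms (i # is) r mu) =
    (\<Sum>j\<le>r. taylor_value Dg a z (taylor_terms is (r - j) (mu(i := mu i + j))) * z i ^ j / fact j)"
proof -
  have "(\<Sum>(nu, w, \<kappa>)\<leftarrow>map (\<lambda>(nu, w, \<kappa>). (nu, replicate j i @ w, \<kappa> / fact j)) ts.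
      Dg nu a * \<kappa> * prod_list (map z w)) = taylor_value Dg a z ts * z i ^ j / fact j" for j ts
    by (induction ts) (auto simp: taylor_value_def algebra_simps add_divide_distrib)
  then show ?thesis
    by (simp add: taylor_value_def sum_list_concat_map o_def interv_sum_list_conv_sum_set_nat
        atLeast0LessThan lessThan_Suc_atMost del: upt_Suc)
qed

lemma taylor_value_cong:
  assumes "\<And>nu w \<kappa> i. (nu, w, \<kappa>) \<in> set ts \<Longrightarrow> i \<in> set w \<Longrightarrow> z i = z' i"
  shows "taylor_value Dg a z ts = taylor_value Dg a z' ts"
  unfolding taylor_value_def
proof (intro arg_cong[where f = sum_list] map_cong refl)
  fix t assume "t \<in> set ts"
  moreover obtain nu w \<kappa> where "t = (nu, w, \<kappa>)" by (cases t)
  ultimately have "map z w = map z' w" using assms by auto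
  then show "(case t of (nu, w, \<kappa>) \<Rightarrow> Dg nu a * \<kappa> * prod_list (map z w)) =
      (case t of (nu, w, \<kappa>) \<Rightarrow> Dg nu a * \<kappa> * prod_list (map z' w))"
    using \<open>t = _\<close> by (simp del: map_eq_conv)
qed

section \<open>Expansion in several variables\<close>

lemma unit_cube_upd: "x \<in> unit_cube I \<Longrightarrow> i \<in> I \<Longrightarrow> 0 \<le> z \<Longrightarrow> z \<le> 1 \<Longrightarrow> x(i := z) \<in> unit_cube I"
  by (auto simp: unit_cube_def)

text \<open>Composition with the translation by \<open>z\<close> turns the derivative in the
  increment, taken at 0, into a derivative along the coordinate line.\<close>

lemma partial_on_line:
  assumes "partial_on I i g g'" "x \<in> unit_cube I" "i \<in> I" "0 \<le> a" "b \<le> 1" "z \<in> {a..b}"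
  shows "((\<lambda>z. g (x(i := z))) has_real_derivative g' (x(i := z))) (at z within {a..b})"
proof -
  let ?y = "x(i := z)"
  have y: "?y \<in> unit_cube I" using assms by (intro unit_cube_upd) auto
  have "((\<lambda>h. g (?y(i := ?y i + h))) has_real_derivative g' ?y)
      (at 0 within {h. ?y(i := ?y i + h) \<in> unit_cube I})"
    by (rule bspec[OF assms(1)[unfolded partial_on_def] y])
  moreover have "(\<lambda>v. v - z) ` {a..b} \<subseteq> {h. ?y(i := ?y i + h) \<in> unit_cube I}"
    using assms by (auto intro!: unit_cube_upd)
  ultimately have "((\<lambda>h. g (x(i := z + h))) has_real_derivative g' ?y) (at (z - z) within (\<lambda>v. v - z) ` {a..b})"
    by (simp add: has_field_derivative_subset)
  moreover have "((\<lambda>v. v - z) has_real_derivative 1) (at z within {a..b})"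
    by (auto intro!: derivative_eq_intros)
  ultimately have "((\<lambda>h. g (x(i := z + h))) \<circ> (\<lambda>v. v - z) has_real_derivative g' ?y * 1) (at z within {a..b})"
    by (rule DERIV_image_chain)
  then show ?thesis by (simp add: o_def)
qed

lemma euclid_dist_upd:
  assumes "finite I" "i \<in> I"
  shows "euclid_dist I (x(i := y)) (x(i := z)) = \<bar>y - z\<bar>"
proof -
  have "(\<Sum>k\<in>I. ((x(i := y)) k - (x(i := z)) k)\<^sup>2) = (\<Sum>k\<in>I. if k = i then (y - z)\<^sup>2 else 0)"
    by (intro sum.cong) auto
  then show ?thesis using assms by (simp add: euclid_dist_def)
qed

text \<open>Coordinates outside the list already agree with \<open>a\<close>. The first listed
  coordinate is moved back to \<open>a i\<close> by a one-dimensional expansion of order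
  \<open>r\<close>; its \<open>j\<close>-th coefficient, a derivative at the moved point, is
  expanded in the remaining coordinates to order \<open>r - j\<close>. The first expansion costs one
  unit \<open>Hc * h powr (real r + lam)\<close>, the at most \<open>s + 1\<close> coefficients pass
  on the error of the shorter list, so each coordinate contributes a factor
  \<open>s + 2\<close>.\<close>

lemma taylor_multi:
  fixes I :: "'i set"
  assumes fin: "finite I" and hd: "holder_derivs I s g Dg"
    and hb: "\<And>mu x y. multi_index I mu \<Longrightarrow> mi_order I mu = s \<Longrightarrow> x \<in> unit_cube I \<Longrightarrow> y \<in> unit_cube I \<Longrightarrow>
      x \<noteq> y \<Longrightarrow> \<bar>Dg mu x - Dg mu y\<bar> \<le> Hc * euclid_dist I x y powr lam"
    and Hc: "0 \<le> Hc" and lam: "0 < lam" and h: "0 < h" and a: "a \<in> unit_cube I"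
    and "distinct is" "set is \<subseteq> I" "multi_index I mu" "mi_order I mu + r = s" "x \<in> unit_cube I"
    "\<And>i. i \<in> set is \<Longrightarrow> a i \<le> x i \<and> x i \<le> a i + h" "\<And>i. i \<notin> set is \<Longrightarrow> x i = a i"
  shows "\<bar>Dg mu x - taylor_value Dg a (\<lambda>i. x i - a i) (taylor_terms is r mu)\<bar>
     \<le> Hc * real (s + 2) ^ length is * h powr (real r + lam)"
  using assms(8-)
proof (induction "is" arbitrary: mu r x)
  case Nil
  then have "x = a" by auto
  then show ?case using Hc by (simp add: taylor_value_def)
next
  case (Cons i "is")
  have iI: "i \<in> I" and i: "i \<notin> set is" using Cons.prems by auto
  have ai: "0 \<le> a i" "a i \<le> x i" "x i \<le> a i + h" "x i \<le> 1"
    using a Cons.prems(5) Cons.prems(6)[of i] iI by (auto simp: unit_cube_def)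
  define d where "d = x i - a i"
  have d: "0 \<le> d" "d \<le> h" using ai by (auto simp: d_def)
  define nu where "nu j = mu(i := mu i + j)" for j
  have nu: "multi_index I (nu j)" "mi_order I (nu j) = mi_order I mu + j" for j
    using Cons.prems(3) iI mi_order_upd[OF fin iI] by (auto simp: nu_def multi_index_def)
  define x' where "x' = x(i := a i)"
  have x': "x' \<in> unit_cube I" using Cons.prems(5) iI ai unfolding x'_def by (intro unit_cube_upd) auto
  define T where "T j = taylor_value Dg a (\<lambda>i. x i - a i) (taylor_terms is (r - j) (nu j))" for j
  let ?l = "length is"
  \<comment> \<open>The last derivative of this sequence has order exactly \<open>s\<close>, where
    Hoelder continuity is available. The two points compared there differ in coordinate
    \<open>i\<close> alone, so their distance is at most \<open>h\<close>.\<close>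
  have "\<bar>Dg (nu 0) (x(i := x i)) - (\<Sum>j\<le>r. Dg (nu j) (x(i := a i)) * (x i - a i) ^ j / fact j)\<bar>
      \<le> (Hc * h powr lam) * (x i - a i) ^ r"
  proof (rule taylor_one_dim[where \<phi> = "\<lambda>j z. Dg (nu j) (x(i := z))" and b = "x i"])
    fix j z assume j: "j < r" and z: "z \<in> {a i..x i}"
    have "partial_on I i (Dg (nu j)) (Dg ((nu j)(i := nu j i + 1)))"
      using hd nu[of j] j Cons.prems(4) iI by (simp add: holder_derivs_def)
    moreover have "(nu j)(i := nu j i + 1) = nu (Suc j)" by (simp add: nu_def)
    ultimately show "((\<lambda>z. Dg (nu j) (x(i := z))) has_real_derivative Dg (nu (Suc j)) (x(i := z)))
        (at z within {a i..x i})"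
      using partial_on_line[of I i "Dg (nu j)" "Dg (nu (Suc j))" x "a i" "x i" z]
        Cons.prems(5) iI ai z by simp
  next
    fix z assume z: "z \<in> {a i..x i}"
    show "\<bar>Dg (nu r) (x(i := z)) - Dg (nu r) (x(i := a i))\<bar> \<le> Hc * h powr lam"
    proof (cases "z = a i")
      case False
      have "x(i := z) \<noteq> x(i := a i)" using False by (metis fun_upd_same)
      then have "\<bar>Dg (nu r) (x(i := z)) - Dg (nu r) (x(i := a i))\<bar> \<le> Hc * \<bar>z - a i\<bar> powr lam"
        using hb[of "nu r" "x(i := z)" "x(i := a i)"] nu[of r] Cons.prems(4,5) z ai iI
        by (simp add: euclid_dist_upd[OF fin iI] unit_cube_upd)
      also have "\<dots> \<le> Hc * h powr lam"
        using z ai d lam Hc by (intro mult_left_mono powr_mono2) (auto simp: d_def)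
      finally show ?thesis .
    qed (use Hc in simp)
  qed (use Hc ai in auto)
  then have main: "\<bar>Dg mu x - (\<Sum>j\<le>r. Dg (nu j) x' * d ^ j / fact j)\<bar> \<le> Hc * h powr (real r + lam)"
  proof -
    assume *: "\<bar>Dg (nu 0) (x(i := x i)) - (\<Sum>j\<le>r. Dg (nu j) (x(i := a i)) * (x i - a i) ^ j / fact j)\<bar>
      \<le> (Hc * h powr lam) * (x i - a i) ^ r"
    have "(Hc * h powr lam) * d ^ r \<le> (Hc * h powr lam) * h ^ r"
      using d Hc by (intro mult_left_mono power_mono) auto
    also have "\<dots> = Hc * h powr (real r + lam)" using h by (simp add: powr_add powr_realpow)
    finally show ?thesis using * by (simp add: nu_def x'_def d_def)
  qed
  have step: "\<bar>Dg (nu j) x' * d ^ j / fact j - T j * d ^ j / fact j\<bar>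
      \<le> Hc * real (s + 2) ^ ?l * h powr (real r + lam)" if j: "j \<le> r" for j
  proof -
    have "\<bar>Dg (nu j) x' - taylor_value Dg a (\<lambda>i. x' i - a i) (taylor_terms is (r - j) (nu j))\<bar>
       \<le> Hc * real (s + 2) ^ ?l * h powr (real (r - j) + lam)"
    proof (rule Cons.IH)
      show "mi_order I (nu j) + (r - j) = s" using nu[of j] Cons.prems(4) j by simp
      show "a k \<le> x' k \<and> x' k \<le> a k + h" if "k \<in> set is" for k
        using Cons.prems(6)[of k] that i by (auto simp: x'_def)
      show "x' k = a k" if "k \<notin> set is" for k
        using Cons.prems(7)[of k] that by (auto simp: x'_def)
    qed (use Cons.prems nu x' in auto)
    moreover have "taylor_value Dg a (\<lambda>i. x' i - a i) (taylor_terms is (r - j) (nu j)) = T j"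
      unfolding T_def
    proof (rule taylor_value_cong)
      fix nu' w \<kappa> k assume "(nu', w, \<kappa>) \<in> set (taylor_terms is (r - j) (nu j))" "k \<in> set w"
      then have "k \<in> set is" using taylor_terms_in[OF fin] Cons.prems(2) nu(1)[of j] by fastforce
      then show "x' k - a k = x k - a k" using i by (auto simp: x'_def)
    qed
    ultimately have e: "\<bar>Dg (nu j) x' - T j\<bar> \<le> Hc * real (s + 2) ^ ?l * h powr (real (r - j) + lam)"
      by simp
    have "d ^ j / fact j \<le> h ^ j"
    proof -
      have "d ^ j / fact j \<le> d ^ j / 1" using d fact_ge_1[of j] by (intro divide_left_mono) auto
      also have "\<dots> \<le> h ^ j" using d by (simp add: power_mono)
      finally show ?thesis .
    qed
    then have "\<bar>Dg (nu j) x' - T j\<bar> * (d ^ j / fact j) \<le>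
        (Hc * real (s + 2) ^ ?l * h powr (real (r - j) + lam)) * h ^ j"
      using e d Hc by (intro mult_mono) auto
    also have "\<dots> = Hc * real (s + 2) ^ ?l * h powr (real r + lam)"
      using h j by (simp add: powr_realpow[symmetric] powr_add[symmetric] of_nat_diff mult.assoc)
    also have "\<bar>Dg (nu j) x' - T j\<bar> * (d ^ j / fact j) = \<bar>(Dg (nu j) x' - T j) * (d ^ j / fact j)\<bar>"
      using d by (simp only: abs_mult) simp
    also have "(Dg (nu j) x' - T j) * (d ^ j / fact j) = Dg (nu j) x' * d ^ j / fact j - T j * d ^ j / fact j"
      by (simp add: left_diff_distrib diff_divide_distrib)
    finally show ?thesis .
  qed
  have "\<bar>(\<Sum>j\<le>r. Dg (nu j) x' * d ^ j / fact j) - (\<Sum>j\<le>r. T j * d ^ j / fact j)\<bar>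
      \<le> (\<Sum>j\<le>r. Hc * real (s + 2) ^ ?l * h powr (real r + lam))"
    unfolding sum_subtractf[symmetric] by (rule order_trans[OF sum_abs sum_mono]) (use step in auto)
  also have "\<dots> = real (r + 1) * (Hc * real (s + 2) ^ ?l * h powr (real r + lam))" by simp
  also have "\<dots> \<le> real (s + 1) * (Hc * real (s + 2) ^ ?l * h powr (real r + lam))"
    using Cons.prems(4) Hc by (intro mult_right_mono) auto
  finally have "\<bar>(\<Sum>j\<le>r. Dg (nu j) x' * d ^ j / fact j) - (\<Sum>j\<le>r. T j * d ^ j / fact j)\<bar>
      \<le> real (s + 1) * (Hc * real (s + 2) ^ ?l * h powr (real r + lam))" .
  moreover have "Hc * h powr (real r + lam) \<le> 1 * (Hc * real (s + 2) ^ ?l * h powr (real r + lam))"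
    using mult_left_mono[of 1 "real (s + 2) ^ ?l" "Hc * h powr (real r + lam)"] Hc
    by (simp add: mult_ac)
  moreover have "taylor_value Dg a (\<lambda>i. x i - a i) (taylor_terms (i # is) r mu) = (\<Sum>j\<le>r. T j * d ^ j / fact j)"
    unfolding taylor_value_Cons T_def d_def nu_def by simp
  ultimately have "\<bar>Dg mu x - taylor_value Dg a (\<lambda>i. x i - a i) (taylor_terms (i # is) r mu)\<bar>
      \<le> (1 + real (s + 1)) * (Hc * real (s + 2) ^ ?l * h powr (real r + lam))"
    using main by (simp add: distrib_right)
  then show ?case by (simp add: algebra_simps)
qed

section \<open>The norm estimate away from thin slabs\<close>

text \<open>The excluded slabs lie to the left of the interior grid planes: these are the points
  where a ramp of \<open>level\<close> is strictly between 0 and 1.\<close>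

definition off_grid :: "'i set \<Rightarrow> nat \<Rightarrow> real \<Rightarrow> ('i \<Rightarrow> real) \<Rightarrow> bool" where
  "off_grid I N \<delta> x \<longleftrightarrow> (\<forall>i\<in>I. \<forall>k\<in>{1..<N}. x i \<notin> {real k / real N - \<delta><..<real k / real N})"

text \<open>\<open>\<bar>g\<bar> powr t\<close> is dominated by \<open>e powr t\<close> plus
  \<open>K powr t\<close> times the indicators of the slabs. As the cube carries a product of
  probability measures, a slab has the measure of an interval, at most \<open>\<delta>\<close>, and
  there are at most \<open>card I * N\<close> slabs.\<close>

lemma Lt_norm_le:
  fixes I :: "'i set"
  assumes fin: "finite I" and t: "0 < t" and d: "0 < \<delta>" and e: "0 \<le> e" and K: "0 \<le> K" and eps: "0 \<le> \<epsilon>"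
    and gK: "\<And>x. x \<in> unit_cube I \<Longrightarrow> \<bar>g x\<bar> \<le> K"
    and ge: "\<And>x. x \<in> unit_cube I \<Longrightarrow> off_grid I N \<delta> x \<Longrightarrow> \<bar>g x\<bar> \<le> e"
    and sum: "e powr t + real (card I * N) * \<delta> * K powr t \<le> \<epsilon> powr t"
  shows "Lt_norm I t g \<le> ereal \<epsilon>"
proof -
  let ?U = "restrict_space lborel {0..1::real}"
  let ?M = "cube_measure I"
  have pU: "prob_space ?U" by (intro prob_space_restrict_space) auto
  interpret product_prob_space "\<lambda>_. ?U" I
    by (intro product_prob_spaceI pU)
  have PM: "?M = Pi\<^sub>M I (\<lambda>_. ?U)" by (simp add: cube_measure_def)
  have prob: "emeasure ?M (space ?M) = 1"
    unfolding PM using emeasure_space_1 by simp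
  \<comment> \<open>A slab near the left end may reach below 0, hence the intersection.\<close>
  define A where "A k = {real k / real N - \<delta><..<real k / real N} \<inter> {0..1}" for k
  have A: "A k \<in> sets ?U" for k
    by (auto simp: sets_restrict_space_iff A_def)
  define C where "C p = {x \<in> space ?M. x (fst p) \<in> A (snd p)}" for p :: "'i \<times> nat"
  let ?P = "I \<times> {1..<N}"
  have C: "C p \<in> sets ?M" "emeasure ?M (C p) \<le> ennreal \<delta>" if "p \<in> ?P" for p
  proof -
    have i: "fst p \<in> I" using that by auto
    show "C p \<in> sets ?M"
      unfolding C_def PM using measurable_sets[OF measurable_component_singleton[OF i] A[of "snd p"]]
      by (simp add: vimage_def Int_def conj_commute)
    have "emeasure ?M (C p) = emeasure ?U (A (snd p))"
      unfolding C_def PM by (rule emeasure_PiM_Collect_single[OF i A])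
    also have "\<dots> = emeasure lborel (A (snd p))"
      by (intro emeasure_restrict_space) (auto simp: A_def)
    also have "\<dots> \<le> emeasure lborel {real (snd p) / real N - \<delta><..<real (snd p) / real N}"
      by (intro emeasure_mono) (auto simp: A_def)
    also have "\<dots> = ennreal \<delta>" using d by simp
    finally show "emeasure ?M (C p) \<le> ennreal \<delta>" .
  qed
  let ?ext = "\<lambda>x i. if i \<in> I then x i else (0::real)"
  let ?J = "\<integral>\<^sup>+ x. ennreal (\<bar>g (?ext x)\<bar> powr t) \<partial>?M"
  have finP: "finite ?P" using fin by simp
  \<comment> \<open>Monotonicity of the integral does not look at the integrand on the left;
    measurability only concerns the indicators of the sets \<open>C p\<close>.\<close>
  have "?J \<le> (\<integral>\<^sup>+ x. ennreal (e powr t) + (\<Sum>p\<in>?P. ennreal (K powr t) * indicator (C p) x) \<partial>?M)"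
  proof (rule nn_integral_mono)
    fix x assume x: "x \<in> space ?M"
    have cube: "?ext x \<in> unit_cube I"
      using x by (auto simp: cube_measure_def space_PiM space_restrict_space unit_cube_def PiE_def Pi_def)
    show "ennreal (\<bar>g (?ext x)\<bar> powr t) \<le>
        ennreal (e powr t) + (\<Sum>p\<in>?P. ennreal (K powr t) * indicator (C p) x)"
    proof (cases "off_grid I N \<delta> (?ext x)")
      case True
      have "ennreal (\<bar>g (?ext x)\<bar> powr t) \<le> ennreal (e powr t)"
        using ge[OF cube True] t by (intro ennreal_leI powr_mono2) auto
      then show ?thesis by (rule order_trans) simp
    next
      case False
      then obtain i k where ik: "i \<in> I" "k \<in> {1..<N}" "x i \<in> {real k / real N - \<delta><..<real k / real N}"
        by (auto simp: off_grid_def split: if_splits)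
      have "x i \<in> {0..1}" using cube ik(1) by (auto simp: unit_cube_def dest!: bspec[of _ _ i])
      then have xC: "x \<in> C (i, k)" using x ik by (auto simp: C_def A_def)
      have "ennreal (\<bar>g (?ext x)\<bar> powr t) \<le> ennreal (K powr t)"
        using gK[OF cube] t by (intro ennreal_leI powr_mono2) auto
      also have "\<dots> = ennreal (K powr t) * indicator (C (i, k)) x" using xC by simp
      also have "\<dots> \<le> (\<Sum>p\<in>?P. ennreal (K powr t) * indicator (C p) x)"
        using ik finP by (intro member_le_sum) auto
      finally show ?thesis by (rule order_trans) simp
    qed
  qed
  also have "\<dots> = ennreal (e powr t) + (\<Sum>p\<in>?P. ennreal (K powr t) * emeasure ?M (C p))"
  proof -
    have m: "(\<lambda>x. ennreal (K powr t) * indicator (C p) x) \<in> borel_measurable ?M" if "p \<in> ?P" for p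
      using C(1)[OF that] by measurable
    have "(\<integral>\<^sup>+ x. ennreal (e powr t) + (\<Sum>p\<in>?P. ennreal (K powr t) * indicator (C p) x) \<partial>?M)
       = (\<integral>\<^sup>+ x. ennreal (e powr t) \<partial>?M) + (\<integral>\<^sup>+ x. (\<Sum>p\<in>?P. ennreal (K powr t) * indicator (C p) x) \<partial>?M)"
      by (rule nn_integral_add[OF borel_measurable_const borel_measurable_sum]) (rule m)
    also have "(\<integral>\<^sup>+ x. ennreal (e powr t) \<partial>?M) = ennreal (e powr t)" using prob by simp
    also have "(\<integral>\<^sup>+ x. (\<Sum>p\<in>?P. ennreal (K powr t) * indicator (C p) x) \<partial>?M)
       = (\<Sum>p\<in>?P. \<integral>\<^sup>+ x. ennreal (K powr t) * indicator (C p) x \<partial>?M)"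
      by (rule nn_integral_sum) (rule m)
    also have "\<dots> = (\<Sum>p\<in>?P. ennreal (K powr t) * emeasure ?M (C p))"
      by (rule sum.cong[OF refl], rule nn_integral_cmult_indicator, rule C(1))
    finally show ?thesis .
  qed
  also have "\<dots> \<le> ennreal (e powr t) + (\<Sum>p\<in>?P. ennreal (K powr t) * ennreal \<delta>)"
    using C(2) by (intro add_left_mono sum_mono mult_left_mono) auto
  also have "\<dots> = ennreal (e powr t + real (card ?P) * (K powr t * \<delta>))"
    using d by (simp add: ennreal_mult[symmetric] ennreal_of_nat_eq_real_of_nat ennreal_plus[symmetric]
        del: ennreal_plus)
  also have "\<dots> \<le> ennreal (e powr t + real (card I * N) * (K powr t * \<delta>))"
  proof (intro ennreal_leI add_left_mono mult_right_mono)
    have "card ?P \<le> card I * N" by (simp add: card_cartesian_product)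
    then show "real (card ?P) \<le> real (card I * N)" by (simp only: of_nat_le_iff)
  qed (use d in auto)
  also have "\<dots> \<le> ennreal (\<epsilon> powr t)"
    using sum by (intro ennreal_leI) (simp add: mult_ac)
  finally have J: "?J \<le> ennreal (\<epsilon> powr t)" .
  then have fin_J: "?J \<noteq> \<infinity>" by (metis ennreal_neq_top infinity_ennreal_def neq_top_trans)
  have "enn2real ?J \<le> \<epsilon> powr t" using J by (intro enn2real_leI) auto
  then have "enn2real ?J powr (1 / t) \<le> (\<epsilon> powr t) powr (1 / t)"
    using t by (intro powr_mono2) auto
  also have "\<dots> = \<epsilon>" using t eps by (cases "\<epsilon> = 0") (auto simp: powr_powr)
  finally show ?thesis using fin_J by (simp add: Lt_norm_def Let_def)
qed

section \<open>Locating the cell and looking up its Taylor coefficients\<close>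

text \<open>Both functions project onto the unit interval. \<open>clamp\<close> is a difference of
  two neurons, subtracted by the weights of the following layer; \<open>clip\<close> nests two ReLUs
  and ends in a single nonnegative register.\<close>

definition clamp :: "real \<Rightarrow> real" where "clamp z = max 0 z - max 0 (z - 1)"
definition clip :: "real \<Rightarrow> real" where "clip z = max 0 (1 - max 0 (1 - z))"

text \<open>A continuous substitute for the index of the cell that contains \<open>z\<close>: each
  interior grid point contributes a ramp of slope \<open>1 / \<delta>\<close>, which reaches 1 at
  the grid point itself.\<close>

definition level :: "nat \<Rightarrow> real \<Rightarrow> real \<Rightarrow> real" where
  "level N \<delta> z = (\<Sum>k\<in>{1..<N}. clamp ((z - real k / real N) / \<delta> + 1))"

definition cell_offset :: "nat \<Rightarrow> real \<Rightarrow> real \<Rightarrow> real" where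
  "cell_offset N \<delta> z = clip (real N * z - level N \<delta> z)"

text \<open>The piecewise linear interpolant of \<open>tab\<close> at 0, ..., \<open>M\<close>. The
  clip keeps it in the unit interval whatever the argument is.\<close>

definition lookup :: "nat \<Rightarrow> (nat \<Rightarrow> real) \<Rightarrow> real \<Rightarrow> real" where
  "lookup M tab u = clip (tab 0 + (\<Sum>k<M. (tab (Suc k) - tab k) * clamp (u - real k)))"

lemma clip_unit: "0 \<le> clip z" "clip z \<le> 1" by (auto simp: clip_def)

lemma clip_id: "0 \<le> z \<Longrightarrow> z \<le> 1 \<Longrightarrow> clip z = z" by (auto simp: clip_def)

lemma clamp_nonneg: "0 \<le> clamp z" by (auto simp: clamp_def max_def)

text \<open>At an integer every ramp equals 0 or 1, and the increments of the table
  telescope.\<close>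

lemma lookup_nat:
  assumes "K \<le> M" "0 \<le> tab K" "tab K \<le> 1"
  shows "lookup M tab (real K) = tab K"
proof -
  have "(\<Sum>k<M. (tab (Suc k) - tab k) * clamp (real K - real k)) =
      (\<Sum>k<M. if k < K then tab (Suc k) - tab k else 0)"
    by (intro sum.cong) (auto simp: clamp_def max_def)
  also have "\<dots> = (\<Sum>k<K. tab (Suc k) - tab k)"
    using assms(1) by (intro sum.mono_neutral_cong_right) auto
  also have "\<dots> = tab K - tab 0" by (rule sum_lessThan_telescope)
  finally show ?thesis using assms(2,3) by (simp add: lookup_def clip_id)
qed

text \<open>Cells are closed on the left and open on the right, since a ramp has already reached 1
  at its grid point. Only the last cell contains its right end, where no ramp is attached. For a
  grid point to the right of \<open>z\<close>, being off the slab leaves room for the whole ramp,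
  which is therefore still 0.\<close>

lemma level_cell:
  assumes "a < N" "real a \<le> real N * z" "real N * z \<le> real a + 1" "a + 1 < N \<Longrightarrow> real N * z < real a + 1"
    and "0 < \<delta>" and off: "\<And>k. k \<in> {1..<N} \<Longrightarrow> z \<notin> {real k / real N - \<delta><..<real k / real N}"
  shows "level N \<delta> z = real a"
proof -
  have N: "0 < real N" using assms(1) by simp
  have "clamp ((z - real k / real N) / \<delta> + 1) = (if k \<le> a then 1 else 0)" if k: "k \<in> {1..<N}" for k
  proof (cases "k \<le> a")
    case True
    then have "real k / real N \<le> z" using assms(2) N by (simp add: field_simps)
    then show ?thesis using True assms(5) by (simp add: clamp_def)
  next
    case False
    then have "a + 1 < N" using k by simp
    then have "real N * z < real k" using assms(4) False by fastforce
    then have "z < real k / real N" using N by (simp add: field_simps)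
    then have "z \<le> real k / real N - \<delta>" using off[OF k] by auto
    then have "(z - real k / real N) / \<delta> + 1 \<le> 0" using assms(5) by (simp add: field_simps)
    then show ?thesis using False by (simp add: clamp_def)
  qed
  then have "level N \<delta> z = (\<Sum>k\<in>{1..<N}. if k \<le> a then 1 else 0)" by (simp add: level_def)
  also have "\<dots> = real (card ({1..<N} \<inter> {..a}))" by (simp add: sum.If_cases atMost_def)
  also have "{1..<N} \<inter> {..a} = {1..a}" using assms(1) by auto
  finally show ?thesis by simp
qed

text \<open>The boolean in \<open>RRamp\<close> and \<open>RLook\<close> distinguishes the two ReLU
  halves of a \<open>clamp\<close>. \<open>RTmp\<close> secures an infinite supply of names for the
  temporaries of the multiplication programs.\<close>

datatype ('i, 'j) reg = RX 'i | RQ | RRamp 'i nat bool | RU | RY 'i | RLook nat bool | RC 'j | RV 'j | RTmp nat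

lemma infinite_reg: "infinite (UNIV :: ('i, 'j) reg set)"
proof
  assume "finite (UNIV :: ('i, 'j) reg set)"
  then have "finite (range (RTmp :: nat \<Rightarrow> ('i, 'j) reg))" by (rule finite_subset[rotated]) simp
  then show False using finite_imageD[of "RTmp :: nat \<Rightarrow> ('i, 'j) reg" UNIV] by (simp add: inj_def)
qed

definition net_input :: "('i \<Rightarrow> real) \<times> nat \<Rightarrow> ('i, 'j) reg \<Rightarrow> real" where
  "net_input p v = (case v of RX i \<Rightarrow> fst p i | RQ \<Rightarrow> real (snd p) | _ \<Rightarrow> 0)"

text \<open>A mixed radix code: the column number is the lowest digit, to base \<open>n\<close>, and
  the cell coordinates are the higher digits, to base \<open>N\<close>, in the order given by
  \<open>\<iota>\<close>.\<close>

definition cell_index :: "'i set \<Rightarrow> nat \<Rightarrow> nat \<Rightarrow> real \<Rightarrow> ('i \<Rightarrow> nat) \<Rightarrow> ('i \<Rightarrow> real) \<times> nat \<Rightarrow> real" where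
  "cell_index I n N \<delta> \<iota> p = real (snd p) + (\<Sum>i\<in>I. real (n * N ^ \<iota> i) * level N \<delta> (fst p i))"

text \<open>\<open>R\<close> bounds the narrow layers and \<open>V\<close> the wide ones. No two
  wide layers are adjacent, so each layer has at most \<open>(V + 1) * (R + 1)\<close> parameters,
  linear in \<open>V\<close>. \<open>R\<close> makes room for offsets, coefficients, results and
  nine temporaries; \<open>V1\<close> counts the inputs and two neurons per ramp, \<open>V3\<close>
  the offsets and two neurons per step of the table. The bounds on \<open>B\<close> list the weights
  that occur.\<close>

locale lookup_net =
  fixes I :: "'i set" and J :: "'j set" and N M n :: nat and \<delta> B :: real and \<iota> :: "'i \<Rightarrow> nat"
    and tab :: "'j \<Rightarrow> nat \<Rightarrow> real" and W R V :: nat and D :: "(('i \<Rightarrow> real) \<times> nat) set"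
  assumes finI: "finite I" and finJ: "finite J" and N1: "1 \<le> N" and d0: "0 < \<delta>"
    and B\<iota>: "i \<in> I \<Longrightarrow> real (n * N ^ \<iota> i) \<le> B" and tab: "j \<in> J \<Longrightarrow> 0 \<le> tab j k \<and> tab j k \<le> 1"
    and B6: "6 \<le> B" and Bd: "1 + 1 / \<delta> \<le> B" and BM: "real M + 1 \<le> B" and BN: "real N \<le> B"
    and R: "card I + 2 * card J + 9 \<le> R" and RV: "R \<le> V" and V1: "card I + 1 + 2 * card I * N \<le> V"
    and V3: "card I + 2 * M \<le> V" and VW: "V \<le> W"
    and D: "p \<in> D \<Longrightarrow> i \<in> I \<Longrightarrow> 0 \<le> fst p i"
begin

section \<open>Register sets and contents of the five layers\<close>

definition A0 :: "('i, 'j) reg set" where "A0 = insert RQ (RX ` I)"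
definition S1 :: "('i, 'j) reg set" where
  "S1 = A0 \<union> (\<lambda>(i, k, b). RRamp i k b) ` (I \<times> {1..<N} \<times> UNIV)"
definition S2 :: "('i, 'j) reg set" where "S2 = insert RU (RY ` I)"
definition S3 :: "('i, 'j) reg set" where "S3 = RY ` I \<union> (\<lambda>(k, b). RLook k b) ` ({..<M} \<times> UNIV)"
definition S4 :: "('i, 'j) reg set" where "S4 = RY ` I \<union> RC ` J"

abbreviation "lev p i \<equiv> level N \<delta> (fst p i)"
abbreviation "ci p \<equiv> cell_index I n N \<delta> \<iota> p"

text \<open>A clip stretches over two layers. \<open>F2\<close> holds the inner ReLU of the offsets
  and \<open>F3\<close> completes it; \<open>F4\<close> holds the inner ReLU of the looked-up
  coefficients and \<open>F5\<close> completes it.\<close>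

definition F1 :: "('i \<Rightarrow> real) \<times> nat \<Rightarrow> ('i, 'j) reg \<Rightarrow> real" where
  "F1 p v = (case v of RX i \<Rightarrow> fst p i | RQ \<Rightarrow> real (snd p)
     | RRamp i k b \<Rightarrow> max 0 ((fst p i - real k / real N) / \<delta> + (if b then 1 else 0)) | _ \<Rightarrow> 0)"
definition F2 :: "('i \<Rightarrow> real) \<times> nat \<Rightarrow> ('i, 'j) reg \<Rightarrow> real" where
  "F2 p v = (case v of RY i \<Rightarrow> max 0 (1 - (real N * fst p i - lev p i)) | RU \<Rightarrow> ci p | _ \<Rightarrow> 0)"
definition F3 :: "('i \<Rightarrow> real) \<times> nat \<Rightarrow> ('i, 'j) reg \<Rightarrow> real" where
  "F3 p v = (case v of RY i \<Rightarrow> cell_offset N \<delta> (fst p i)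
     | RLook k b \<Rightarrow> max 0 (ci p - real k - (if b then 1 else 0)) | _ \<Rightarrow> 0)"
definition F4 :: "('i \<Rightarrow> real) \<times> nat \<Rightarrow> ('i, 'j) reg \<Rightarrow> real" where
  "F4 p v = (case v of RY i \<Rightarrow> cell_offset N \<delta> (fst p i)
     | RC j \<Rightarrow> max 0 (1 - (tab j 0 + (\<Sum>k<M. (tab j (Suc k) - tab j k) * clamp (ci p - real k)))) | _ \<Rightarrow> 0)"
definition F5 :: "('i \<Rightarrow> real) \<times> nat \<Rightarrow> ('i, 'j) reg \<Rightarrow> real" where
  "F5 p v = (case v of RY i \<Rightarrow> cell_offset N \<delta> (fst p i) | RC j \<Rightarrow> lookup M (tab j) (ci p) | _ \<Rightarrow> 0)"

lemma fins: "finite A0" "finite S1" "finite S2" "finite S3" "finite S4"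
  using finI finJ by (auto simp: A0_def S1_def S2_def S3_def S4_def)

lemma cards: "card A0 \<le> R" "card S1 \<le> V" "card S2 \<le> R" "card S3 \<le> V" "card S4 \<le> R" "card S4 + card J + 9 \<le> R"
proof -
  have X: "card (RX ` I :: ('i, 'j) reg set) \<le> card I" "card (RY ` I :: ('i, 'j) reg set) \<le> card I"
     "card (RC ` J :: ('i, 'j) reg set) \<le> card J"
    using finI finJ by (auto intro: card_image_le)
  have a0: "card A0 \<le> card I + 1" unfolding A0_def
    using card_insert_le_m1[of "card I + 1" "RX ` I :: ('i, 'j) reg set" RQ] X by simp
  then show "card A0 \<le> R" using R by simp
  have "card ((\<lambda>(i, k, b). RRamp i k b) ` (I \<times> {1..<N} \<times> (UNIV :: bool set)) :: ('i, 'j) reg set)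
      \<le> card (I \<times> {1..<N} \<times> (UNIV :: bool set))"
    using finI by (intro card_image_le) auto
  also have "\<dots> = card I * ((N - 1) * 2)" by (simp add: card_cartesian_product)
  also have "\<dots> \<le> card I * (N * 2)" by (intro mult_le_mono) auto
  finally show "card S1 \<le> V" using a0 V1
      card_Un_le[of A0 "(\<lambda>(i, k, b). RRamp i k b) ` (I \<times> {1..<N} \<times> (UNIV :: bool set)) :: ('i, 'j) reg set"]
    unfolding S1_def by linarith
  show "card S2 \<le> R" unfolding S2_def
    using card_insert_le_m1[of "card I + 1" "RY ` I :: ('i, 'j) reg set" RU] X R by simp
  have "card ((\<lambda>(k, b). RLook k b) ` ({..<M} \<times> (UNIV :: bool set)) :: ('i, 'j) reg set)
     \<le> card ({..<M} \<times> (UNIV :: bool set))"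
    by (intro card_image_le) auto
  also have "\<dots> = M * 2" by (simp add: card_cartesian_product)
  finally show "card S3 \<le> V" using X V3
      card_Un_le[of "RY ` I" "(\<lambda>(k, b). RLook k b) ` ({..<M} \<times> (UNIV :: bool set)) :: ('i, 'j) reg set"]
    unfolding S3_def by linarith
  show "card S4 \<le> R" "card S4 + card J + 9 \<le> R"
    using X R card_Un_le[of "RY ` I" "RC ` J :: ('i, 'j) reg set"] unfolding S4_def by linarith+
qed

lemma sum_A0: "(\<Sum>a\<in>A0. h a) = h RQ + (\<Sum>i\<in>I. h (RX i))"
  using finI by (simp add: A0_def image_iff sum.reindex inj_on_def)

lemma sum_S1: "(\<Sum>a\<in>S1. h a) = h RQ + (\<Sum>i\<in>I. h (RX i)) +
    (\<Sum>i\<in>I. \<Sum>k\<in>{1..<N}. h (RRamp i k True) + h (RRamp i k False))"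
proof -
  have "(\<Sum>a\<in>(\<lambda>(i, k, b). RRamp i k b) ` (I \<times> {1..<N} \<times> UNIV). h a) =
     (\<Sum>(i, k, b)\<in>I \<times> {1..<N} \<times> UNIV. h (RRamp i k b))"
    by (subst sum.reindex) (auto simp: inj_on_def intro!: sum.cong)
  also have "\<dots> = (\<Sum>i\<in>I. \<Sum>k\<in>{1..<N}. h (RRamp i k True) + h (RRamp i k False))"
    by (simp add: sum.cartesian_product[symmetric] UNIV_bool add.commute)
  finally show ?thesis unfolding S1_def
    using finI fins(1) by (subst sum.union_disjoint) (auto simp: sum_A0, auto simp: A0_def)
qed

lemma sum_S2: "(\<Sum>a\<in>S2. h a) = h RU + (\<Sum>i\<in>I. h (RY i))"
  using finI by (simp add: S2_def image_iff sum.reindex inj_on_def)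

lemma sum_S3: "(\<Sum>a\<in>S3. h a) = (\<Sum>i\<in>I. h (RY i)) + (\<Sum>k<M. h (RLook k True) + h (RLook k False))"
proof -
  have "(\<Sum>a\<in>(\<lambda>(k, b). RLook k b) ` ({..<M} \<times> UNIV). h a) = (\<Sum>(k, b)\<in>{..<M} \<times> UNIV. h (RLook k b))"
    by (subst sum.reindex) (auto simp: inj_on_def intro!: sum.cong)
  also have "\<dots> = (\<Sum>k<M. h (RLook k True) + h (RLook k False))"
    by (simp add: sum.cartesian_product[symmetric] UNIV_bool add.commute)
  finally show ?thesis unfolding S3_def
    using finI by (subst sum.union_disjoint) (auto simp: sum.reindex inj_on_def)
qed

lemma sum_S4: "(\<Sum>a\<in>S4. h a) = (\<Sum>i\<in>I. h (RY i)) + (\<Sum>j\<in>J. h (RC j))"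
  unfolding S4_def using finI finJ
  by (subst sum.union_disjoint) (auto simp: sum.reindex inj_on_def)

lemma if_sum:
  fixes c :: "'b \<Rightarrow> real"
  shows "finite X \<Longrightarrow> x \<in> X \<Longrightarrow> (\<Sum>i\<in>X. (if x = i then c i else 0) * g i) = c x * g x"
    "finite X \<Longrightarrow> x \<in> X \<Longrightarrow> (\<Sum>i\<in>X. if x = i then g i else 0) = g x"
  by (auto simp: if_distrib[where f = "\<lambda>u. u * _"] cong: if_cong)

abbreviation "rc \<equiv> relu_comp W B D net_input A0"

text \<open>The steep weights \<open>1 / \<delta>\<close> and the matching biases occur here only.
  Inputs are copied for the next layer, which uses that they are nonnegative on
  \<open>D\<close>.\<close>

lemma layer1: "rc S1 1 ((V + 1) * (R + 1)) F1"
proof -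
  define M1 :: "('i, 'j) reg \<Rightarrow> ('i, 'j) reg \<Rightarrow> real" where
    "M1 v a = (case a of RQ \<Rightarrow> (if v = RQ then 1 else 0)
      | RX i \<Rightarrow> (case v of RX i' \<Rightarrow> if i' = i then 1 else 0 | RRamp i' k b \<Rightarrow> if i' = i then 1 / \<delta> else 0 | _ \<Rightarrow> 0)
      | _ \<Rightarrow> 0)" for v a
  define b1 :: "('i, 'j) reg \<Rightarrow> real" where
    "b1 v = (case v of RRamp i k b \<Rightarrow> (if b then 1 else 0) - real k / real N / \<delta> | _ \<Rightarrow> 0)" for v
  have "rc S1 (Suc 0) (0 + (V + 1) * (R + 1)) F1"
  proof (rule relu_comp.layer[OF relu_comp.init, where M = M1 and b = b1])
    show "\<bar>M1 v a\<bar> \<le> B" if "v \<in> S1" "a \<in> A0" for v a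
      using B6 Bd d0 by (cases a; cases v) (auto simp: M1_def)
    show "\<bar>b1 v\<bar> \<le> B" if "v \<in> S1" for v
    proof -
      have ramp: "\<bar>(if b then 1 else 0) - real k / real N / \<delta>\<bar> \<le> B" if "k < N" for k b
      proof -
        have "0 \<le> real k / real N / \<delta>" "0 < 1 / \<delta>" using d0 by simp_all
        moreover have "real k / real N / \<delta> \<le> 1 / \<delta>" using that d0 by (intro divide_right_mono) auto
        ultimately show ?thesis using Bd by (smt (verit))
      qed
      consider "\<bar>b1 v\<bar> = 0" | i k b where "v = RRamp i k b" "k < N"
        using \<open>v \<in> S1\<close> by (auto simp: S1_def A0_def b1_def)
      then show ?thesis
      proof cases
        case (2 i k b)
        then show ?thesis using ramp[OF 2(2), of b] by (simp add: b1_def)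
      qed (use B6 in simp)
    qed
    have "card S1 * (card A0 + 1) \<le> (V + 1) * (R + 1)" using cards by (intro mult_le_mono) auto
    then show "0 + card S1 * (card A0 + 1) \<le> 0 + (V + 1) * (R + 1)" by (rule add_left_mono)
    show "F1 p v = max 0 ((\<Sum>a\<in>A0. M1 v a * net_input p a) + b1 v)" if "p \<in> D" "v \<in> S1" for p v
    proof -
      consider "v = RQ" | i where "v = RX i" "i \<in> I" | i k b where "v = RRamp i k b" "i \<in> I"
        using \<open>v \<in> S1\<close> by (auto simp: S1_def A0_def)
      then show ?thesis
      proof cases
        case 1
        then show ?thesis by (simp add: sum_A0 F1_def M1_def b1_def net_input_def)
      next
        case (2 i)
        then show ?thesis using D[OF that(1) 2(2)] finI
          by (simp add: sum_A0 F1_def M1_def b1_def net_input_def if_sum)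
      next
        case (3 i k b)
        then show ?thesis using finI
          by (simp add: sum_A0 F1_def M1_def b1_def net_input_def if_sum diff_divide_distrib)
      qed
    qed
  qed (use fins cards VW in auto)
  then show ?thesis by simp
qed

lemma ci_nonneg: "0 \<le> ci p"
  unfolding cell_index_def level_def by (intro add_nonneg_nonneg sum_nonneg mult_nonneg_nonneg clamp_nonneg) auto

text \<open>The halves of each ramp enter with opposite signs, so that levels appear only inside the
  linear forms for the cell index and the offsets. The radix powers are the weights of the cell
  index.\<close>

lemma layer2: "rc S2 2 (2 * ((V + 1) * (R + 1))) F2"
proof -
  define M2 :: "('i, 'j) reg \<Rightarrow> ('i, 'j) reg \<Rightarrow> real" where
    "M2 v a = (case v of RU \<Rightarrow> (case a of RQ \<Rightarrow> 1 | RRamp i k b \<Rightarrow> (if b then 1 else - 1) * real (n * N ^ \<iota> i) | _ \<Rightarrow> 0)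
      | RY i' \<Rightarrow> (case a of RX i \<Rightarrow> if i' = i then - real N else 0
          | RRamp i k b \<Rightarrow> if i' = i then (if b then 1 else - 1) else 0 | _ \<Rightarrow> 0)
      | _ \<Rightarrow> 0)" for v a
  define b2 :: "('i, 'j) reg \<Rightarrow> real" where "b2 v = (case v of RY i \<Rightarrow> 1 | _ \<Rightarrow> 0)" for v
  have ramp: "F1 p (RRamp i k True) - F1 p (RRamp i k False) = clamp ((fst p i - real k / real N) / \<delta> + 1)" for p i k
    by (simp add: F1_def clamp_def)
  have "rc S2 (Suc 1) ((V + 1) * (R + 1) + (V + 1) * (R + 1)) F2"
  proof (rule relu_comp.layer[OF layer1, where M = M2 and b = b2])
    show "\<bar>M2 v a\<bar> \<le> B" if "v \<in> S2" "a \<in> S1" for v a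
    proof -
      have "i \<in> I" if "a = RRamp i k b" for i k b
        using \<open>a \<in> S1\<close> that by (auto simp: S1_def A0_def)
      then show ?thesis using B6 BN B\<iota> by (cases a; cases v) (auto simp: M2_def)
    qed
    show "\<bar>b2 v\<bar> \<le> B" for v using B6 by (cases v) (auto simp: b2_def)
    have "card S2 * (card S1 + 1) \<le> (R + 1) * (V + 1)" using cards by (intro mult_le_mono) auto
    then show "(V + 1) * (R + 1) + card S2 * (card S1 + 1) \<le> (V + 1) * (R + 1) + (V + 1) * (R + 1)"
      unfolding mult.commute[of "R + 1"] by (rule add_left_mono)
    show "F2 p v = max 0 ((\<Sum>a\<in>S1. M2 v a * F1 p a) + b2 v)" if "p \<in> D" "v \<in> S2" for p v
    proof -
      consider "v = RU" | i where "v = RY i" "i \<in> I" using \<open>v \<in> S2\<close> by (auto simp: S2_def)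
      then show ?thesis
      proof cases
        case 1
        have "(\<Sum>a\<in>S1. M2 RU a * F1 p a) = real (snd p) +
           (\<Sum>i\<in>I. \<Sum>k\<in>{1..<N}. real (n * N ^ \<iota> i) * (F1 p (RRamp i k True) - F1 p (RRamp i k False)))"
          by (simp add: sum_S1 M2_def algebra_simps) (simp add: F1_def)
        also have "\<dots> = ci p" unfolding ramp cell_index_def level_def by (simp add: sum_distrib_left)
        finally show ?thesis using 1 ci_nonneg by (simp add: F2_def b2_def)
      next
        case (2 i)
        have "(\<Sum>a\<in>S1. M2 (RY i) a * F1 p a) = (\<Sum>i'\<in>I. (if i = i' then - real N else 0) * F1 p (RX i')) +
           (\<Sum>i'\<in>I. if i = i' then (\<Sum>k\<in>{1..<N}. F1 p (RRamp i' k True) - F1 p (RRamp i' k False)) else 0)"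
          by (simp add: sum_S1 M2_def) (intro sum.cong; auto)
        also have "\<dots> = - real N * fst p i + lev p i"
          unfolding ramp if_sum[OF finI 2(2)] by (simp add: level_def F1_def)
        finally show ?thesis using 2 by (simp add: F2_def b2_def)
      qed
    qed
  qed (use fins cards VW RV in auto)
  moreover have "Suc 1 = 2" "(V + 1) * (R + 1) + (V + 1) * (R + 1) = 2 * ((V + 1) * (R + 1))"
    by (simp_all add: algebra_simps)
  ultimately show ?thesis by (simp only:)
qed

text \<open>The single register of the cell index is fanned out into shifted copies, two per step of
  the table. The shifts are biases of size up to \<open>M\<close>.\<close>

lemma layer3: "rc S3 3 (3 * ((V + 1) * (R + 1))) F3"
proof -
  define M3 :: "('i, 'j) reg \<Rightarrow> ('i, 'j) reg \<Rightarrow> real" where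
    "M3 v a = (case v of RLook k b \<Rightarrow> (if a = RU then 1 else 0)
      | RY i' \<Rightarrow> (case a of RY i \<Rightarrow> if i' = i then - 1 else 0 | _ \<Rightarrow> 0) | _ \<Rightarrow> 0)" for v a
  define b3 :: "('i, 'j) reg \<Rightarrow> real" where
    "b3 v = (case v of RY i \<Rightarrow> 1 | RLook k b \<Rightarrow> - real k - (if b then 1 else 0) | _ \<Rightarrow> 0)" for v
  have "rc S3 (Suc 2) (2 * ((V + 1) * (R + 1)) + (V + 1) * (R + 1)) F3"
  proof (rule relu_comp.layer[OF layer2, where M = M3 and b = b3])
    show "\<bar>M3 v a\<bar> \<le> B" for v a
      using B6 by (cases a; cases v) (auto simp: M3_def)
    show "\<bar>b3 v\<bar> \<le> B" if "v \<in> S3" for v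
    proof -
      have "k < M" if "v = RLook k b" for k b using \<open>v \<in> S3\<close> that by (auto simp: S3_def)
      then show ?thesis using B6 BM by (cases v) (fastforce simp: b3_def)+
    qed
    have "card S3 * (card S2 + 1) \<le> (V + 1) * (R + 1)" using cards by (intro mult_le_mono) auto
    then show "2 * ((V + 1) * (R + 1)) + card S3 * (card S2 + 1) \<le> 2 * ((V + 1) * (R + 1)) + (V + 1) * (R + 1)"
      by (rule add_left_mono)
    show "F3 p v = max 0 ((\<Sum>a\<in>S2. M3 v a * F2 p a) + b3 v)" if "p \<in> D" "v \<in> S3" for p v
    proof -
      consider k b where "v = RLook k b" | i where "v = RY i" "i \<in> I" using \<open>v \<in> S3\<close> by (auto simp: S3_def)
      then show ?thesis
        by cases (use finI in \<open>auto simp: sum_S2 F3_def F2_def M3_def b3_def if_sum cell_offset_def clip_def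
            algebra_simps\<close>)
    qed
  qed (use fins cards VW in auto)
  moreover have "Suc 2 = 3" "2 * ((V + 1) * (R + 1)) + (V + 1) * (R + 1) = 3 * ((V + 1) * (R + 1))"
    by (simp_all add: algebra_simps)
  ultimately show ?thesis by (simp only:)
qed

text \<open>The table enters as weights: differences of consecutive entries, at most 1 in absolute
  value, one row for each \<open>j\<close>.\<close>

lemma layer4: "rc S4 4 (4 * ((V + 1) * (R + 1))) F4"
proof -
  define M4 :: "('i, 'j) reg \<Rightarrow> ('i, 'j) reg \<Rightarrow> real" where
    "M4 v a = (case v of RC j \<Rightarrow> (case a of RLook k b \<Rightarrow> (if b then 1 else - 1) * (tab j (Suc k) - tab j k) | _ \<Rightarrow> 0)
      | RY i' \<Rightarrow> (case a of RY i \<Rightarrow> if i' = i then 1 else 0 | _ \<Rightarrow> 0) | _ \<Rightarrow> 0)" for v a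
  define b4 :: "('i, 'j) reg \<Rightarrow> real" where
    "b4 v = (case v of RC j \<Rightarrow> 1 - tab j 0 | _ \<Rightarrow> 0)" for v
  have look: "F3 p (RLook k False) - F3 p (RLook k True) = clamp (ci p - real k)" for p k
    by (simp add: F3_def clamp_def)
  have "rc S4 (Suc 3) (3 * ((V + 1) * (R + 1)) + (V + 1) * (R + 1)) F4"
  proof (rule relu_comp.layer[OF layer3, where M = M4 and b = b4])
    have *: "\<bar>tab j (Suc k) - tab j k\<bar> \<le> B" if "j \<in> J" for j k
      using tab[OF that, of k] tab[OF that, of "Suc k"] B6 by auto
    show "\<bar>M4 v a\<bar> \<le> B" if "v \<in> S4" for v a
    proof -
      have "j \<in> J" if "v = RC j" for j using \<open>v \<in> S4\<close> that by (auto simp: S4_def)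
      then show ?thesis using B6 *
        by (cases a; cases v) (auto simp: M4_def abs_minus_commute)
    qed
    show "\<bar>b4 v\<bar> \<le> B" if "v \<in> S4" for v
    proof -
      have "j \<in> J" if "v = RC j" for j using \<open>v \<in> S4\<close> that by (auto simp: S4_def)
      then show ?thesis using B6 tab[of _ 0] by (cases v) (fastforce simp: b4_def abs_le_iff)+
    qed
    have "card S4 * (card S3 + 1) \<le> (R + 1) * (V + 1)" using cards by (intro mult_le_mono) auto
    then show "3 * ((V + 1) * (R + 1)) + card S4 * (card S3 + 1) \<le> 3 * ((V + 1) * (R + 1)) + (V + 1) * (R + 1)"
      unfolding mult.commute[of "R + 1"] by (rule add_left_mono)
    show "F4 p v = max 0 ((\<Sum>a\<in>S3. M4 v a * F3 p a) + b4 v)" if "p \<in> D" "v \<in> S4" for p v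
    proof -
      consider j where "v = RC j" | i where "v = RY i" "i \<in> I" using \<open>v \<in> S4\<close> by (auto simp: S4_def)
      then show ?thesis
      proof cases
        case (1 j)
        have "(\<Sum>a\<in>S3. M4 (RC j) a * F3 p a) =
           - (\<Sum>k<M. (tab j (Suc k) - tab j k) * (F3 p (RLook k False) - F3 p (RLook k True)))"
          by (simp add: sum_S3 M4_def algebra_simps sum_negf[symmetric])
        then show ?thesis unfolding look using 1 by (simp add: F4_def b4_def algebra_simps)
      next
        case (2 i)
        have "0 \<le> cell_offset N \<delta> (fst p i)" by (simp add: cell_offset_def clip_unit)
        then show ?thesis using 2 finI by (simp add: sum_S3 F4_def F3_def M4_def b4_def if_sum)
      qed
    qed
  qed (use fins cards VW RV in auto)
  moreover have "Suc 3 = 4" "3 * ((V + 1) * (R + 1)) + (V + 1) * (R + 1) = 4 * ((V + 1) * (R + 1))"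
    by (simp_all add: algebra_simps)
  ultimately show ?thesis by (simp only:)
qed

lemma layer5: "rc S4 5 (5 * ((V + 1) * (R + 1))) F5"
proof -
  define M5 :: "('i, 'j) reg \<Rightarrow> ('i, 'j) reg \<Rightarrow> real" where
    "M5 v a = (case v of RC j' \<Rightarrow> (case a of RC j \<Rightarrow> if j' = j then - 1 else 0 | _ \<Rightarrow> 0)
      | RY i' \<Rightarrow> (case a of RY i \<Rightarrow> if i' = i then 1 else 0 | _ \<Rightarrow> 0) | _ \<Rightarrow> 0)" for v a
  define b5 :: "('i, 'j) reg \<Rightarrow> real" where
    "b5 v = (case v of RC j \<Rightarrow> 1 | _ \<Rightarrow> 0)" for v
  have "rc S4 (Suc 4) (4 * ((V + 1) * (R + 1)) + (V + 1) * (R + 1)) F5"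
  proof (rule relu_comp.layer[OF layer4, where M = M5 and b = b5])
    show "\<bar>M5 v a\<bar> \<le> B" for v a
      using B6 by (cases a; cases v) (auto simp: M5_def)
    show "\<bar>b5 v\<bar> \<le> B" for v
      using B6 by (cases v) (auto simp: b5_def)
    have "card S4 * (card S4 + 1) \<le> (V + 1) * (R + 1)" using cards RV by (intro mult_le_mono) auto
    then show "4 * ((V + 1) * (R + 1)) + card S4 * (card S4 + 1) \<le> 4 * ((V + 1) * (R + 1)) + (V + 1) * (R + 1)"
      by (rule add_left_mono)
    show "F5 p v = max 0 ((\<Sum>a\<in>S4. M5 v a * F4 p a) + b5 v)" if "p \<in> D" "v \<in> S4" for p v
    proof -
      consider j where "v = RC j" "j \<in> J" | i where "v = RY i" "i \<in> I" using \<open>v \<in> S4\<close> by (auto simp: S4_def)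
      then show ?thesis
      proof cases
        case (1 j)
        then show ?thesis
          using finJ by (simp add: sum_S4 F5_def F4_def M5_def b5_def if_sum lookup_def clip_def algebra_simps)
      next
        case (2 i)
        have "0 \<le> cell_offset N \<delta> (fst p i)" by (simp add: cell_offset_def clip_unit)
        then show ?thesis using 2 finI by (simp add: sum_S4 F5_def F4_def M5_def b5_def if_sum)
      qed
    qed
  qed (use fins cards VW RV in auto)
  moreover have "Suc 4 = 5" "4 * ((V + 1) * (R + 1)) + (V + 1) * (R + 1) = 5 * ((V + 1) * (R + 1))"
    by (simp_all add: algebra_simps)
  ultimately show ?thesis by (simp only:)
qed

text \<open>The five layers are charged to the initial budget of \<open>relu_program\<close>, so the
  program itself starts at 0 with the offsets and coefficients in place. The clips supply the unit
  interval bounds it asks for.\<close>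

lemma words_net:
  fixes k :: nat
  assumes "\<And>j. j \<in> J \<Longrightarrow> set (wd j) \<subseteq> I"
  defines "l \<equiv> \<Sum>j\<in>J. length (wd j) * (9 * k + 9) + 1"
  shows "\<exists>G. rc (RV ` J) (5 + l) (5 * ((V + 1) * (R + 1)) + l * (R * (R + 1))) G \<and>
    (\<forall>p\<in>D. \<forall>j\<in>J. G p (RV j) =
       word_approx k (\<lambda>i. cell_offset N \<delta> (fst p i)) (wd j) (lookup M (tab j) (ci p)))"
proof -
  interpret relu_program W R 5 "5 * ((V + 1) * (R + 1))" B D net_input A0
    using fins B6 RV VW infinite_reg by unfold_locales auto
  have unit: "0 \<le> F5 p (RY i) \<and> F5 p (RY i) \<le> 1" "0 \<le> F5 p (RC j) \<and> F5 p (RC j) \<le> 1" for p i j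
    by (simp_all add: F5_def cell_offset_def lookup_def clip_unit)
  have "prog 0 S4 F5"
    using layer5 fins cards unit unfolding prog_def by (auto simp: S4_def)
  then have "\<exists>G. prog (0 + (\<Sum>j\<in>J. length (wd j) * (9 * k + 9) + 1)) (S4 \<union> RV ` J) G \<and>
    (\<forall>p\<in>D. (\<forall>v\<in>S4. G p v = F5 p v) \<and>
       (\<forall>j\<in>J. G p (RV j) = word_approx k (\<lambda>i. F5 p (RY i)) (wd j) (F5 p (RC j))))"
    by (rule prog_words) (use finJ cards assms(1) unit in \<open>auto simp: S4_def inj_on_def\<close>)
  then obtain G where G: "prog l (S4 \<union> RV ` J) G"
    "\<forall>p\<in>D. \<forall>j\<in>J. G p (RV j) = word_approx k (\<lambda>i. F5 p (RY i)) (wd j) (F5 p (RC j))"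
    unfolding l_def add_0 by blast
  have "rc (RV ` J) (5 + l) (5 * ((V + 1) * (R + 1)) + l * (R * (R + 1))) G"
    using prog_weaken[OF G(1), of "RV ` J" G] unfolding prog_def by blast
  then show ?thesis using G(2) by (auto simp: F5_def)
qed

end

section \<open>Approximation of Hoelder functions by a single network\<close>

text \<open>Splitting off the lowest digit leaves \<open>N\<close> times the digit sum of the
  shifted sequence, which division by \<open>N\<close> uncovers.\<close>

lemma digit_sum:
  fixes b :: "nat \<Rightarrow> nat"
  assumes "\<And>l. l < m \<Longrightarrow> b l < N"
  shows "(\<Sum>k<m. b k * N ^ k) < N ^ m" "l < m \<Longrightarrow> (\<Sum>k<m. b k * N ^ k) div N ^ l mod N = b l"
proof -
  have "(\<Sum>k<m. b k * N ^ k) < N ^ m \<and> (\<forall>l<m. (\<Sum>k<m. b k * N ^ k) div N ^ l mod N = b l)"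
    using assms
  proof (induction m arbitrary: b)
    case (Suc m)
    let ?S = "\<Sum>k<m. b (Suc k) * N ^ k"
    have b0: "b 0 < N" using Suc.prems by simp
    have IH: "?S < N ^ m" "\<forall>l<m. ?S div N ^ l mod N = b (Suc l)"
      using Suc.IH[of "\<lambda>k. b (Suc k)"] Suc.prems by auto
    have S: "(\<Sum>k<Suc m. b k * N ^ k) = b 0 + N * ?S"
      unfolding sum.lessThan_Suc_shift by (simp add: sum_distrib_left mult_ac)
    have "b 0 + N * ?S < N + N * ?S" using b0 by simp
    also have "\<dots> = N * Suc ?S" by simp
    also have "\<dots> \<le> N * N ^ m" using IH(1) by (intro mult_le_mono2) auto
    finally have "b 0 + N * ?S < N ^ Suc m" by simp
    moreover have "(b 0 + N * ?S) div N ^ l mod N = b l" if "l < Suc m" for l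
    proof (cases l)
      case 0
      then show ?thesis using b0 by simp
    next
      case (Suc l')
      have "(b 0 + N * ?S) div N ^ l = ((b 0 + N * ?S) div N) div N ^ l'"
        by (simp add: Suc div_mult2_eq)
      also have "(b 0 + N * ?S) div N = ?S" using b0 by simp
      finally show ?thesis using IH(2) that Suc by simp
    qed
    ultimately show ?case unfolding S by blast
  qed simp
  then show "(\<Sum>k<m. b k * N ^ k) < N ^ m" "l < m \<Longrightarrow> (\<Sum>k<m. b k * N ^ k) div N ^ l mod N = b l"
    by auto
qed

lemma digit_sum_bij:
  fixes a :: "'i \<Rightarrow> nat"
  assumes "bij_betw \<iota> I {..<m}" "\<And>i. i \<in> I \<Longrightarrow> a i < N"
  shows "(\<Sum>i\<in>I. a i * N ^ \<iota> i) < N ^ m" "i \<in> I \<Longrightarrow> (\<Sum>i\<in>I. a i * N ^ \<iota> i) div N ^ \<iota> i mod N = a i"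
proof -
  let ?b = "\<lambda>k. a (inv_into I \<iota> k)"
  have inj: "inj_on \<iota> I" and im: "\<iota> ` I = {..<m}" using assms(1) by (auto simp: bij_betw_def)
  have "(\<Sum>k<m. ?b k * N ^ k) = (\<Sum>i\<in>I. a i * N ^ \<iota> i)"
    unfolding im[symmetric] using inj by (subst sum.reindex) (auto intro!: sum.cong)
  moreover have b: "?b k < N" if "k < m" for k
    using that im by (intro assms(2)) (simp add: inv_into_into)
  ultimately show "(\<Sum>i\<in>I. a i * N ^ \<iota> i) < N ^ m"
    using digit_sum(1)[of m ?b N] by simp
  assume i: "i \<in> I"
  then have "\<iota> i < m" using im by auto
  then show "(\<Sum>i\<in>I. a i * N ^ \<iota> i) div N ^ \<iota> i mod N = a i"
    using digit_sum(2)[of m ?b N "\<iota> i"] b \<open>(\<Sum>k<m. ?b k * N ^ k) = _\<close> inv_into_f_f[OF inj i] by simp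
qed

text \<open>The constants of the finitely many components are summed up. The extra 1 in
  \<open>Bf\<close> makes it safe to divide the coefficients by it.\<close>

lemma holder_uniform:
  fixes g :: "nat \<Rightarrow> nat \<Rightarrow> ('i \<Rightarrow> real) \<Rightarrow> real"
  assumes "\<forall>p<d. \<forall>q<n. holder I s lam (g p q)"
  obtains Dg Bf Hc where "1 \<le> (Bf :: real)" "0 \<le> (Hc :: real)"
    "\<And>p q. p < d \<Longrightarrow> q < n \<Longrightarrow> holder_derivs I s (g p q) (Dg p q)"
    "\<And>p q mu x. p < d \<Longrightarrow> q < n \<Longrightarrow> multi_index I mu \<Longrightarrow> mi_order I mu \<le> s \<Longrightarrow> x \<in> unit_cube I \<Longrightarrow>
       \<bar>Dg p q mu x\<bar> \<le> Bf"
    "\<And>p q mu x y. p < d \<Longrightarrow> q < n \<Longrightarrow> multi_index I mu \<Longrightarrow> mi_order I mu = s \<Longrightarrow> x \<in> unit_cube I \<Longrightarrow>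
       y \<in> unit_cube I \<Longrightarrow> x \<noteq> y \<Longrightarrow> \<bar>Dg p q mu x - Dg p q mu y\<bar> \<le> Hc * euclid_dist I x y powr lam"
proof -
  have "\<forall>p q. \<exists>Dg B H. p < d \<longrightarrow> q < n \<longrightarrow> holder_derivs I s (g p q) Dg \<and>
     (\<forall>mu. multi_index I mu \<and> mi_order I mu \<le> s \<longrightarrow> (\<forall>x \<in> unit_cube I. \<bar>Dg mu x\<bar> \<le> B)) \<and>
     (\<forall>mu. multi_index I mu \<and> mi_order I mu = s \<longrightarrow>
         (\<forall>x \<in> unit_cube I. \<forall>y \<in> unit_cube I. x \<noteq> y \<longrightarrow>
            \<bar>Dg mu x - Dg mu y\<bar> \<le> H * euclid_dist I x y powr lam))"
    using assms unfolding holder_def by meson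
  then obtain Dg B H where *: "\<And>p q. p < d \<Longrightarrow> q < n \<Longrightarrow> holder_derivs I s (g p q) (Dg p q) \<and>
     (\<forall>mu. multi_index I mu \<and> mi_order I mu \<le> s \<longrightarrow> (\<forall>x \<in> unit_cube I. \<bar>Dg p q mu x\<bar> \<le> B p q)) \<and>
     (\<forall>mu. multi_index I mu \<and> mi_order I mu = s \<longrightarrow>
         (\<forall>x \<in> unit_cube I. \<forall>y \<in> unit_cube I. x \<noteq> y \<longrightarrow>
            \<bar>Dg p q mu x - Dg p q mu y\<bar> \<le> H p q * euclid_dist I x y powr lam))"
    by metis
  define Bf where "Bf = 1 + (\<Sum>p<d. \<Sum>q<n. \<bar>B p q\<bar>)"
  define Hc where "Hc = (\<Sum>p<d. \<Sum>q<n. \<bar>H p q\<bar>)"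
  have le: "\<bar>G p q\<bar> \<le> (\<Sum>p<d. \<Sum>q<n. \<bar>G p q\<bar>)" if "p < d" "q < n" for p q and G :: "nat \<Rightarrow> nat \<Rightarrow> real"
  proof -
    have "\<bar>G p q\<bar> \<le> (\<Sum>q<n. \<bar>G p q\<bar>)" using that by (intro member_le_sum) auto
    also have "\<dots> \<le> (\<Sum>p<d. \<Sum>q<n. \<bar>G p q\<bar>)"
      using that by (intro member_le_sum[where f = "\<lambda>p. \<Sum>q<n. \<bar>G p q\<bar>"]) (auto intro: sum_nonneg)
    finally show ?thesis .
  qed
  show ?thesis
  proof (rule that[of Bf Hc Dg])
    show "1 \<le> Bf" "0 \<le> Hc" unfolding Bf_def Hc_def by (auto intro!: sum_nonneg)
    fix p q assume pq: "p < d" "q < n"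
    show "holder_derivs I s (g p q) (Dg p q)" using *[OF pq] by blast
    show "\<bar>Dg p q mu x\<bar> \<le> Bf" if "multi_index I mu" "mi_order I mu \<le> s" "x \<in> unit_cube I" for mu x
    proof -
      have "\<bar>Dg p q mu x\<bar> \<le> B p q" using *[OF pq] that by blast
      then show ?thesis using le[OF pq, of B] by (simp add: Bf_def)
    qed
    show "\<bar>Dg p q mu x - Dg p q mu y\<bar> \<le> Hc * euclid_dist I x y powr lam"
      if "multi_index I mu" "mi_order I mu = s" "x \<in> unit_cube I" "y \<in> unit_cube I" "x \<noteq> y" for mu x y
    proof -
      have "\<bar>Dg p q mu x - Dg p q mu y\<bar> \<le> H p q * euclid_dist I x y powr lam" using *[OF pq] that by blast
      also have "\<dots> \<le> Hc * euclid_dist I x y powr lam"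
        using le[OF pq, of H] by (intro mult_right_mono) (auto simp: Hc_def)
      finally show ?thesis .
    qed
  qed
qed

text \<open>The floor of \<open>N * z\<close>, except that the minimum with \<open>N - 1\<close>
  assigns \<open>z = 1\<close> to the last cell; strictness on the right is lost only there.\<close>

lemma cell_exists:
  assumes "1 \<le> N" "0 \<le> z" "z \<le> 1"
  obtains a where "a < N" "real a \<le> real N * z" "real N * z \<le> real a + 1" "a + 1 < N \<Longrightarrow> real N * z < real a + 1"
proof (rule that[of "min (nat \<lfloor>real N * z\<rfloor>) (N - 1)"])
  have nn: "0 \<le> real N * z" and le: "real N * z \<le> real N" using assms by (auto intro: mult_left_le)
  have fl: "real (nat \<lfloor>real N * z\<rfloor>) \<le> real N * z" "real N * z < real (nat \<lfloor>real N * z\<rfloor>) + 1"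
    using nn by (auto simp: of_nat_nat le_floor_iff)
  show "min (nat \<lfloor>real N * z\<rfloor>) (N - 1) < N" using assms by simp
  show "real (min (nat \<lfloor>real N * z\<rfloor>) (N - 1)) \<le> real N * z" using fl by linarith
  show "real N * z \<le> real (min (nat \<lfloor>real N * z\<rfloor>) (N - 1)) + 1"
    using fl le assms(1) by (auto simp: min_def of_nat_diff)
  show "real N * z < real (min (nat \<lfloor>real N * z\<rfloor>) (N - 1)) + 1"
    if "min (nat \<lfloor>real N * z\<rfloor>) (N - 1) + 1 < N"
    using fl that by (auto simp: min_def split: if_splits)
qed

text \<open>Moves the mesh size out of the displacements into the coefficients. The words are then
  evaluated at offsets in the unit interval, where approximate multiplication works, and the
  coefficients only become smaller.\<close>

lemma taylor_value_scale:
  assumes "\<And>nu w \<kappa> i. (nu, w, \<kappa>) \<in> set ts \<Longrightarrow> i \<in> set w \<Longrightarrow> z i = y i / c"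
  shows "taylor_value Dg a z ts =
     (\<Sum>\<tau><length ts. case ts ! \<tau> of (nu, w, \<kappa>) \<Rightarrow> Dg nu a * \<kappa> * (1 / c) ^ length w * prod_list (map y w))"
proof -
  have prod: "prod_list (map z w) = (1 / c) ^ length w * prod_list (map y w)"
    if "\<And>i. i \<in> set w \<Longrightarrow> z i = y i / c" for w
    using that by (induction w) auto
  show ?thesis unfolding taylor_value_def sum_list_sum_nth
  proof (rule sum.cong)
    fix \<tau> assume "\<tau> \<in> {..<length ts}"
    then have \<tau>: "\<tau> < length ts" by simp
    obtain nu w \<kappa> where e: "ts ! \<tau> = (nu, w, \<kappa>)" by (cases "ts ! \<tau>")
    then have "(nu, w, \<kappa>) \<in> set ts" using nth_mem[OF \<tau>] by simp
    then have "prod_list (map z w) = (1 / c) ^ length w * prod_list (map y w)" by (intro prod assms)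
    then show "(map (\<lambda>(nu, w, \<kappa>). Dg nu a * \<kappa> * prod_list (map z w)) ts) ! \<tau> =
      (case ts ! \<tau> of (nu, w, \<kappa>) \<Rightarrow> Dg nu a * \<kappa> * (1 / c) ^ length w * prod_list (map y w))"
      using \<tau> e by simp
  qed (simp add: atLeast0LessThan)
qed

section \<open>The piecewise Taylor approximant on the grid\<close>

locale holder_grid =
  fixes I :: "'i set" and d n s :: nat and lam :: real
    and g :: "nat \<Rightarrow> nat \<Rightarrow> ('i \<Rightarrow> real) \<Rightarrow> real"
    and Dg :: "nat \<Rightarrow> nat \<Rightarrow> ('i \<Rightarrow> nat) \<Rightarrow> ('i \<Rightarrow> real) \<Rightarrow> real"
    and Bf Hc :: real and xs :: "'i list" and \<iota> :: "'i \<Rightarrow> nat"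
  assumes finI: "finite I" and neI: "I \<noteq> {}" and n1: "1 \<le> n" and lam0: "0 < lam"
    and Bf1: "1 \<le> Bf" and Hc0: "0 \<le> Hc"
    and hd: "p < d \<Longrightarrow> q < n \<Longrightarrow> holder_derivs I s (g p q) (Dg p q)"
    and hB: "p < d \<Longrightarrow> q < n \<Longrightarrow> multi_index I mu \<Longrightarrow> mi_order I mu \<le> s \<Longrightarrow> x \<in> unit_cube I \<Longrightarrow>
       \<bar>Dg p q mu x\<bar> \<le> Bf"
    and hH: "p < d \<Longrightarrow> q < n \<Longrightarrow> multi_index I mu \<Longrightarrow> mi_order I mu = s \<Longrightarrow> x \<in> unit_cube I \<Longrightarrow>
       y \<in> unit_cube I \<Longrightarrow> x \<noteq> y \<Longrightarrow> \<bar>Dg p q mu x - Dg p q mu y\<bar> \<le> Hc * euclid_dist I x y powr lam"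
    and xs: "distinct xs" "set xs = I" and \<iota>: "bij_betw \<iota> I {..<card I}"
begin

definition ts :: "(('i \<Rightarrow> nat) \<times> 'i list \<times> real) list" where "ts = taylor_terms xs s (\<lambda>_. 0)"
definition wrd :: "nat \<Rightarrow> 'i list" where "wrd \<tau> = fst (snd (ts ! \<tau>))"
definition corner :: "nat \<Rightarrow> ('i \<Rightarrow> nat) \<Rightarrow> 'i \<Rightarrow> real" where
  "corner N a = (\<lambda>i. if i \<in> I then real (a i) / real N else 0)"
definition coeff :: "nat \<Rightarrow> nat \<Rightarrow> nat \<Rightarrow> nat \<Rightarrow> ('i \<Rightarrow> nat) \<Rightarrow> real" where
  "coeff N p q \<tau> a = (case ts ! \<tau> of (nu, w, \<kappa>) \<Rightarrow> Dg p q nu (corner N a) * \<kappa> * (1 / real N) ^ length w)"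

text \<open>The registers of a network are nonnegative, so a coefficient is stored as its positive
  part (flag \<open>True\<close>) and its negative part (flag \<open>False\<close>), both scaled into the unit interval.\<close>

definition part :: "nat \<Rightarrow> nat \<Rightarrow> nat \<Rightarrow> nat \<Rightarrow> bool \<Rightarrow> ('i \<Rightarrow> nat) \<Rightarrow> real" where
  "part N p q \<tau> b a = max 0 ((if b then 1 else - 1) * coeff N p q \<tau> a / Bf)"
text \<open>Decodes \<open>cell_index\<close>: \<open>K mod n\<close> is the column, the base
  \<open>N\<close> digits of \<open>K div n\<close> are the cell. The decoded values are in range
  for every \<open>K\<close>, so all entries lie in the unit interval.\<close>

definition table :: "nat \<Rightarrow> nat \<times> nat \<times> bool \<Rightarrow> nat \<Rightarrow> real" where
  "table N = (\<lambda>(p, \<tau>, b) K. part N p (K mod n) \<tau> b (\<lambda>i. (K div n) div N ^ \<iota> i mod N))"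
definition prods :: "nat \<Rightarrow> real \<Rightarrow> nat \<Rightarrow> nat \<times> nat \<times> bool \<Rightarrow> ('i \<Rightarrow> real) \<times> nat \<Rightarrow> real" where
  "prods N \<delta> k j z = word_approx k (\<lambda>i. cell_offset N \<delta> (fst z i)) (wrd (fst (snd j)))
     (lookup (n * N ^ card I) (table N j) (cell_index I n N \<delta> \<iota> z))"
definition out :: "nat \<Rightarrow> real \<Rightarrow> nat \<Rightarrow> nat \<Rightarrow> ('i \<Rightarrow> real) \<times> nat \<Rightarrow> real" where
  "out N \<delta> k p z = (\<Sum>\<tau><length ts. Bf * (prods N \<delta> k (p, \<tau>, True) z - prods N \<delta> k (p, \<tau>, False) z))"

lemma ts_nth:
  assumes "\<tau> < length ts"
  obtains nu \<kappa> where "ts ! \<tau> = (nu, wrd \<tau>, \<kappa>)" "set (wrd \<tau>) \<subseteq> I" "length (wrd \<tau>) \<le> s" "0 \<le> \<kappa>" "\<kappa> \<le> 1"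
    "multi_index I nu" "mi_order I nu \<le> s"
proof -
  obtain nu w \<kappa> where e: "ts ! \<tau> = (nu, w, \<kappa>)" by (cases "ts ! \<tau>")
  then have "(nu, w, \<kappa>) \<in> set (taylor_terms xs s (\<lambda>_. 0))"
    using nth_mem[OF assms] by (simp add: ts_def)
  from taylor_terms_in[OF finI this] xs(2)
  have "set w \<subseteq> I \<and> length w \<le> s \<and> 0 \<le> \<kappa> \<and> \<kappa> \<le> 1 \<and> multi_index I nu \<and> mi_order I nu \<le> s"
    by (simp add: multi_index_def mi_order_def)
  then show ?thesis using e by (intro that[of nu \<kappa>]) (auto simp: wrd_def)
qed

lemma corner_cube: "1 \<le> N \<Longrightarrow> \<forall>i\<in>I. a i < N \<Longrightarrow> corner N a \<in> unit_cube I"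
  by (auto simp: corner_def unit_cube_def less_imp_le)

lemma coeff_bound:
  assumes "1 \<le> N" "p < d" "q < n" "\<tau> < length ts" "\<forall>i\<in>I. a i < N"
  shows "\<bar>coeff N p q \<tau> a\<bar> \<le> Bf"
proof -
  obtain nu \<kappa> where e: "ts ! \<tau> = (nu, wrd \<tau>, \<kappa>)" "0 \<le> \<kappa>" "\<kappa> \<le> 1" "multi_index I nu" "mi_order I nu \<le> s"
    using ts_nth[OF assms(4)] by metis
  have D: "\<bar>Dg p q nu (corner N a)\<bar> \<le> Bf"
    using hB[OF assms(2,3) e(4,5)] corner_cube[OF assms(1,5)] by simp
  have "(1 / real N) ^ length (wrd \<tau>) \<le> 1" using assms(1) by (intro power_le_one) auto
  then have "\<kappa> * (1 / real N) ^ length (wrd \<tau>) \<le> 1"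
    using e by (intro mult_le_one) auto
  then have "\<bar>Dg p q nu (corner N a)\<bar> * (\<kappa> * (1 / real N) ^ length (wrd \<tau>)) \<le> Bf * 1"
    using D e Bf1 by (intro mult_mono) auto
  then show ?thesis using e by (simp add: coeff_def abs_mult mult.assoc)
qed

lemma part_unit:
  assumes "1 \<le> N" "p < d" "q < n" "\<tau> < length ts" "\<forall>i\<in>I. a i < N"
  shows "0 \<le> part N p q \<tau> b a" "part N p q \<tau> b a \<le> 1"
  using coeff_bound[OF assms] Bf1 by (auto simp: part_def divide_le_eq)

lemma part_diff: "Bf * (part N p q \<tau> True a - part N p q \<tau> False a) = coeff N p q \<tau> a"
  using Bf1 by (cases "0 \<le> coeff N p q \<tau> a") (auto simp: part_def max_def divide_le_0_iff zero_le_divide_iff)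

lemma table_unit:
  assumes "1 \<le> N" "j \<in> {..<d} \<times> {..<length ts} \<times> UNIV"
  shows "0 \<le> table N j K \<and> table N j K \<le> 1"
proof -
  obtain p \<tau> b where j: "j = (p, \<tau>, b)" by (cases j)
  have "K mod n < n" using n1 by simp
  then show ?thesis using assms part_unit[of N p "K mod n" \<tau> "\<lambda>i. (K div n) div N ^ \<iota> i mod N" b]
    by (auto simp: j table_def)
qed

text \<open>Valid on the slabs as well, where the looked-up coefficients may be meaningless:
  clipping bounds each Taylor term by \<open>Bf\<close>.\<close>

lemma out_bound:
  assumes "1 \<le> N"
  shows "\<bar>out N \<delta> k p z\<bar> \<le> real (length ts) * Bf"
proof -
  have "\<bar>Bf * (prods N \<delta> k (p, \<tau>, True) z - prods N \<delta> k (p, \<tau>, False) z)\<bar> \<le> Bf" for \<tau>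
  proof -
    have u: "0 \<le> prods N \<delta> k j z" "prods N \<delta> k j z \<le> 1" for j
      unfolding prods_def lookup_def by (intro word_approx_unit clip_unit)+
    have "\<bar>prods N \<delta> k (p, \<tau>, True) z - prods N \<delta> k (p, \<tau>, False) z\<bar> \<le> 1"
      using u[of "(p, \<tau>, True)"] u[of "(p, \<tau>, False)"] by auto
    then show ?thesis using Bf1 by (simp add: abs_mult)
  qed
  then have "\<bar>out N \<delta> k p z\<bar> \<le> (\<Sum>\<tau><length ts. Bf)"
    unfolding out_def by (intro order_trans[OF sum_abs sum_mono])
  then show ?thesis by simp
qed

text \<open>Off the slabs the lookup returns the true coefficients of the cell. What remains is the
  Taylor error with mesh size \<open>1 / N\<close> and, for each term, two words that are each off
  by at most \<open>s * (1/4) ^ k\<close>.\<close>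

lemma out_error:
  assumes N: "1 \<le> N" and d0: "0 < \<delta>" and p: "p < d" and q: "q < n" and x: "x \<in> unit_cube I"
    and off: "off_grid I N \<delta> x"
  shows "\<bar>out N \<delta> k p (x, q) - g p q x\<bar> \<le> Hc * real (s + 2) ^ card I * real N powr - (real s + lam)
     + real (length ts) * (2 * Bf * real s) * (1/4) ^ k"
proof -
  have "\<exists>a. a < N \<and> real a \<le> real N * x i \<and> real N * x i \<le> real a + 1 \<and> level N \<delta> (x i) = real a"
    if "i \<in> I" for i
  proof -
    have "0 \<le> x i" "x i \<le> 1" using x that by (auto simp: unit_cube_def)
    from cell_exists[OF N this] obtain a where a: "a < N" "real a \<le> real N * x i"
      "real N * x i \<le> real a + 1" "a + 1 < N \<Longrightarrow> real N * x i < real a + 1" by metis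
    have "level N \<delta> (x i) = real a"
      by (rule level_cell[OF a d0]) (use off that in \<open>auto simp: off_grid_def\<close>)
    then show ?thesis using a by blast
  qed
  then obtain a where aI: "\<forall>i\<in>I. a i < N \<and> real (a i) \<le> real N * x i \<and> real N * x i \<le> real (a i) + 1 \<and>
      level N \<delta> (x i) = real (a i)"
    by metis
  have aN: "\<forall>i\<in>I. a i < N" using aI by blast
  define y where "y i = real N * x i - real (a i)" for i
  have y: "0 \<le> y i" "y i \<le> 1" "cell_offset N \<delta> (x i) = y i" if "i \<in> I" for i
    using aI that by (auto simp: y_def cell_offset_def clip_id)
  define S where "S = (\<Sum>i\<in>I. a i * N ^ \<iota> i)"
  have "S < N ^ card I" and dig: "S div N ^ \<iota> i mod N = a i" if "i \<in> I" for i
    using digit_sum_bij[OF \<iota>, of a N] aN that by (auto simp: S_def)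
  then have S: "S < N ^ card I" using neI by blast
  \<comment> \<open>All levels are exact here, so the argument of the lookup is an integer and hits
    a table entry rather than an interpolated value.\<close>
  have ci: "cell_index I n N \<delta> \<iota> (x, q) = real (q + n * S)"
    using aI by (simp add: cell_index_def S_def sum_distrib_left mult_ac cong: sum.cong)
  have "q + n * S < n * Suc S" using q by simp
  also have "\<dots> \<le> n * N ^ card I" using S by (intro mult_le_mono2) auto
  finally have KM: "q + n * S \<le> n * N ^ card I" by simp
  have tab: "table N (p, \<tau>, b) (q + n * S) = part N p q \<tau> b a" for \<tau> b
  proof -
    have "corner N (\<lambda>i. S div N ^ \<iota> i mod N) = corner N a" using dig by (auto simp: corner_def)
    then have "coeff N p q \<tau> (\<lambda>i. S div N ^ \<iota> i mod N) = coeff N p q \<tau> a" by (simp add: coeff_def)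
    then show ?thesis using q by (simp add: table_def part_def)
  qed
  have word: "\<bar>prods N \<delta> k (p, \<tau>, b) (x, q) - prod_list (map y (wrd \<tau>)) * part N p q \<tau> b a\<bar>
      \<le> real s * (1/4) ^ k" if \<tau>: "\<tau> < length ts" for \<tau> b
  proof -
    obtain nu \<kappa> where e: "set (wrd \<tau>) \<subseteq> I" "length (wrd \<tau>) \<le> s" using ts_nth[OF \<tau>] by metis
    note pu = part_unit[OF N p q \<tau> aN]
    have "lookup (n * N ^ card I) (table N (p, \<tau>, b)) (real (q + n * S)) = part N p q \<tau> b a"
      using lookup_nat[OF KM, of "table N (p, \<tau>, b)"] pu unfolding tab by blast
    moreover have "word_approx k (\<lambda>i. cell_offset N \<delta> (x i)) (wrd \<tau>) c = word_approx k y (wrd \<tau>) c" for c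
      unfolding word_approx_def using y(3) e(1) by (intro foldr_cong) auto
    ultimately have "prods N \<delta> k (p, \<tau>, b) (x, q) = word_approx k y (wrd \<tau>) (part N p q \<tau> b a)"
      unfolding prods_def ci fst_conv snd_conv by simp
    also have "\<bar>\<dots> - prod_list (map y (wrd \<tau>)) * part N p q \<tau> b a\<bar> \<le> length (wrd \<tau>) * (1/4) ^ k"
      using pu y e(1) by (intro word_approx_error) auto
    also have "\<dots> \<le> real s * (1/4) ^ k" using e(2) by (intro mult_right_mono) auto
    finally show ?thesis .
  qed
  define z where "z = (\<lambda>i. x i - corner N a i)"
  have tv: "taylor_value (Dg p q) (corner N a) z ts =
      (\<Sum>\<tau><length ts. coeff N p q \<tau> a * prod_list (map y (wrd \<tau>)))"
  proof -
    have "taylor_value (Dg p q) (corner N a) z ts = (\<Sum>\<tau><length ts. case ts ! \<tau> of (nu, w, \<kappa>) \<Rightarrow>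
       Dg p q nu (corner N a) * \<kappa> * (1 / real N) ^ length w * prod_list (map y w))"
    proof (rule taylor_value_scale)
      fix nu w \<kappa> i assume "(nu, w, \<kappa>) \<in> set ts" "i \<in> set w"
      then have "set w \<subseteq> I" using taylor_terms_in[OF finI, of nu w \<kappa> xs s "\<lambda>_. 0"] xs(2)
        by (simp add: ts_def multi_index_def)
      then have "i \<in> I" using \<open>i \<in> set w\<close> by blast
      then show "z i = y i / real N" using N by (simp add: z_def corner_def y_def field_simps)
    qed
    also have "\<dots> = (\<Sum>\<tau><length ts. coeff N p q \<tau> a * prod_list (map y (wrd \<tau>)))"
      by (intro sum.cong) (auto simp: coeff_def wrd_def split: prod.splits)
    finally show ?thesis .
  qed
  have "\<bar>out N \<delta> k p (x, q) - taylor_value (Dg p q) (corner N a) z ts\<bar>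
      \<le> (\<Sum>\<tau><length ts. 2 * Bf * real s * (1/4) ^ k)"
    unfolding out_def tv sum_subtractf[symmetric]
  proof (rule order_trans[OF sum_abs sum_mono])
    fix \<tau> assume "\<tau> \<in> {..<length ts}"
    then have \<tau>: "\<tau> < length ts" by simp
    let ?p = "prod_list (map y (wrd \<tau>))"
    let ?e = "\<lambda>b. prods N \<delta> k (p, \<tau>, b) (x, q) - ?p * part N p q \<tau> b a"
    have "Bf * (prods N \<delta> k (p, \<tau>, True) (x, q) - prods N \<delta> k (p, \<tau>, False) (x, q)) - coeff N p q \<tau> a * ?p
       = Bf * (?e True - ?e False)"
      unfolding part_diff[symmetric] by (simp add: algebra_simps)
    then have "\<bar>Bf * (prods N \<delta> k (p, \<tau>, True) (x, q) - prods N \<delta> k (p, \<tau>, False) (x, q)) -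
        coeff N p q \<tau> a * ?p\<bar> = Bf * \<bar>?e True - ?e False\<bar>"
      using Bf1 by (simp add: abs_mult)
    also have "\<dots> \<le> Bf * (real s * (1/4) ^ k + real s * (1/4) ^ k)"
      using Bf1 by (intro mult_left_mono order_trans[OF abs_triangle_ineq4] add_mono word[OF \<tau>]) auto
    finally show "\<bar>Bf * (prods N \<delta> k (p, \<tau>, True) (x, q) - prods N \<delta> k (p, \<tau>, False) (x, q)) -
        coeff N p q \<tau> a * ?p\<bar> \<le> 2 * Bf * real s * (1/4) ^ k"
      by (simp add: algebra_simps)
  qed
  then have 1: "\<bar>out N \<delta> k p (x, q) - taylor_value (Dg p q) (corner N a) z ts\<bar>
      \<le> real (length ts) * (2 * Bf * real s) * (1/4) ^ k" by simp
  have "\<bar>Dg p q (\<lambda>_. 0) x - taylor_value (Dg p q) (corner N a) (\<lambda>i. x i - corner N a i) (taylor_terms xs s (\<lambda>_. 0))\<bar>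
     \<le> Hc * real (s + 2) ^ length xs * (1 / real N) powr (real s + lam)"
  proof (rule taylor_multi[OF finI hd[OF p q] hH[OF p q] Hc0 lam0])
    show "corner N a \<in> unit_cube I" using N aN by (rule corner_cube)
    show "corner N a i \<le> x i \<and> x i \<le> corner N a i + 1 / real N" if "i \<in> set xs" for i
      using that xs(2) aI N by (auto simp: corner_def field_simps)
    show "x i = corner N a i" if "i \<notin> set xs" for i
      using that xs(2) x by (auto simp: corner_def unit_cube_def)
  qed (use xs x N in \<open>auto simp: multi_index_def mi_order_def\<close>)
  moreover have "Dg p q (\<lambda>_. 0) x = g p q x" using hd[OF p q] x by (simp add: holder_derivs_def)
  moreover have "(1 / real N) powr (real s + lam) = real N powr - (real s + lam)"
    using N by (simp only: powr_divide powr_minus_divide powr_one_eq_one)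
  moreover have "length xs = card I" using xs distinct_card by fastforce
  ultimately have 2: "\<bar>g p q x - taylor_value (Dg p q) (corner N a) z ts\<bar>
      \<le> Hc * real (s + 2) ^ card I * real N powr - (real s + lam)"
    by (simp add: z_def ts_def)
  show ?thesis using 1 2 by linarith
qed

text \<open>A single constant \<open>c\<close>, chosen before \<open>N\<close>, \<open>k\<close> and
  \<open>\<delta>\<close>, covers all budgets, so that the three parameters can later be tuned to
  the accuracy. \<open>pos\<close> and \<open>posq\<close> are the rows in which the network finds
  the entries of the matrix and the column number.\<close>

lemma grid_net:
  fixes pos :: "'i \<Rightarrow> nat" and posq a :: nat
  assumes pos: "inj_on pos I" "pos ` I \<subseteq> {..<a}" "posq < a" "posq \<notin> pos ` I"
  shows "\<exists>c\<ge>1. \<forall>N k \<delta>. 1 \<le> N \<longrightarrow> 0 < \<delta> \<longrightarrow> (\<exists>W P net. 1 \<le> length net \<and>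
     real (length net) \<le> c * (real k + 1) \<and> real W \<le> c * real N ^ card I \<and>
     real P \<le> c * (real N ^ card I + real k) \<and>
     sparse_fnn (c * real N ^ card I + 1 / \<delta>) P net \<and>
     (\<forall>p<d. \<forall>q<n. \<forall>x\<in>unit_cube I. \<forall>X. (\<forall>i\<in>I. X (pos i) = x i) \<longrightarrow> X posq = real q \<longrightarrow>
        fnn_eval a d W net X p = out N \<delta> k p (x, q)))"
proof -
  define m where "m = card I"
  have m1: "1 \<le> m" using finI neI by (simp add: m_def Suc_le_eq card_gt_0_iff)
  define J where "J = {..<d} \<times> {..<length ts} \<times> (UNIV :: bool set)"
  have finJ: "finite J" by (simp add: J_def)
  define R where "R = m + 2 * card J + 9"
  \<comment> \<open>\<open>A * Q\<close> exceeds the three lower bounds on \<open>V\<close>.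
    \<open>cl\<close> covers the words, as \<open>s * (9 * k + 9) + 1\<close> is at most
    \<open>(9 * s + 1) * (k + 1)\<close>. \<open>cP\<close> adds up the five lookup layers, the
    words (with a 2 because \<open>k + 1\<close> is at most \<open>2 * (Q + k)\<close>) and the
    output layer. \<open>Bf\<close> is part of \<open>c\<close> as an output weight.\<close>
  define A where "A = R + 1 + 3 * m + 2 * n"
  define cl where "cl = card J * (9 * s + 1)"
  define cP where "cP = 5 * ((A + 1) * (R + 1)) + 2 * (cl * (R * (R + 1))) + d * (card J + 1)"
  define c where "c = real (6 + cl + A + cP + n + 8) + Bf"
  have c1: "1 \<le> c" using Bf1 by (simp add: c_def)
  have "\<exists>W P net. 1 \<le> length net \<and>
     real (length net) \<le> c * (real k + 1) \<and> real W \<le> c * real N ^ m \<and>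
     real P \<le> c * (real N ^ m + real k) \<and>
     sparse_fnn (c * real N ^ m + 1 / \<delta>) P net \<and>
     (\<forall>p<d. \<forall>q<n. \<forall>x\<in>unit_cube I. \<forall>X. (\<forall>i\<in>I. X (pos i) = x i) \<longrightarrow> X posq = real q \<longrightarrow>
        fnn_eval a d W net X p = out N \<delta> k p (x, q))"
    if N: "1 \<le> N" and \<delta>: "0 < \<delta>" for N k :: nat and \<delta> :: real
  proof -
    define Q where "Q = N ^ m"
    have Q1: "1 \<le> Q" using N by (simp add: Q_def)
    have NQ: "N \<le> Q" using self_le_power[of N m] N m1 by (simp add: Q_def)
    define V where "V = A * Q"
    define B where "B = c * real Q + 1 / \<delta>"
    define D where "D = {z :: ('i \<Rightarrow> real) \<times> nat. fst z \<in> unit_cube I \<and> snd z < n}"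
    have RQ: "R * 1 \<le> R * Q" "m * 1 \<le> m * Q" "m * N \<le> m * Q" "1 \<le> Q"
      using Q1 NQ by (auto intro: mult_le_mono2)
    have Vs: "R \<le> V" "m + 1 + 2 * m * N \<le> V" "m + 2 * (n * Q) \<le> V"
    proof -
      have "V = R * Q + Q + 3 * (m * Q) + 2 * (n * Q)" by (simp add: V_def A_def algebra_simps)
      then show "R \<le> V" "m + 1 + 2 * m * N \<le> V" "m + 2 * (n * Q) \<le> V"
        using RQ unfolding mult.assoc mult_1_right by linarith+
    qed
    have cQ: "c \<le> c * real Q" using c1 Q1 by simp
    have nQ: "real n * real Q + 8 + real Q \<le> c * real Q"
    proof -
      have "(real n + 8 + 1) * real Q \<le> c * real Q"
        using Bf1 by (intro mult_right_mono) (auto simp: c_def)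
      moreover have "8 \<le> 8 * real Q" using Q1 by simp
      ultimately show ?thesis by (simp add: distrib_right)
    qed
    have d1: "0 \<le> 1 / \<delta>" using \<delta> by simp
    have B: "6 \<le> B" "1 + 1 / \<delta> \<le> B" "real (n * Q) + 1 \<le> B" "real N \<le> B" "Bf \<le> B"
    proof -
      have "0 \<le> real n * real Q" "0 \<le> real Q" "real N \<le> real Q" "Bf \<le> c" using NQ by (auto simp: c_def)
      then show "6 \<le> B" "1 + 1 / \<delta> \<le> B" "real (n * Q) + 1 \<le> B" "real N \<le> B" "Bf \<le> B"
        using nQ cQ d1 unfolding B_def of_nat_mult by linarith+
    qed
    have B\<iota>: "real (n * N ^ \<iota> i) \<le> B" if "i \<in> I" for i
    proof -
      have "\<iota> i < m" using \<iota> that by (auto simp: bij_betw_def m_def)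
      then have "n * N ^ \<iota> i \<le> n * Q" using N unfolding Q_def by (intro mult_le_mono2 power_increasing) auto
      then have "real (n * N ^ \<iota> i) \<le> real (n * Q)" by (simp only: of_nat_le_iff)
      then show ?thesis using B(3) by linarith
    qed
    interpret L: lookup_net I J N "n * Q" n \<delta> B \<iota> "table N" V R V D
    proof
      show "0 \<le> table N j k \<and> table N j k \<le> 1" if "j \<in> J" for j k
        using table_unit[OF N] that by (simp add: J_def)
      show "0 \<le> fst p i" if "p \<in> D" "i \<in> I" for p i
        using that by (auto simp: D_def unit_cube_def)
    qed (use finI finJ N \<delta> B B\<iota> Vs in \<open>auto simp: R_def m_def[symmetric] mult.assoc\<close>)
    let ?wd = "\<lambda>j :: nat \<times> nat \<times> bool. wrd (fst (snd j))"
    have wd: "set (?wd j) \<subseteq> I" "length (?wd j) \<le> s" if j: "j \<in> J" for j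
    proof -
      have "fst (snd j) < length ts" using j by (auto simp: J_def)
      then show "set (?wd j) \<subseteq> I" "length (?wd j) \<le> s" by (auto elim: ts_nth)
    qed
    define l where "l = (\<Sum>j\<in>J. length (?wd j) * (9 * k + 9) + 1)"
    have "l \<le> (\<Sum>j\<in>J. s * (9 * k + 9) + 1)"
      unfolding l_def using wd(2) by (intro sum_mono add_right_mono mult_le_mono1)
    also have "\<dots> = card J * (s * (9 * k + 9) + 1)" by simp
    also have "\<dots> \<le> card J * ((9 * s + 1) * (k + 1))"
      by (intro mult_le_mono2) (simp add: algebra_simps)
    also have "\<dots> = cl * (k + 1)" by (simp only: cl_def mult.assoc)
    finally have l: "l \<le> cl * (k + 1)" .
    obtain G where G: "relu_comp V B D net_input L.A0 (RV ` J) (5 + l)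
        (5 * ((V + 1) * (R + 1)) + l * (R * (R + 1))) G"
      "\<forall>z\<in>D. \<forall>j\<in>J. G z (RV j) = prods N \<delta> k j z"
      using L.words_net[of ?wd k] wd(1) unfolding l_def[symmetric] prods_def m_def[symmetric] Q_def[symmetric]
      by blast
    \<comment> \<open>Among the input registers only \<open>RQ\<close> falls under the last
      case.\<close>
    define e0 :: "('i, nat \<times> nat \<times> bool) reg \<Rightarrow> nat" where
      "e0 v = (case v of RX i \<Rightarrow> pos i | _ \<Rightarrow> posq)" for v
    have e0: "inj_on e0 L.A0" "e0 ` L.A0 \<subseteq> {..<a}"
      using pos by (auto simp: L.A0_def e0_def inj_on_def)
    \<comment> \<open>The output weights undo the scaling by \<open>Bf\<close> and reunite positive
      and negative parts.\<close>
    define O' :: "nat \<Rightarrow> ('i, nat \<times> nat \<times> bool) reg \<Rightarrow> real" where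
      "O' p v = (case v of RV (p', \<tau>, b) \<Rightarrow> if p = p' then (if b then Bf else - Bf) else 0 | _ \<Rightarrow> 0)" for p v
    have O': "\<bar>O' p v\<bar> \<le> B" if "v \<in> RV ` J" for p v
      using that B Bf1 by (auto simp: O'_def)
    let ?RJ = "RV ` J :: ('i, nat \<times> nat \<times> bool) reg set"
    have "\<exists>net. length net = Suc (5 + l) \<and>
        sparse_fnn B (5 * ((V + 1) * (R + 1)) + l * (R * (R + 1)) + d * (card ?RJ + 1)) net \<and>
       (\<forall>z\<in>D. \<forall>X. (\<forall>v\<in>L.A0. X (e0 v) = net_input z v) \<longrightarrow>
        (\<forall>p<d. fnn_eval a d V net X p = (\<Sum>v\<in>?RJ. O' p v * G z v) + 0))"
      by (rule relu_comp_fnn[OF G(1) L.fins(1) e0]) (use O' B(1) in auto)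
    moreover have "card ?RJ = card J" by (intro card_image) (auto simp: inj_on_def)
    ultimately obtain net where net: "length net = Suc (5 + l)"
        "sparse_fnn B (5 * ((V + 1) * (R + 1)) + l * (R * (R + 1)) + d * (card J + 1)) net"
       "\<forall>z\<in>D. \<forall>X. (\<forall>v\<in>L.A0. X (e0 v) = net_input z v) \<longrightarrow>
        (\<forall>p<d. fnn_eval a d V net X p = (\<Sum>v\<in>?RJ. O' p v * G z v) + 0)"
      by (simp only:) (elim exE conjE)
    have eval: "fnn_eval a d V net X p = out N \<delta> k p (x, q)"
      if p: "p < d" and q: "q < n" and x: "x \<in> unit_cube I"
        and X: "\<forall>i\<in>I. X (pos i) = x i" "X posq = real q" for p q x X
    proof -
      have z: "(x, q) \<in> D" using x q by (simp add: D_def)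
      have "\<forall>v\<in>L.A0. X (e0 v) = net_input (x, q) v"
        using X by (auto simp: L.A0_def e0_def net_input_def)
      then have "fnn_eval a d V net X p = (\<Sum>v\<in>RV ` J. O' p v * G (x, q) v)"
        using net(3) z p by simp
      also have "\<dots> = (\<Sum>j\<in>J. O' p (RV j) * prods N \<delta> k j (x, q))"
        using G(2) z by (subst sum.reindex) (auto simp: inj_on_def)
      also have "\<dots> = (\<Sum>p'<d. \<Sum>\<tau><length ts. \<Sum>b\<in>UNIV. O' p (RV (p', \<tau>, b)) * prods N \<delta> k (p', \<tau>, b) (x, q))"
        unfolding J_def sum.cartesian_product by (intro sum.cong) auto
      also have "\<dots> = (\<Sum>p'<d. if p = p' then out N \<delta> k p (x, q) else 0)"
        by (intro sum.cong) (auto simp: O'_def out_def UNIV_bool algebra_simps)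
      also have "\<dots> = out N \<delta> k p (x, q)" using p by simp
      finally show ?thesis .
    qed
    have len: "real (length net) \<le> c * (real k + 1)"
    proof -
      have "length net \<le> (6 + cl) * (k + 1)" using net(1) l unfolding distrib_right[of 6 cl] by simp
      then have "real (length net) \<le> real ((6 + cl) * (k + 1))" by (simp only: of_nat_le_iff)
      also have "\<dots> = real (6 + cl) * (real k + 1)" by (simp add: algebra_simps)
      also have "\<dots> \<le> c * (real k + 1)" using Bf1 by (intro mult_right_mono) (auto simp: c_def)
      finally show ?thesis .
    qed
    have wid: "real V \<le> c * real N ^ m"
    proof -
      have "real V = real A * real N ^ m" by (simp add: V_def Q_def)
      also have "\<dots> \<le> c * real N ^ m" using Bf1 by (intro mult_right_mono) (auto simp: c_def)
      finally show ?thesis .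
    qed
    have par: "real (5 * ((V + 1) * (R + 1)) + l * (R * (R + 1)) + d * (card J + 1)) \<le> c * (real N ^ m + real k)"
    proof -
      have "5 * ((V + 1) * (R + 1)) \<le> 5 * (((A + 1) * Q) * (R + 1))"
        using Q1 by (intro mult_le_mono2 mult_le_mono1) (simp add: V_def)
      also have "\<dots> = 5 * ((A + 1) * (R + 1)) * Q" by (simp only: mult_ac)
      also have "\<dots> \<le> 5 * ((A + 1) * (R + 1)) * (Q + k)" by (intro mult_le_mono2) simp
      finally have 1: "5 * ((V + 1) * (R + 1)) \<le> 5 * ((A + 1) * (R + 1)) * (Q + k)" .
      have "l * (R * (R + 1)) \<le> (cl * (k + 1)) * (R * (R + 1))" using l by (rule mult_le_mono1)
      also have "\<dots> = (cl * (R * (R + 1))) * (k + 1)" by (simp only: mult_ac)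
      also have "\<dots> \<le> (cl * (R * (R + 1))) * (2 * (Q + k))" using Q1 by (intro mult_le_mono2) simp
      finally have 2: "l * (R * (R + 1)) \<le> 2 * (cl * (R * (R + 1))) * (Q + k)" by (simp only: mult_ac)
      have 3: "d * (card J + 1) * 1 \<le> d * (card J + 1) * (Q + k)" using Q1 by (intro mult_le_mono2) simp
      have "5 * ((V + 1) * (R + 1)) + l * (R * (R + 1)) + d * (card J + 1) \<le> cP * (Q + k)"
        using add_mono[OF add_mono[OF 1 2] 3] unfolding cP_def distrib_right mult_1_right .
      then have "real (5 * ((V + 1) * (R + 1)) + l * (R * (R + 1)) + d * (card J + 1)) \<le> real (cP * (Q + k))"
        by (simp only: of_nat_le_iff)
      also have "\<dots> = real cP * (real N ^ m + real k)" by (simp add: Q_def)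
      also have "\<dots> \<le> c * (real N ^ m + real k)" using Bf1 by (intro mult_right_mono) (auto simp: c_def)
      finally show ?thesis .
    qed
    have "sparse_fnn (c * real N ^ m + 1 / \<delta>)
       (5 * ((V + 1) * (R + 1)) + l * (R * (R + 1)) + d * (card J + 1)) net"
      using net(2) by (simp only: B_def Q_def of_nat_power)
    moreover have "1 \<le> length net" using net(1) by simp
    ultimately show ?thesis using len wid par eval
      by (intro exI[of _ V] exI[of _ "5 * ((V + 1) * (R + 1)) + l * (R * (R + 1)) + d * (card J + 1)"]
          exI[of _ net] conjI allI impI ballI)
  qed
  then show ?thesis using c1 unfolding m_def by (intro exI[of _ c] conjI allI impI)
qed

text \<open>Tunes the grid: \<open>N\<close> makes the Taylor error and \<open>k\<close> the
  multiplication error at most \<open>\<epsilon> / 4\<close>, and \<open>\<delta>\<close> makes the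
  slabs contribute half of \<open>\<epsilon> powr t\<close>. \<open>T\<close> is described through
  some column \<open>X\<close> with the right entries, because the columns produced by the attention
  layer contain further rows.\<close>

lemma column_net:
  fixes pos :: "'i \<Rightarrow> nat" and posq a :: nat and t :: real
  assumes pos: "inj_on pos I" "pos ` I \<subseteq> {..<a}" "posq < a" "posq \<notin> pos ` I" and t: "1 \<le> t"
  defines "m \<equiv> real (card I)" and "\<gamma> \<equiv> real s + lam"
  shows "\<exists>C>0. \<forall>\<epsilon>. 0 < \<epsilon> \<and> \<epsilon> < 1 \<longrightarrow> (\<exists>W P net. 1 \<le> length net \<and>
     real (length net) \<le> C * (1 + ln (1 / \<epsilon>)) \<and> real W \<le> C * \<epsilon> powr (- m / \<gamma>) \<and>
     real P \<le> C * \<epsilon> powr (- m / \<gamma>) \<and>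
     sparse_fnn (C * \<epsilon> powr (- (7 * m + \<gamma> + 2) * t / \<gamma>)) P net \<and>
     (\<forall>p<d. \<forall>q<n. \<forall>T. (\<forall>x\<in>unit_cube I. \<exists>X. (\<forall>i\<in>I. X (pos i) = x i) \<and> X posq = real q \<and>
        T x = fnn_eval a d W net X p) \<longrightarrow> Lt_norm I t (\<lambda>x. T x - g p q x) \<le> ereal \<epsilon>))"
proof -
  have m1: "1 \<le> m" using finI neI by (simp add: m_def Suc_le_eq card_gt_0_iff)
  have g0: "0 < \<gamma>" using lam0 by (simp add: \<gamma>_def)
  obtain c where c1: "1 \<le> c" and c: "\<forall>N k \<delta>. 1 \<le> N \<longrightarrow> 0 < \<delta> \<longrightarrow> (\<exists>W P net. 1 \<le> length net \<and>
     real (length net) \<le> c * (real k + 1) \<and> real W \<le> c * real N ^ card I \<and>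
     real P \<le> c * (real N ^ card I + real k) \<and>
     sparse_fnn (c * real N ^ card I + 1 / \<delta>) P net \<and>
     (\<forall>p<d. \<forall>q<n. \<forall>x\<in>unit_cube I. \<forall>X. (\<forall>i\<in>I. X (pos i) = x i) \<longrightarrow> X posq = real q \<longrightarrow>
        fnn_eval a d W net X p = out N \<delta> k p (x, q)))"
    using grid_net[OF pos] by (elim exE conjE)
  define K where "K = (real (length ts) + 1) * Bf"
  define E1 where "E1 = Hc * real (s + 2) ^ card I"
  define E2 where "E2 = real (length ts) * (2 * Bf * real s)"
  \<comment> \<open>With \<open>4 * E1 + 1\<close> the product
    \<open>E1 * (\<epsilon> / c\<^sub>1)\<close> is at most \<open>\<epsilon> / 4\<close>, and
    \<open>c\<^sub>1 / \<epsilon>\<close> exceeds 1 even if \<open>E1\<close> vanishes; likewise for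
    \<open>c\<^sub>2\<close>.\<close>
  define c\<^sub>1 where "c\<^sub>1 = 4 * E1 + 1"
  define c\<^sub>2 where "c\<^sub>2 = 4 * E2 + 1"
  define C\<^sub>1 where "C\<^sub>1 = c\<^sub>1 powr (1 / \<gamma>) + 1"
  define L where "L = ln c\<^sub>2 + 2"
  define C where "C = 1 + c * L + c * C\<^sub>1 ^ card I + c * (C\<^sub>1 ^ card I + L * (1 + \<gamma> / m)) + 2 * m * K powr t * C\<^sub>1"
  have E: "0 \<le> E1" "0 \<le> E2" using Hc0 Bf1 by (simp_all add: E1_def E2_def)
  have cc: "1 \<le> c\<^sub>1" "1 \<le> c\<^sub>2" using E by (simp_all add: c\<^sub>1_def c\<^sub>2_def)
  have K1: "1 \<le> K" using Bf1 mult_mono[of 1 "real (length ts) + 1" 1 Bf] by (simp add: K_def)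
  have C1: "1 \<le> C\<^sub>1" by (simp add: C\<^sub>1_def)
  have L2: "2 \<le> L" using cc by (simp add: L_def)
  have parts: "0 \<le> c * L" "0 \<le> c * C\<^sub>1 ^ card I" "0 \<le> c * (C\<^sub>1 ^ card I + L * (1 + \<gamma> / m))" "0 \<le> 2 * m * K powr t * C\<^sub>1"
    using c1 L2 C1 g0 m1 by simp_all
  then have C0: "0 < C" unfolding C_def by linarith
  have CL: "c * L \<le> C" and CW: "c * C\<^sub>1 ^ card I \<le> C" and CP: "c * (C\<^sub>1 ^ card I + L * (1 + \<gamma> / m)) \<le> C"
    and CB: "c * C\<^sub>1 ^ card I + 2 * m * K powr t * C\<^sub>1 \<le> C"
    using parts unfolding C_def by linarith+
  show ?thesis
  proof (intro exI[of _ C] conjI allI impI C0)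
    fix \<epsilon> :: real assume "0 < \<epsilon> \<and> \<epsilon> < 1"
    then have e0: "0 < \<epsilon>" and e1: "\<epsilon> < 1" by auto
    have inv: "(1 / \<epsilon>) powr b = \<epsilon> powr - b" for b
      by (simp only: powr_divide powr_minus_divide powr_one_eq_one)
    have ln0: "0 < ln (1 / \<epsilon>)" using e0 e1 by (simp add: ln_div)
    define X where "X = \<epsilon> powr (- m / \<gamma>)"
    define u where "u = (c\<^sub>1 / \<epsilon>) powr (1 / \<gamma>)"
    define N where "N = nat \<lceil>u\<rceil>"
    define v where "v = ln (c\<^sub>2 / \<epsilon>)"
    define k where "k = nat \<lceil>v\<rceil>"
    \<comment> \<open>Chosen so that at most \<open>m * N\<close> slabs, each contributing
      \<open>\<delta> * K powr t\<close>, add up to \<open>\<epsilon> powr t / 2\<close>.\<close>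
    define \<delta> where "\<delta> = \<epsilon> powr t / (2 * (m * real N) * K powr t)"
    have "1 < c\<^sub>1 / \<epsilon>" using cc e0 e1 by (simp add: less_divide_eq)
    then have u1: "1 < u" using g0 by (simp add: u_def gr_one_powr)
    have "real N = of_int \<lceil>u\<rceil>" using u1 by (simp add: N_def)
    then have Nu: "u \<le> real N" "real N \<le> u + 1"
      using le_of_int_ceiling[of u] of_int_ceiling_le_add_one[of u] by simp_all
    then have N1: "1 \<le> N" using u1 by simp
    have u_e: "u = c\<^sub>1 powr (1 / \<gamma>) * \<epsilon> powr (- 1 / \<gamma>)"
    proof -
      have "u = (c\<^sub>1 * (1 / \<epsilon>)) powr (1 / \<gamma>)" by (simp add: u_def)
      also have "\<dots> = c\<^sub>1 powr (1 / \<gamma>) * (1 / \<epsilon>) powr (1 / \<gamma>)" by (rule powr_mult)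
      finally show ?thesis unfolding inv minus_divide_left .
    qed
    have one: "1 \<le> \<epsilon> powr - b" if "0 \<le> b" for b
      using ge_one_powr_ge_zero[of "1 / \<epsilon>" b] e0 e1 that unfolding inv by simp
    have Nle: "real N \<le> C\<^sub>1 * \<epsilon> powr (- 1 / \<gamma>)"
    proof -
      have "1 \<le> \<epsilon> powr (- 1 / \<gamma>)" using one[of "1 / \<gamma>"] g0 unfolding minus_divide_left by simp
      then show ?thesis using Nu(2) unfolding u_e C\<^sub>1_def distrib_right by linarith
    qed
    have NX: "real N ^ card I \<le> C\<^sub>1 ^ card I * X"
    proof -
      have "real N ^ card I \<le> (C\<^sub>1 * \<epsilon> powr (- 1 / \<gamma>)) ^ card I" using Nle by (intro power_mono) auto
      also have "\<dots> = C\<^sub>1 ^ card I * X"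
        using e0 by (simp add: power_mult_distrib X_def m_def powr_powr powr_realpow[symmetric])
      finally show ?thesis .
    qed
    have v0: "0 < v" using cc e0 e1 by (simp add: v_def less_divide_eq)
    have "real k = of_int \<lceil>v\<rceil>" using v0 by (simp add: k_def)
    then have kv: "v \<le> real k" "real k \<le> v + 1"
      using le_of_int_ceiling[of v] of_int_ceiling_le_add_one[of v] by simp_all
    have kL: "real k + 1 \<le> L * (1 + ln (1 / \<epsilon>))"
    proof -
      have "v = ln c\<^sub>2 + ln (1 / \<epsilon>)" using cc e0 by (simp add: v_def ln_div)
      then have "real k + 1 \<le> L + ln (1 / \<epsilon>)" using kv by (simp add: L_def)
      also have "\<dots> \<le> L + L * ln (1 / \<epsilon>)" using L2 ln0 mult_right_mono[of 1 L "ln (1 / \<epsilon>)"] by simp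
      finally show ?thesis by (simp add: distrib_left)
    qed
    \<comment> \<open>The parameters of the deep part number about
      \<open>ln (1 / \<epsilon>)\<close>; they are absorbed by the power of
      \<open>1 / \<epsilon>\<close> already paid for the table, through
      \<open>ln y \<le> y powr b / b\<close>.\<close>
    have lnX: "1 + ln (1 / \<epsilon>) \<le> (1 + \<gamma> / m) * X"
    proof -
      have "ln (1 / \<epsilon>) \<le> (1 / \<epsilon>) powr (m / \<gamma>) / (m / \<gamma>)"
        using e0 e1 m1 g0 by (intro ln_powr_bound) auto
      also have "(1 / \<epsilon>) powr (m / \<gamma>) = X" unfolding inv X_def minus_divide_left ..
      finally have "ln (1 / \<epsilon>) \<le> \<gamma> / m * X" by (simp add: mult.commute)
      moreover have "1 \<le> X" using one[of "m / \<gamma>"] m1 g0 unfolding X_def minus_divide_left by simp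
      ultimately show ?thesis by (simp add: distrib_right)
    qed
    have Kt: "0 < K powr t" using K1 by simp
    have d0: "0 < \<delta>" using e0 m1 N1 Kt by (simp add: \<delta>_def)
    obtain W P net where net: "1 \<le> length net" "real (length net) \<le> c * (real k + 1)"
      "real W \<le> c * real N ^ card I" "real P \<le> c * (real N ^ card I + real k)"
      "sparse_fnn (c * real N ^ card I + 1 / \<delta>) P net"
      "\<forall>p<d. \<forall>q<n. \<forall>x\<in>unit_cube I. \<forall>X. (\<forall>i\<in>I. X (pos i) = x i) \<longrightarrow> X posq = real q \<longrightarrow>
        fnn_eval a d W net X p = out N \<delta> k p (x, q)"
      using c[rule_format, OF N1 d0, of k] by (elim exE conjE)
    have len: "real (length net) \<le> C * (1 + ln (1 / \<epsilon>))"
    proof -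
      have "c * (real k + 1) \<le> c * (L * (1 + ln (1 / \<epsilon>)))" using kL c1 by (intro mult_left_mono) auto
      also have "\<dots> \<le> C * (1 + ln (1 / \<epsilon>))"
        using CL ln0 by (simp only: mult.assoc[symmetric]) (intro mult_right_mono, auto)
      finally show ?thesis using net(2) by linarith
    qed
    have X0: "0 \<le> X" by (simp add: X_def)
    have cNX: "c * real N ^ card I \<le> c * C\<^sub>1 ^ card I * X"
      using NX c1 unfolding mult.assoc by (intro mult_left_mono) auto
    have wid: "real W \<le> C * X"
      using net(3) cNX mult_right_mono[OF CW X0] by linarith
    have par: "real P \<le> C * X"
    proof -
      have "real k \<le> L * (1 + ln (1 / \<epsilon>))" using kL by linarith
      also have "\<dots> \<le> L * ((1 + \<gamma> / m) * X)" using lnX L2 by (intro mult_left_mono) auto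
      finally have "real N ^ card I + real k \<le> (C\<^sub>1 ^ card I + L * (1 + \<gamma> / m)) * X"
        using NX by (simp add: distrib_right mult.assoc)
      then have "c * (real N ^ card I + real k) \<le> c * ((C\<^sub>1 ^ card I + L * (1 + \<gamma> / m)) * X)"
        using c1 by (intro mult_left_mono) auto
      also have "\<dots> \<le> C * X" using mult_right_mono[OF CP X0] by (simp only: mult.assoc)
      finally show ?thesis using net(4) by linarith
    qed
    \<comment> \<open>\<open>N ^ card I\<close> needs the exponent \<open>m / \<gamma>\<close>,
      while \<open>1 / \<delta>\<close>, of order \<open>N * \<epsilon> powr - t\<close>, needs
      \<open>1 / \<gamma> + t\<close>. After multiplication by \<open>\<gamma>\<close> both are at
      most \<open>(7 * m + \<gamma> + 2) * t\<close>.\<close>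
    have bnd: "c * real N ^ card I + 1 / \<delta> \<le> C * \<epsilon> powr (- (7 * m + \<gamma> + 2) * t / \<gamma>)"
    proof -
      let ?Y = "\<epsilon> powr (- (7 * m + \<gamma> + 2) * t / \<gamma>)"
      have mt: "m \<le> m * t" using mult_left_mono[OF t, of m] m1 by simp
      have mono: "\<epsilon> powr - b \<le> ?Y" if "b * \<gamma> \<le> (7 * m + \<gamma> + 2) * t" for b
      proof -
        have "b \<le> (7 * m + \<gamma> + 2) * t / \<gamma>" using that g0 by (simp add: le_divide_eq)
        then have "\<epsilon> powr - b \<le> \<epsilon> powr - ((7 * m + \<gamma> + 2) * t / \<gamma>)" using e0 e1 by (intro powr_mono') auto
        then show ?thesis by (simp only: minus_divide_left mult_minus_left)
      qed
      have ex: "(7 * m + \<gamma> + 2) * t = 7 * (m * t) + \<gamma> * t + 2 * t" by (simp add: algebra_simps)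
      have gt: "0 < \<gamma> * t" using g0 t by simp
      have "X \<le> ?Y" using mono[of "m / \<gamma>"] g0 mt m1 gt t unfolding ex X_def by simp
      then have 1: "c * real N ^ card I \<le> c * C\<^sub>1 ^ card I * ?Y"
        using cNX c1 C1 mult_left_mono[of X ?Y "c * C\<^sub>1 ^ card I"] parts(2) by linarith
      have "1 / \<delta> = 2 * (m * real N) * K powr t * (1 / \<epsilon> powr t)"
        by (simp add: \<delta>_def)
      also have "\<dots> = 2 * m * K powr t * real N * \<epsilon> powr - t"
        unfolding powr_minus_divide by (simp only: mult_ac)
      also have "\<dots> \<le> 2 * m * K powr t * (C\<^sub>1 * \<epsilon> powr (- 1 / \<gamma>)) * \<epsilon> powr - t"
        using Nle m1 by (intro mult_right_mono mult_left_mono) auto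
      also have "\<dots> = 2 * m * K powr t * C\<^sub>1 * \<epsilon> powr - (1 / \<gamma> + t)"
      proof -
        have "\<epsilon> powr (- 1 / \<gamma>) * \<epsilon> powr - t = \<epsilon> powr (- 1 / \<gamma> + - t)" by (rule powr_add[symmetric])
        also have "- 1 / \<gamma> + - t = - (1 / \<gamma> + t)" by simp
        finally show ?thesis by (simp only: mult.assoc)
      qed
      also have "\<dots> \<le> 2 * m * K powr t * C\<^sub>1 * ?Y"
      proof (intro mult_left_mono parts mono)
        have "(1 / \<gamma> + t) * \<gamma> = 1 + \<gamma> * t" using g0 by (simp add: distrib_right)
        then show "(1 / \<gamma> + t) * \<gamma> \<le> (7 * m + \<gamma> + 2) * t" unfolding ex using mt m1 t by linarith
      qed
      finally have "c * real N ^ card I + 1 / \<delta> \<le> (c * C\<^sub>1 ^ card I + 2 * m * K powr t * C\<^sub>1) * ?Y"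
        using 1 by (simp add: distrib_right)
      also have "\<dots> \<le> C * ?Y" using CB by (intro mult_right_mono) auto
      finally show ?thesis .
    qed
    have norm: "Lt_norm I t (\<lambda>x. T x - g p q x) \<le> ereal \<epsilon>"
      if p: "p < d" and q: "q < n" and T: "\<forall>x\<in>unit_cube I. \<exists>X. (\<forall>i\<in>I. X (pos i) = x i) \<and> X posq = real q \<and>
        T x = fnn_eval a d W net X p" for p q T
    proof (rule Lt_norm_le[OF finI _ d0])
      have T: "T x = out N \<delta> k p (x, q)" if "x \<in> unit_cube I" for x
      proof -
        from bspec[OF T that] obtain X
          where "\<forall>i\<in>I. X (pos i) = x i" "X posq = real q" "T x = fnn_eval a d W net X p"
          by (elim exE conjE)
        then show ?thesis using net(6) p q that by simp
      qed
      show "\<bar>T x - g p q x\<bar> \<le> K" if x: "x \<in> unit_cube I" for x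
      proof -
        have "\<bar>g p q x\<bar> \<le> Bf"
          using hd[OF p q] hB[OF p q, of "\<lambda>_. 0" x] x by (simp add: holder_derivs_def multi_index_def mi_order_def)
        then show ?thesis using out_bound[OF N1, of \<delta> k p "(x, q)"] unfolding T[OF x] K_def
          by (simp add: distrib_right)
      qed
      show "\<bar>T x - g p q x\<bar> \<le> \<epsilon> / 2" if x: "x \<in> unit_cube I" "off_grid I N \<delta> x" for x
      proof -
        have "\<bar>T x - g p q x\<bar> \<le> E1 * real N powr - \<gamma> + E2 * (1/4) ^ k"
          using out_error[OF N1 d0 p q x, of k] unfolding T[OF x(1)] E1_def E2_def \<gamma>_def .
        moreover have "E1 * real N powr - \<gamma> \<le> \<epsilon> / 4"
        proof -
          have "real N powr - \<gamma> \<le> u powr - \<gamma>"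
            using Nu(1) u1 g0 by (intro powr_mono2') auto
          also have "u powr - \<gamma> = \<epsilon> / c\<^sub>1"
            using cc e0 g0 by (simp add: u_def powr_powr powr_minus_divide)
          finally have "E1 * real N powr - \<gamma> \<le> E1 * (\<epsilon> / c\<^sub>1)" using E by (intro mult_left_mono)
          also have "\<dots> \<le> \<epsilon> / 4" using cc(1) E(1) e0 by (simp add: c\<^sub>1_def field_simps)
          finally show ?thesis .
        qed
        moreover have "E2 * (1/4) ^ k \<le> \<epsilon> / 4"
        proof -
          \<comment> \<open>The error decays like \<open>4 ^ k\<close> and 4 exceeds
            \<open>exp 1\<close>, so the natural logarithm of \<open>c\<^sub>2 / \<epsilon>\<close>
            suffices for \<open>k\<close>.\<close>
          have "c\<^sub>2 / \<epsilon> = exp v" using cc e0 by (simp add: v_def)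
          also have "\<dots> \<le> exp (real k)" using kv by simp
          also have "\<dots> = exp 1 ^ k" by (simp add: exp_of_nat_mult[symmetric])
          also have "\<dots> \<le> 4 ^ k" using exp_le by (intro power_mono) auto
          finally have "c\<^sub>2 / \<epsilon> \<le> 4 ^ k" .
          then have "(1/4) ^ k \<le> \<epsilon> / c\<^sub>2" using cc e0 by (simp add: power_one_over field_simps)
          then have "E2 * (1/4) ^ k \<le> E2 * (\<epsilon> / c\<^sub>2)" using E by (intro mult_left_mono)
          also have "\<dots> \<le> \<epsilon> / 4" using cc(2) E(2) e0 by (simp add: c\<^sub>2_def field_simps)
          finally show ?thesis .
        qed
        ultimately show ?thesis by linarith
      qed
      \<comment> \<open>Since \<open>t\<close> is at least 1, the error
        \<open>\<epsilon> / 2\<close> off the slabs uses up at most half of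
        \<open>\<epsilon> powr t\<close>.\<close>
      have "(\<epsilon> / 2) powr t = \<epsilon> powr t * (1/2) powr t" using e0 by (simp add: powr_divide)
      also have "\<dots> \<le> \<epsilon> powr t * (1/2)"
        using powr_mono'[of 1 t "1/2"] t by (intro mult_left_mono) auto
      finally have "(\<epsilon> / 2) powr t \<le> \<epsilon> powr t / 2" by simp
      moreover have "real (card I * N) * \<delta> * K powr t = \<epsilon> powr t / 2"
        using m1 N1 Kt by (simp add: \<delta>_def m_def field_simps)
      ultimately show "(\<epsilon> / 2) powr t + real (card I * N) * \<delta> * K powr t \<le> \<epsilon> powr t" by linarith
    qed (use t e0 K1 in auto)
    have sp: "sparse_fnn (C * \<epsilon> powr (- (7 * m + \<gamma> + 2) * t / \<gamma>)) P net"
      using net(5) bnd unfolding sparse_fnn_def bounded_layer_def by (meson order_trans)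
    show "\<exists>W P net. 1 \<le> length net \<and>
     real (length net) \<le> C * (1 + ln (1 / \<epsilon>)) \<and> real W \<le> C * \<epsilon> powr (- m / \<gamma>) \<and>
     real P \<le> C * \<epsilon> powr (- m / \<gamma>) \<and>
     sparse_fnn (C * \<epsilon> powr (- (7 * m + \<gamma> + 2) * t / \<gamma>)) P net \<and>
     (\<forall>p<d. \<forall>q<n. \<forall>T. (\<forall>x\<in>unit_cube I. \<exists>X. (\<forall>i\<in>I. X (pos i) = x i) \<and> X posq = real q \<and>
        T x = fnn_eval a d W net X p) \<longrightarrow> Lt_norm I t (\<lambda>x. T x - g p q x) \<le> ereal \<epsilon>)"
      using net(1) len wid[unfolded X_def] par[unfolded X_def] sp norm
      by (intro exI[of _ W] exI[of _ P] exI[of _ net] conjI allI impI)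
  qed
qed

end

section \<open>Assembling the transformer\<close>

lemma sparse_fnn_mono: "sparse_fnn B P net \<Longrightarrow> B \<le> B' \<Longrightarrow> P \<le> P' \<Longrightarrow> sparse_fnn B' P' net"
  unfolding sparse_fnn_def bounded_layer_def by (meson order_trans)

text \<open>Copying layers bring a shallow construction to a prescribed depth.\<close>

lemma relu_comp_id:
  assumes "relu_comp W B D inp A S L P F" "finite S" "card S \<le> W" "1 \<le> B"
    and "\<And>x v. x \<in> D \<Longrightarrow> v \<in> S \<Longrightarrow> 0 \<le> F x v"
  shows "relu_comp W B D inp A S (Suc L) (P + card S * (card S + 1)) F"
proof (rule relu_comp.layer[OF assms(1), where M = "\<lambda>v a. if v = a then 1 else 0" and b = "\<lambda>_. 0"])
  fix x v assume x: "x \<in> D" and v: "v \<in> S"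
  have "(\<Sum>a\<in>S. (if v = a then 1 else 0) * F x a) = (\<Sum>a\<in>S. if v = a then F x a else 0)"
    by (intro sum.cong) auto
  also have "\<dots> = F x v" using assms(2) v by simp
  finally show "F x v = max 0 ((\<Sum>a\<in>S. (if v = a then 1 else 0) * F x a) + 0)"
    using assms(5)[OF x v] by simp
qed (use assms in auto)

text \<open>Two copying layers and an output layer give the prescribed depth 3. ReLU copies are
  faithful on nonnegative columns, the only ones that will occur.\<close>

lemma identity_net:
  assumes "D \<le> W"
  shows "\<exists>P net. length net = 3 \<and> sparse_fnn 1 P net \<and>
    (\<forall>X. (\<forall>i<D. 0 \<le> X i) \<longrightarrow> (\<forall>i<D. fnn_eval D D W net X i = X i))"
proof -
  let ?Z = "{X :: nat \<Rightarrow> real. \<forall>i<D. 0 \<le> X i}"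
  have "relu_comp W 1 ?Z (\<lambda>X. X) {..<D} {..<D} 0 0 (\<lambda>X. X)" by (rule relu_comp.init)
  then have "relu_comp W 1 ?Z (\<lambda>X. X) {..<D} {..<D} (Suc 0) (0 + card {..<D} * (card {..<D} + 1)) (\<lambda>X. X)"
    by (rule relu_comp_id) (use assms in auto)
  then have rc: "relu_comp W 1 ?Z (\<lambda>X. X) {..<D} {..<D} (Suc (Suc 0))
      (0 + card {..<D} * (card {..<D} + 1) + card {..<D} * (card {..<D} + 1)) (\<lambda>X. X)"
    by (rule relu_comp_id) (use assms in auto)
  have "\<exists>net. length net = Suc (Suc (Suc 0)) \<and> sparse_fnn 1
      (0 + card {..<D} * (card {..<D} + 1) + card {..<D} * (card {..<D} + 1) + D * (card {..<D} + 1)) net \<and>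
     (\<forall>x\<in>?Z. \<forall>X. (\<forall>v\<in>{..<D}. X v = x v) \<longrightarrow>
      (\<forall>i<D. fnn_eval D D W net X i = (\<Sum>v<D. (if i = v then 1 else 0) * x v) + 0))"
    by (rule relu_comp_fnn[OF rc finite_lessThan inj_on_id2]) auto
  then obtain net P where "length net = Suc (Suc (Suc 0))" "sparse_fnn 1 P net"
    and ev: "\<forall>x\<in>?Z. \<forall>X. (\<forall>v\<in>{..<D}. X v = x v) \<longrightarrow>
      (\<forall>i<D. fnn_eval D D W net X i = (\<Sum>v<D. (if i = v then 1 else 0) * x v) + 0)"
    by (elim exE conjE)
  moreover have "fnn_eval D D W net X i = X i" if "\<forall>i<D. 0 \<le> X i" "i < D" for X i
  proof -
    have "fnn_eval D D W net X i = (\<Sum>v<D. (if i = v then 1 else 0) * X v)" using ev that by simp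
    also have "\<dots> = (\<Sum>v<D. if i = v then X v else 0)" by (intro sum.cong) auto
    finally show ?thesis using that(2) by simp
  qed
  ultimately show ?thesis by (intro exI[of _ P] exI[of _ net]) (simp add: eval_nat_numeral)
qed

lemma sum_lessThan_add: "(\<Sum>a<m + (n::nat). h a) = (\<Sum>a<m. h a) + (\<Sum>j<n. (h (m + j) :: real))"
  by (induction n) (simp_all add: add.assoc)

text \<open>Different columns occupy disjoint rows, so summing over all columns collects the whole matrix.\<close>

definition slots :: "nat \<Rightarrow> nat \<Rightarrow> vec \<Rightarrow> nat \<Rightarrow> nat \<Rightarrow> real" where
  "slots d n x q i = (if i < d * n then if i mod n = q then x (i div n) else 0
     else if i = 2 * d * n then real q else 0)"

text \<open>For \<open>x\<close> in the unit interval and a bit \<open>b\<close>,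
  \<open>max 0 (x + b - 1)\<close> is \<open>x\<close> or 0 according to \<open>b\<close>, so one
  neuron per slot selects by position; the column number is a linear form in the one-hot vector. Two
  further layers only copy. Rows \<open>d * n\<close> up to \<open>2 * d * n - 1\<close> stay 0 and
  are left for the attention layer.\<close>

lemma slot_net:
  assumes d1: "1 \<le> d" and n1: "1 \<le> n"
  shows "\<exists>W P B net. length net = 4 \<and> 0 \<le> B \<and> sparse_fnn B P net \<and>
    (\<forall>x q X. q < n \<longrightarrow> (\<forall>p<d. 0 \<le> x p \<and> x p \<le> 1) \<longrightarrow> (\<forall>p<d. X p = x p) \<longrightarrow>
       (\<forall>j<n. X (d + j) = (if j = q then 1 else 0)) \<longrightarrow>
       (\<forall>i<D. fnn_eval (d + n + 1) D W net X i = slots d n x q i))"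
proof -
  define S where "S = {..<d * n + 1}"
  define W where "W = d * n + 1"
  define B where "B = real n + 1"
  define Z where "Z = {z :: (nat \<Rightarrow> real) \<times> nat. snd z < n \<and> (\<forall>p<d. 0 \<le> fst z p \<and> fst z p \<le> 1)}"
  define inp where "inp z v = (if v < d then fst z v else if v = d + snd z then 1 else 0)"
    for z :: "(nat \<Rightarrow> real) \<times> nat" and v
  define F where "F z v = (if v < d * n then if v mod n = snd z then fst z (v div n) else 0 else real (snd z))"
    for z :: "(nat \<Rightarrow> real) \<times> nat" and v
  define M where "M v a = (if v < d * n then if a = v div n \<or> a = d + v mod n then 1 else 0
     else if d \<le> a then real (a - d) else 0)" for v a
  define b where "b v = (if v < d * n then - 1 else 0 :: real)" for v
  have div: "v div n < d" if "v < d * n" for v using that n1 by (simp add: less_mult_imp_div_less)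
  have "relu_comp W B Z inp {..<d + n} S (Suc 0) (0 + card S * (card {..<d + n} + 1)) F"
  proof (rule relu_comp.layer[OF relu_comp.init, where M = M and b = b])
    show "\<bar>M v a\<bar> \<le> B" if "a \<in> {..<d + n}" for v a using that by (auto simp: M_def B_def)
    show "\<bar>b v\<bar> \<le> B" for v by (auto simp: b_def B_def)
    show "F z v = max 0 ((\<Sum>a<d + n. M v a * inp z a) + b v)" if z: "z \<in> Z" and v: "v \<in> S" for z v
    proof -
      have q: "snd z < n" using z by (simp add: Z_def)
      show ?thesis
      proof (cases "v < d * n")
        case True
        have x: "0 \<le> fst z (v div n)" "fst z (v div n) \<le> 1" using z div[OF True] by (auto simp: Z_def)
        have "(\<Sum>a<d. M v a * inp z a) = (\<Sum>a<d. if a = v div n then fst z a else 0)"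
          using True by (intro sum.cong) (auto simp: M_def inp_def)
        moreover have "(\<Sum>j<n. M v (d + j) * inp z (d + j)) = (\<Sum>j<n. if j = snd z then if j = v mod n then 1 else 0 else 0)"
          using True div[OF True] by (intro sum.cong) (auto simp: M_def inp_def)
        ultimately have "(\<Sum>a<d + n. M v a * inp z a) = fst z (v div n) + (if v mod n = snd z then 1 else 0)"
          unfolding sum_lessThan_add using div[OF True] q by simp
        then show ?thesis using True x by (simp add: F_def b_def)
      next
        case False
        have "(\<Sum>a<d. M v a * inp z a) = 0" using False by (simp add: M_def)
        moreover have "(\<Sum>j<n. M v (d + j) * inp z (d + j)) = (\<Sum>j<n. if j = snd z then real j else 0)"
          using False by (intro sum.cong) (auto simp: M_def inp_def)
        ultimately have "(\<Sum>a<d + n. M v a * inp z a) = real (snd z)"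
          unfolding sum_lessThan_add using q by simp
        then show ?thesis using False by (simp add: F_def b_def)
      qed
    qed
  qed (auto simp: S_def W_def)
  moreover have nn: "0 \<le> F z v" if "z \<in> Z" "v \<in> S" for z v
    using that div[of v] by (auto simp: F_def Z_def)
  ultimately have "relu_comp W B Z inp {..<d + n} S (Suc (Suc 0))
      (0 + card S * (card {..<d + n} + 1) + card S * (card S + 1)) F"
    by (intro relu_comp_id) (auto simp: S_def W_def B_def)
  then have rc: "relu_comp W B Z inp {..<d + n} S (Suc (Suc (Suc 0)))
      (0 + card S * (card {..<d + n} + 1) + card S * (card S + 1) + card S * (card S + 1)) F"
    by (rule relu_comp_id) (use nn in \<open>auto simp: S_def W_def B_def\<close>)
  define O' where "O' i v = (if i < d * n \<and> v = i \<or> i = 2 * d * n \<and> v = d * n then 1 else 0 :: real)" for i v :: nat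
  have "\<exists>net. length net = Suc (Suc (Suc (Suc 0))) \<and> sparse_fnn B
      (0 + card S * (card {..<d + n} + 1) + card S * (card S + 1) + card S * (card S + 1) + D * (card S + 1)) net \<and>
     (\<forall>z\<in>Z. \<forall>X. (\<forall>v\<in>{..<d + n}. X v = inp z v) \<longrightarrow>
      (\<forall>i<D. fnn_eval (d + n + 1) D W net X i = (\<Sum>v\<in>S. O' i v * F z v) + 0))"
    by (rule relu_comp_fnn[OF rc finite_lessThan inj_on_id2]) (auto simp: B_def O'_def)
  then obtain net P where net: "length net = Suc (Suc (Suc (Suc 0)))" "sparse_fnn B P net"
    and ev: "\<forall>z\<in>Z. \<forall>X. (\<forall>v\<in>{..<d + n}. X v = inp z v) \<longrightarrow>
      (\<forall>i<D. fnn_eval (d + n + 1) D W net X i = (\<Sum>v\<in>S. O' i v * F z v) + 0)"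
    by (elim exE conjE)
  have "fnn_eval (d + n + 1) D W net X i = slots d n x q i"
    if q: "q < n" and x: "\<forall>p<d. 0 \<le> x p \<and> x p \<le> 1" and X: "\<forall>p<d. X p = x p"
      "\<forall>j<n. X (d + j) = (if j = q then 1 else 0)" and i: "i < D" for x q X i
  proof -
    have "(x, q) \<in> Z" using q x by (simp add: Z_def)
    moreover have "X v = inp (x, q) v" if "v < d + n" for v
      using X(1) X(2)[rule_format, of "v - d"] that by (auto simp: inp_def)
    ultimately have "fnn_eval (d + n + 1) D W net X i = (\<Sum>v\<in>S. O' i v * F (x, q) v)"
      using ev i by simp
    also have "\<dots> = slots d n x q i"
    proof -
      consider (a) "i < d * n" | (b) "i = 2 * d * n" "\<not> i < d * n" | (c) "\<not> i < d * n" "i \<noteq> 2 * d * n" by blast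
      then show ?thesis
      proof cases
        case a
        then have "i \<noteq> 2 * d * n" using d1 n1 by simp
        then have "(\<Sum>v\<in>S. O' i v * F (x, q) v) = (\<Sum>v\<in>S. if v = i then F (x, q) v else 0)"
          using a by (intro sum.cong) (auto simp: O'_def)
        then show ?thesis using a by (simp add: S_def slots_def F_def)
      next
        case b
        then have "(\<Sum>v\<in>S. O' i v * F (x, q) v) = (\<Sum>v\<in>S. if v = d * n then F (x, q) v else 0)"
          by (intro sum.cong) (auto simp: O'_def)
        then show ?thesis using b by (simp add: S_def slots_def F_def)
      next
        case c
        then show ?thesis by (simp add: slots_def O'_def)
      qed
    qed
    finally show ?thesis .
  qed
  moreover have "length net = 4" "0 \<le> B" using net by (simp_all add: B_def)
  ultimately show ?thesis using net(2) by blast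
qed

section \<open>Attention layers and the forward pass\<close>

definition zero_head :: head where "zero_head = (\<lambda>_ _. 0, \<lambda>_ _. 0, \<lambda>_ _. 0, \<lambda>_ _. 0)"

text \<open>Vanishing keys and queries make the softmax uniform, so this head adds the row sums of the
  first \<open>m\<close> rows to the next \<open>m\<close> rows.\<close>

definition sum_head :: "nat \<Rightarrow> nat \<Rightarrow> head" where
  "sum_head n m = (\<lambda>r s. if s < m \<and> r = m + s then 1 else 0, \<lambda>s r. if s = r \<and> r < m then real n else 0,
     \<lambda>_ _. 0, \<lambda>_ _. 0)"

text \<open>The prescribed head numbers are reached by padding with zero heads; the residual
  connection turns a layer of such heads into the identity.\<close>

lemma sa_layer_zero: "sa_layer n D S (replicate H zero_head) X = mtrunc D n X"
  by (intro ext) (simp add: sa_layer_def zero_head_def mtrunc_def mmul_def)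

text \<open>The factor \<open>n\<close> in the value matrix cancels the \<open>1 / n\<close> of the
  uniform softmax, and the residual connection preserves the first \<open>m\<close> rows. The head
  needs \<open>m\<close> inner dimensions, which is what the head size \<open>max (d * n) 3\<close>
  provides.\<close>

lemma sa_layer_sum:
  assumes "m \<le> S" "m \<le> D" "1 \<le> n"
  shows "sa_layer n D S (sum_head n m # replicate H zero_head) X =
    mtrunc D n (\<lambda>i j. X i j + (if m \<le> i \<and> i < 2 * m then \<Sum>l<n. X (i - m) l else 0))"
proof -
  let ?hs = "sum_head n m # replicate H zero_head"
  obtain WO WV where h: "sum_head n m = (WO, WV, \<lambda>_ _. 0, \<lambda>_ _. 0)"
    and W: "WO = (\<lambda>r s. if s < m \<and> r = m + s then 1 else 0)" "WV = (\<lambda>s r. if s = r \<and> r < m then real n else 0)"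
    by (simp add: sum_head_def)
  have soft: "col_softmax n (mmul D (mtrans X) (mmul S (mtrans (\<lambda>_ _. 0)) Y)) = (\<lambda>_ _. 1 / real n)" for Y
    by (intro ext) (simp add: col_softmax_def mmul_def mtrans_def)
  have val: "mmul S WO (mmul D WV X) i l = (if m \<le> i \<and> i < 2 * m then real n * X (i - m) l else 0)" for i l
  proof -
    have V: "mmul D WV X s l = real n * X s l" if "s < m" for s
    proof -
      have "mmul D WV X s l = (\<Sum>r<D. if r = s then real n * X r l else 0)"
        unfolding mmul_def W using that by (intro sum.cong) auto
      then show ?thesis using that assms(2) by simp
    qed
    have "mmul S WO (mmul D WV X) i l = (\<Sum>s<S. if s = i - m \<and> m \<le> i \<and> i < 2 * m then real n * X s l else 0)"
      unfolding mmul_def[of S] W(1) using V by (intro sum.cong) auto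
    also have "\<dots> = (if m \<le> i \<and> i < 2 * m then real n * X (i - m) l else 0)"
      using assms(1) by (cases "m \<le> i \<and> i < 2 * m") auto
    finally show ?thesis .
  qed
  have "(\<Sum>h<length ?hs. case ?hs ! h of (WO, WV, WK, WQ) \<Rightarrow>
        mmul n (mmul S WO (mmul D WV X))
          (col_softmax n (mmul D (mtrans X) (mmul S (mtrans WK) (mmul D WQ X)))) i j) =
      (if m \<le> i \<and> i < 2 * m then \<Sum>l<n. X (i - m) l else 0)" for i j
  proof -
    have "(\<Sum>h<length ?hs. case ?hs ! h of (WO, WV, WK, WQ) \<Rightarrow>
        mmul n (mmul S WO (mmul D WV X))
          (col_softmax n (mmul D (mtrans X) (mmul S (mtrans WK) (mmul D WQ X)))) i j) =
        mmul n (mmul S WO (mmul D WV X)) (\<lambda>_ _. 1 / real n) i j"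
      unfolding length_Cons sum.lessThan_Suc_shift nth_Cons_0 h prod.case soft
      by (simp add: zero_head_def mmul_def)
    also have "\<dots> = (\<Sum>l<n. (if m \<le> i \<and> i < 2 * m then real n * X (i - m) l else 0) * (1 / real n))"
      unfolding mmul_def[of n] val ..
    also have "\<dots> = (if m \<le> i \<and> i < 2 * m then \<Sum>l<n. X (i - m) l else 0)"
      using assms(3) by (cases "m \<le> i \<and> i < 2 * m") auto
    finally show ?thesis .
  qed
  then show ?thesis unfolding sa_layer_def by simp
qed

text \<open>After the first attention layer the state \<open>Z\<close> is fixed by each middle block
  followed by the next attention layer; the index shifts because block \<open>k\<close> precedes
  layer \<open>k + 1\<close>.\<close>

lemma foldl_layers:
  assumes "sa 1 Y0 = Z" "\<And>k. 1 \<le> k \<Longrightarrow> k < n \<Longrightarrow> sa (Suc k) (ff k Z) = Z" "1 \<le> n"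
  shows "foldl (\<lambda>Y k. ff k (sa k Y)) Y0 [1..<n + 1] = ff n Z"
proof -
  have "foldl (\<lambda>Y k. ff k (sa k Y)) Y0 [1..<k + 1] = ff k Z" if "1 \<le> k" "k \<le> n" for k
    using that
  proof (induction k)
    case (Suc k)
    show ?case
    proof (cases "k = 0")
      case False
      then show ?thesis using Suc assms(2)[of k] by simp
    qed (use assms(1) in simp)
  qed simp
  then show ?thesis using assms(3) by simp
qed

text \<open>The embedding copies the data into the first \<open>d\<close> rows, and its bias places
  an identity matrix below them: column \<open>j\<close> receives the \<open>j\<close>-th unit
  vector as its position.\<close>

definition transformer_of :: "nat \<Rightarrow> nat \<Rightarrow> nat \<Rightarrow> nat \<Rightarrow> fnn \<Rightarrow> fnn \<Rightarrow> fnn \<Rightarrow> transformer" where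
  "transformer_of d n H1 H2 net0 net1 net2 = Transformer
     (\<lambda>r c. if r = c \<and> r < d then 1 else 0) (\<lambda>r c. if r = d + c \<and> c < n then 1 else 0)
     (net0 # replicate (n - 1) net1 @ [net2])
     ((sum_head n (d * n) # replicate (H1 - 1) zero_head) # replicate (n - 1) (replicate H2 zero_head))"

text \<open>After attention, column \<open>q\<close> contains its own slots in the first
  \<open>d * n\<close> rows, the whole matrix in the next \<open>d * n\<close>, and its number in
  row \<open>2 * d * n\<close>. The last block sees exactly this column.\<close>

lemma transformer_value:
  fixes d n D S1 H1 H2 W0 W1 L2 W2 q :: nat
  assumes dn: "1 \<le> d" "1 \<le> n" and D: "2 * d * n + 1 \<le> D" and S1: "d * n \<le> S1"
    and net0: "\<And>x q X i. q < n \<Longrightarrow> \<forall>p<d. 0 \<le> x p \<and> x p \<le> 1 \<Longrightarrow> \<forall>p<d. X p = x p \<Longrightarrow>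
       \<forall>j<n. X (d + j) = (if j = q then 1 else 0) \<Longrightarrow> i < D \<Longrightarrow>
       fnn_eval (d + n + 1) D W0 net0 X i = slots d n x q i"
    and net1: "\<And>X i. \<forall>i<D. 0 \<le> X i \<Longrightarrow> i < D \<Longrightarrow> fnn_eval D D W1 net1 X i = X i"
    and x: "x \<in> unit_cube (mat_idx d n)" and q: "q < n"
  defines "dv \<equiv> [d, d + n + 1] @ replicate n D @ [d]"
    and "LW \<equiv> (4, W0) # replicate (n - 1) (3, W1) @ [(L2, W2)]"
    and "HS \<equiv> (H1, S1) # replicate (n - 1) (H2, 3)"
  shows "\<exists>X. (\<forall>(p, j)\<in>mat_idx d n. X (d * n + p * n + j) = x (p, j)) \<and> X (2 * d * n) = real q \<and>
     (\<forall>p<d. tf_eval n dv LW HS (transformer_of d n H1 H2 net0 net1 net2) (curry x) p q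
        = fnn_eval D d W2 net2 X p)"
proof -
  let ?T = "transformer_of d n H1 H2 net0 net1 net2"
  define col where "col j p = x (p, j)" for j p
  have colb: "\<forall>p<d. 0 \<le> col j p \<and> col j p \<le> 1" if "j < n" for j
    using x that by (auto simp: unit_cube_def mat_idx_def col_def)
  define Y0 where "Y0 = mtrunc D n (\<lambda>i j. slots d n (col j) j i)"
  define Z where "Z = mtrunc D n (\<lambda>i j. slots d n (col j) j i +
     (if d * n \<le> i \<and> i < 2 * d * n then col ((i - d * n) mod n) ((i - d * n) div n) else 0))"
  have div: "v div n < d" "v mod n < n" if "v < d * n" for v
    using that dn by (simp_all add: less_mult_imp_div_less)
  \<comment> \<open>Nonnegativity is what lets the middle blocks pass \<open>Z\<close> on
    unchanged.\<close>
  have Z0: "0 \<le> Z i j" for i j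
  proof -
    have "0 \<le> slots d n (col j) j i" if "j < n"
      using colb[OF that] div(1)[of i] by (auto simp: slots_def)
    moreover have "0 \<le> col ((i - d * n) mod n) ((i - d * n) div n)" if "d * n \<le> i" "i < 2 * d * n"
    proof -
      have "i - d * n < d * n" using that by simp
      from div[OF this] colb show ?thesis by blast
    qed
    ultimately show ?thesis by (auto simp: Z_def mtrunc_def)
  qed
  define K where "K = length HS"
  have K: "K = n" using dn by (simp add: K_def HS_def)
  define dd where "dd k = dv ! (k + 1)" for k
  have dd: "dd 0 = d + n + 1" "\<And>k. 1 \<le> k \<Longrightarrow> k \<le> n \<Longrightarrow> dd k = D" "dd (n + 1) = d"
    by (auto simp: dd_def dv_def nth_append nth_Cons split: nat.splits)
  have LW: "snd (LW ! 0) = W0" "\<And>k. 1 \<le> k \<Longrightarrow> k < n \<Longrightarrow> snd (LW ! k) = W1" "snd (LW ! n) = W2"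
    using dn by (auto simp: LW_def nth_append nth_Cons split: nat.splits)
  have FF: "tf_FF ?T ! 0 = net0" "\<And>k. 1 \<le> k \<Longrightarrow> k < n \<Longrightarrow> tf_FF ?T ! k = net1" "tf_FF ?T ! n = net2"
    using dn by (auto simp: transformer_of_def nth_append nth_Cons split: nat.splits)
  have HS: "snd (HS ! 0) = S1" by (simp add: HS_def)
  have SA: "tf_SA ?T ! 0 = sum_head n (d * n) # replicate (H1 - 1) zero_head"
    "\<And>k. 1 \<le> k \<Longrightarrow> k < n \<Longrightarrow> tf_SA ?T ! k = replicate H2 zero_head"
    by (auto simp: transformer_of_def nth_Cons split: nat.splits)
  define sa where "sa k Y = sa_layer n (dd k) (snd (HS ! (k - 1))) (tf_SA ?T ! (k - 1)) Y" for k Y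
  define ff where "ff k Y = ff_block n (dd k) (dd (k + 1)) (snd (LW ! k)) (tf_FF ?T ! k) Y" for k Y
  define E where "E = emb (dv ! 0) (dd 0) n (tf_WEB ?T) (tf_BEB ?T) (curry x)"
  have Ex: "E p j = col j p" if "p < d" "j < n" for p j
  proof -
    have "(\<Sum>k<d. (if p = k \<and> p < d then 1 else 0) * x (k, j)) = (\<Sum>k<d. if p = k then x (k, j) else 0)"
      using that by (intro sum.cong) auto
    then show ?thesis using that dd(1) by (simp add: E_def emb_def mtrunc_def transformer_of_def dv_def col_def)
  qed
  have Ee: "E (d + j') j = (if j' = j then 1 else 0)" if "j' < n" "j < n" for j' j
    using that dd(1) by (simp add: E_def emb_def mtrunc_def transformer_of_def dv_def)
  have X0: "ff_block n (dd 0) (dd 1) (snd (LW ! 0)) (tf_FF ?T ! 0) E = Y0"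
  proof (intro ext)
    fix i j
    have "fnn_eval (d + n + 1) D W0 net0 (\<lambda>k. E k j) i = slots d n (col j) j i" if "i < D" "j < n"
      by (rule net0) (use that Ex Ee colb in auto)
    then show "ff_block n (dd 0) (dd 1) (snd (LW ! 0)) (tf_FF ?T ! 0) E i j = Y0 i j"
      using dd(1) dd(2)[of 1] dn LW(1) FF(1) by (simp add: ff_block_def Y0_def mtrunc_def)
  qed
  have ev: "tf_eval n dv LW HS ?T (curry x) = foldl (\<lambda>Y k. ff k (sa k Y)) Y0 [1..<n + 1]"
    unfolding tf_eval_def Let_def K_def[symmetric] K dd_def[symmetric] X0[symmetric] E_def ff_def sa_def
    by (simp add: dd_def)
  also have "\<dots> = ff n Z"
  proof (rule foldl_layers[where ff = ff and sa = sa])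
    have "sa 1 Y0 = mtrunc D n (\<lambda>i j. Y0 i j +
        (if d * n \<le> i \<and> i < 2 * (d * n) then \<Sum>l<n. Y0 (i - d * n) l else 0))"
      unfolding sa_def using dd(2)[of 1] dn HS SA(1) S1 D by (simp add: sa_layer_sum)
    also have "\<dots> = Z"
    proof (intro ext)
      fix i j
      show "mtrunc D n (\<lambda>i j. Y0 i j + (if d * n \<le> i \<and> i < 2 * (d * n) then \<Sum>l<n. Y0 (i - d * n) l else 0)) i j = Z i j"
      proof (cases "i < D \<and> j < n \<and> d * n \<le> i \<and> i < 2 * d * n")
        case True
        let ?v = "i - d * n"
        have v: "?v < d * n" "?v < D" using True D by auto
        have "(\<Sum>l<n. Y0 ?v l) = (\<Sum>l<n. if ?v mod n = l then col l (?v div n) else 0)"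
          using v by (intro sum.cong) (auto simp: Y0_def mtrunc_def slots_def)
        then show ?thesis using True div(2)[OF v(1)] by (simp add: Z_def Y0_def mtrunc_def mult.assoc)
      qed (auto simp: Z_def Y0_def mtrunc_def mult.assoc)
    qed
    finally show "sa 1 Y0 = Z" .
    show "sa (Suc k) (ff k Z) = Z" if k: "1 \<le> k" "k < n" for k
    proof -
      have "ff k Z = Z"
      proof (intro ext)
        fix i j
        have "fnn_eval D D W1 net1 (\<lambda>k. Z k j) i = Z i j" if "i < D" using net1[of "\<lambda>k. Z k j" i] Z0 that by simp
        then show "ff k Z i j = Z i j"
          using k dd(2)[of k] dd(2)[of "k + 1"] LW(2)[of k] FF(2)[of k]
          by (simp add: ff_def ff_block_def mtrunc_def) (simp add: Z_def mtrunc_def)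
      qed
      moreover have "mtrunc D n Z = Z" by (intro ext) (simp add: Z_def mtrunc_def)
      ultimately show ?thesis using k dd(2)[of "k + 1"] SA(2)[of k] by (simp add: sa_def sa_layer_zero)
    qed
  qed (use dn in simp)
  finally have ev: "tf_eval n dv LW HS ?T (curry x) = ff n Z" .
  have "tf_eval n dv LW HS ?T (curry x) p q = fnn_eval D d W2 net2 (\<lambda>k. Z k q) p" if "p < d" for p
    unfolding ev ff_def ff_block_def using that q dn dd(2)[of n] dd(3) LW(3) FF(3) by (simp add: mtrunc_def)
  moreover have "Z (2 * d * n) q = real q" using D q dn by (simp add: Z_def mtrunc_def slots_def)
  moreover have "Z (d * n + p * n + j) q = x (p, j)" if "p < d" "j < n" for p j
  proof -
    have "p * n + j < p * n + n" using that by simp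
    also have "\<dots> = (p + 1) * n" by simp
    also have "\<dots> \<le> d * n" using that by (intro mult_le_mono1) simp
    finally have "p * n + j < d * n" .
    then show ?thesis using D q that by (simp add: Z_def mtrunc_def slots_def col_def)
  qed
  ultimately show ?thesis by (intro exI[of _ "\<lambda>k. Z k q"]) (auto simp: mat_idx_def)
qed

section \<open>Parameter counts and the final constants\<close>

lemma finite_sa_pos: "finite (sa_pos H S D)"
  by (rule finite_subset[of _ "{..<H} \<times> {..<4} \<times> {..<S + D} \<times> {..<S + D}"])
     (auto simp: sa_pos_def split: if_splits)

lemma finite_eb_pos: "finite (eb_pos a b n)"
  by (rule finite_subset[of _ "{..<2} \<times> {..<b} \<times> {..<a + n}"]) (auto simp: eb_pos_def)

theorem theorem1:
  fixes d n s :: nat and lam t :: real and f :: "mat \<Rightarrow> mat"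
  assumes "1 \<le> d" and "1 \<le> n" and "0 < lam" and "lam \<le> 1" and "1 \<le> t"
    and "\<forall>p<d. \<forall>q<n. holder (mat_idx d n) s lam (\<lambda>x. f (curry x) p q)"
  shows "\<exists>C>0. \<forall>\<epsilon>::real. 0 < \<epsilon> \<and> \<epsilon> < 1 \<longrightarrow>
    (let \<gamma> = real s + lam; c = (s + d * n - 1) choose (d * n - 1);
         dv = [d, d + n + 1] @ replicate n ((2 * d * n + 5 * d) * c) @ [d];
         HS = ((3 * d + 1) * c, max (d * n) 3) # replicate (n - 1) (3 * d * c, 3)
     in \<exists>T W0 Ln Wn.
       (let LW = (4, W0) # replicate (n - 1) (3, d * c * (4 * n + 11)) @ [(Ln, Wn)] in
        tf_shape dv LW HS T \<and>
        real W0 \<le> C * \<epsilon> powr (- 1 / \<gamma>) \<and>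
        real Ln \<le> C * (1 + ln (1 / \<epsilon>)) \<and>
        real Wn \<le> C * \<epsilon> powr (- real (d * n) / \<gamma>) \<and>
        (\<forall>p<d. \<forall>q<n.
           Lt_norm (mat_idx d n) t (\<lambda>x. tf_eval n dv LW HS T (curry x) p q - f (curry x) p q)
             \<le> ereal \<epsilon>) \<and>
        tf_EB_bound n dv T C \<and>
        tf_FF_bound dv LW HS T (C * \<epsilon> powr (- (7 * real (d * n) + \<gamma> + 2) * t / \<gamma>)) \<and>
        tf_SA_bound dv HS T (C * (1 + ln (1 / \<epsilon>))) \<and>
        real (tf_M_EB n dv T) \<le> C \<and>
        real (tf_M_FF dv LW HS T) \<le> C * \<epsilon> powr (- real (d * n) / \<gamma>) \<and>
        real (tf_M_SA dv HS T) \<le> C))"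
proof -
  define \<gamma> where "\<gamma> = real s + lam"
  define c where "c = (s + d * n - 1) choose (d * n - 1)"
  define D where "D = (2 * d * n + 5 * d) * c"
  define dv where "dv = [d, d + n + 1] @ replicate n D @ [d]"
  define HS where "HS = ((3 * d + 1) * c, max (d * n) 3) # replicate (n - 1) (3 * d * c, 3)"
  define W1 where "W1 = d * c * (4 * n + 11)"
  define I where "I = mat_idx d n"
  have d1: "1 \<le> d" and n1: "1 \<le> n" by fact+
  have dn1: "1 \<le> d * n" using d1 n1 by simp
  have c1: "1 \<le> c" using dn1 by (simp add: c_def Suc_le_eq zero_less_binomial)
  \<comment> \<open>The prescribed dimension leaves at least \<open>5 * d\<close> rows beyond
    \<open>2 * d * n\<close>; one of them holds the column number.\<close>
  have D1: "2 * d * n + 1 \<le> D"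
  proof -
    have "2 * d * n + 1 \<le> (2 * d * n + 5 * d) * 1" using d1 by simp
    also have "\<dots> \<le> D" unfolding D_def using c1 by (intro mult_le_mono2)
    finally show ?thesis .
  qed
  have DW1: "D \<le> W1" by (simp add: D_def W1_def algebra_simps)
  have finI: "finite I" and cardI: "card I = d * n" and neI: "I \<noteq> {}"
    using d1 n1 by (auto simp: I_def mat_idx_def lessThan_empty_iff)
  have \<gamma>0: "0 < \<gamma>" using assms(3) by (simp add: \<gamma>_def)
  define g where "g p q = (\<lambda>x. f (curry x) p q)" for p q
  have hold: "\<forall>p<d. \<forall>q<n. holder I s lam (g p q)" using assms(6) by (simp add: I_def g_def)
  obtain Dg Bf Hc where hol: "1 \<le> (Bf :: real)" "0 \<le> (Hc :: real)"
    "\<And>p q. p < d \<Longrightarrow> q < n \<Longrightarrow> holder_derivs I s (g p q) (Dg p q)"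
    "\<And>p q mu x. p < d \<Longrightarrow> q < n \<Longrightarrow> multi_index I mu \<Longrightarrow> mi_order I mu \<le> s \<Longrightarrow> x \<in> unit_cube I \<Longrightarrow>
       \<bar>Dg p q mu x\<bar> \<le> Bf"
    "\<And>p q mu x y. p < d \<Longrightarrow> q < n \<Longrightarrow> multi_index I mu \<Longrightarrow> mi_order I mu = s \<Longrightarrow> x \<in> unit_cube I \<Longrightarrow>
       y \<in> unit_cube I \<Longrightarrow> x \<noteq> y \<Longrightarrow> \<bar>Dg p q mu x - Dg p q mu y\<bar> \<le> Hc * euclid_dist I x y powr lam"
    by (rule holder_uniform[OF hold]) (rule that, assumption+)
  obtain xs where xs: "set xs = I" "distinct xs" using finite_distinct_list[OF finI] by blast
  obtain \<iota> where "bij_betw \<iota> I {0..<card I}" using ex_bij_betw_finite_nat[OF finI] by blast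
  then have \<iota>: "bij_betw \<iota> I {..<card I}" by (simp add: atLeast0LessThan)
  interpret G: holder_grid I d n s lam g Dg Bf Hc xs \<iota>
    by (rule holder_grid.intro[OF finI neI n1 assms(3) hol xs(2,1) \<iota>])
  \<comment> \<open>Row-major position inside the block that the attention layer fills.\<close>
  define pos where "pos = (\<lambda>(p, j). d * n + p * n + j)"
  have posb: "d * n \<le> pos i \<and> pos i < 2 * d * n" if "i \<in> I" for i
  proof -
    obtain p j where i: "i = (p, j)" "p < d" "j < n" using \<open>i \<in> I\<close> by (auto simp: I_def mat_idx_def)
    have "p * n + j < (p + 1) * n" using i by simp
    also have "\<dots> \<le> d * n" using i by (intro mult_le_mono1) simp
    finally show ?thesis using i by (simp add: pos_def)
  qed
  have pos: "inj_on pos I" "pos ` I \<subseteq> {..<D}" "2 * d * n < D" "2 * d * n \<notin> pos ` I"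
  proof -
    show "inj_on pos I"
    proof (rule inj_onI)
      fix i i' assume "i \<in> I" "i' \<in> I" and e: "pos i = pos i'"
      then obtain p j p' j' where i: "i = (p, j)" "i' = (p', j')" "j < n" "j' < n"
        by (auto simp: I_def mat_idx_def)
      then have e': "p * n + j = p' * n + j'" using e by (simp add: pos_def)
      have "p = p'" using arg_cong[OF e', of "\<lambda>k. k div n"] i by simp
      then show "i = i'" using e' i by simp
    qed
    show "pos ` I \<subseteq> {..<D}" "2 * d * n < D" "2 * d * n \<notin> pos ` I"
      using posb D1 by fastforce+
  qed
  let ?m = "real (card I)"
  obtain C2 where C2: "0 < C2" "\<forall>\<epsilon>. 0 < \<epsilon> \<and> \<epsilon> < 1 \<longrightarrow> (\<exists>W P net. 1 \<le> length net \<and>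
     real (length net) \<le> C2 * (1 + ln (1 / \<epsilon>)) \<and> real W \<le> C2 * \<epsilon> powr (- ?m / (real s + lam)) \<and>
     real P \<le> C2 * \<epsilon> powr (- ?m / (real s + lam)) \<and>
     sparse_fnn (C2 * \<epsilon> powr (- (7 * ?m + (real s + lam) + 2) * t / (real s + lam))) P net \<and>
     (\<forall>p<d. \<forall>q<n. \<forall>T. (\<forall>x\<in>unit_cube I. \<exists>X. (\<forall>i\<in>I. X (pos i) = x i) \<and> X (2 * d * n) = real q \<and>
        T x = fnn_eval D d W net X p) \<longrightarrow> Lt_norm I t (\<lambda>x. T x - g p q x) \<le> ereal \<epsilon>))"
    using G.column_net[OF pos assms(5)] by (elim exE conjE)
  \<comment> \<open>The blocks before the last are fixed ahead of \<open>\<epsilon>\<close>, so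
    their width, weights and parameters go into \<open>C\<close>; in particular a constant
    \<open>W0\<close> obeys its bound because \<open>\<epsilon> powr (- 1 / \<gamma>)\<close> is at
    least 1.\<close>
  obtain W0 P0 B0 net0 where net0: "length net0 = 4" "0 \<le> B0" "sparse_fnn B0 P0 net0"
    "\<forall>x q X. q < n \<longrightarrow> (\<forall>p<d. 0 \<le> x p \<and> x p \<le> 1) \<longrightarrow> (\<forall>p<d. X p = x p) \<longrightarrow>
       (\<forall>j<n. X (d + j) = (if j = q then 1 else 0)) \<longrightarrow>
       (\<forall>i<D. fnn_eval (d + n + 1) D W0 net0 X i = slots d n x q i)"
    using slot_net[OF d1 n1, of D] by (elim exE conjE)
  obtain net1 P1 where net1: "length net1 = 3" "sparse_fnn 1 P1 net1"
    "\<forall>X. (\<forall>i<D. 0 \<le> X i) \<longrightarrow> (\<forall>i<D. fnn_eval D D W1 net1 X i = X i)"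
    using identity_net[OF DW1] by (elim exE conjE)
  \<comment> \<open>For attention and embedding it is enough to count all positions, zero or not:
    the number depends on \<open>d\<close>, \<open>n\<close> and \<open>s\<close> only.\<close>
  define MSA where "MSA = (\<Sum>k<n. card (sa_pos (fst (HS ! k)) (snd (HS ! k)) (dv ! (k + 2))))"
  define MEB where "MEB = card (eb_pos d (d + n + 1) n)"
  define C where "C = C2 + real W0 + 4 + B0 + real n + real (n * (P0 + P1)) + real MSA + real MEB"
  have C: "0 < C" "C2 \<le> C" "real W0 \<le> C" "1 \<le> C" "B0 \<le> C" "real n \<le> C" "C2 + real (n * (P0 + P1)) \<le> C"
    "real MSA \<le> C" "real MEB \<le> C"
    using C2(1) net0(2) of_nat_0_le_iff[of W0, where 'a = real] of_nat_0_le_iff[of n, where 'a = real]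
      of_nat_0_le_iff[of "n * (P0 + P1)", where 'a = real] of_nat_0_le_iff[of MSA, where 'a = real]
      of_nat_0_le_iff[of MEB, where 'a = real]
    unfolding C_def by linarith+
  have main: "\<exists>T W0 Ln Wn.
       (let LW = (4, W0) # replicate (n - 1) (3, W1) @ [(Ln, Wn)] in
        tf_shape dv LW HS T \<and>
        real W0 \<le> C * \<epsilon> powr (- 1 / \<gamma>) \<and>
        real Ln \<le> C * (1 + ln (1 / \<epsilon>)) \<and>
        real Wn \<le> C * \<epsilon> powr (- real (d * n) / \<gamma>) \<and>
        (\<forall>p<d. \<forall>q<n.
           Lt_norm (mat_idx d n) t (\<lambda>x. tf_eval n dv LW HS T (curry x) p q - f (curry x) p q)
             \<le> ereal \<epsilon>) \<and>
        tf_EB_bound n dv T C \<and>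
        tf_FF_bound dv LW HS T (C * \<epsilon> powr (- (7 * real (d * n) + \<gamma> + 2) * t / \<gamma>)) \<and>
        tf_SA_bound dv HS T (C * (1 + ln (1 / \<epsilon>))) \<and>
        real (tf_M_EB n dv T) \<le> C \<and>
        real (tf_M_FF dv LW HS T) \<le> C * \<epsilon> powr (- real (d * n) / \<gamma>) \<and>
        real (tf_M_SA dv HS T) \<le> C)"
    if \<epsilon>: "0 < \<epsilon> \<and> \<epsilon> < 1" for \<epsilon> :: real
  proof -
    let ?X = "\<epsilon> powr (- real (d * n) / \<gamma>)"
    let ?Y = "\<epsilon> powr (- (7 * real (d * n) + \<gamma> + 2) * t / \<gamma>)"
    have one: "1 \<le> \<epsilon> powr b" if "b \<le> 0" for b
      using powr_mono'[OF that, of \<epsilon>] \<epsilon> by simp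
    have "0 \<le> (7 * real (d * n) + \<gamma> + 2) * t / \<gamma>"
      using \<gamma>0 assms(5) by (intro divide_nonneg_pos mult_nonneg_nonneg) auto
    then have "- (7 * real (d * n) + \<gamma> + 2) * t / \<gamma> \<le> 0"
      by (simp only: mult_minus_left minus_divide_left[symmetric] neg_le_0_iff_le)
    then have X1: "1 \<le> ?X" "1 \<le> \<epsilon> powr (- 1 / \<gamma>)" "1 \<le> ?Y"
      using \<gamma>0 by (auto intro!: one divide_nonpos_pos)
    have ln0: "0 \<le> ln (1 / \<epsilon>)" using \<epsilon> by (simp add: ln_div)
    obtain W2 P2 net2 where net2: "1 \<le> length net2" "real (length net2) \<le> C2 * (1 + ln (1 / \<epsilon>))"
      "real W2 \<le> C2 * ?X" "real P2 \<le> C2 * ?X" "sparse_fnn (C2 * ?Y) P2 net2"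
      "\<forall>p<d. \<forall>q<n. \<forall>T. (\<forall>x\<in>unit_cube I. \<exists>X. (\<forall>i\<in>I. X (pos i) = x i) \<and> X (2 * d * n) = real q \<and>
        T x = fnn_eval D d W2 net2 X p) \<longrightarrow> Lt_norm I t (\<lambda>x. T x - g p q x) \<le> ereal \<epsilon>"
      using C2(2)[THEN spec, THEN mp, OF \<epsilon>] unfolding \<gamma>_def[symmetric] cardI by (elim exE conjE)
    define LW where "LW = (4, W0) # replicate (n - 1) (3, W1) @ [(length net2, W2)]"
    define T where "T = transformer_of d n ((3 * d + 1) * c) (3 * d * c) net0 net1 net2"
    have lHS: "length HS = n" using n1 by (simp add: HS_def)
    have dv_nth: "dv ! 0 = d" "dv ! 1 = d + n + 1" by (simp_all add: dv_def)
    have FF: "length (tf_FF T ! k) = fst (LW ! k) \<and> 1 \<le> fst (LW ! k) \<and>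
        sparse_fnn (C * ?Y) (if k = n then P2 else P0 + P1) (tf_FF T ! k)" if "k \<le> n" for k
    proof -
      have "C * 1 \<le> C * ?Y" using X1(3) C(1) by (intro mult_left_mono) auto
      then have CY: "B0 \<le> C * ?Y" "1 \<le> C * ?Y" using C(4,5) by linarith+
      consider "k = 0" | "1 \<le> k" "k < n" | "k = n" "k \<noteq> 0" using \<open>k \<le> n\<close> by linarith
      then show ?thesis
      proof cases
        case 1
        then have "tf_FF T ! k = net0" "LW ! k = (4, W0)" by (simp_all add: LW_def T_def transformer_of_def)
        then show ?thesis
          using 1 net0(1) n1 sparse_fnn_mono[OF net0(3) CY(1), of "P0 + P1"] by simp
      next
        case 2
        then have "tf_FF T ! k = net1" "LW ! k = (3, W1)"
          by (auto simp: LW_def T_def transformer_of_def nth_append nth_Cons split: nat.splits)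
        then show ?thesis
          using 2 net1(1) sparse_fnn_mono[OF net1(2) CY(2), of "P0 + P1"] by simp
      next
        case 3
        then have "tf_FF T ! k = net2" "LW ! k = (length net2, W2)"
          by (auto simp: LW_def T_def transformer_of_def nth_append nth_Cons split: nat.splits)
        moreover have "sparse_fnn (C * ?Y) P2 net2"
          by (rule sparse_fnn_mono[OF net2(5) mult_right_mono[OF C(2)] order_refl]) simp
        ultimately show ?thesis using 3 net2(1) by simp
      qed
    qed
    have SA0: "tf_SA T ! 0 = sum_head n (d * n) # replicate ((3 * d + 1) * c - 1) zero_head"
      by (simp add: T_def transformer_of_def)
    have SAk: "tf_SA T ! k = replicate (3 * d * c) zero_head" if "1 \<le> k" "k < n" for k
      using that by (auto simp: T_def transformer_of_def nth_Cons split: nat.splits)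
    have HSk: "HS ! k = (3 * d * c, 3)" if "1 \<le> k" "k < n" for k
      using that by (auto simp: HS_def nth_Cons split: nat.splits)
    have H1: "1 \<le> (3 * d + 1) * c" using c1 by simp
    have shape: "tf_shape dv LW HS T"
      unfolding tf_shape_def Let_def lHS
    proof (intro conjI allI impI)
      show "length (tf_SA T ! k) = fst (HS ! k)" if "k < n" for k
        using that SA0 SAk[of k] HSk[of k] H1 by (cases "k = 0") (auto simp: HS_def)
    qed (use FF n1 in \<open>auto simp: dv_def LW_def T_def transformer_of_def\<close>)
    have W0: "real W0 \<le> C * \<epsilon> powr (- 1 / \<gamma>)"
      using C(1,3) X1(2) mult_left_mono[of 1 "\<epsilon> powr (- 1 / \<gamma>)" C] by linarith
    have Ln: "real (length net2) \<le> C * (1 + ln (1 / \<epsilon>))"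
      using net2(2) mult_right_mono[OF C(2), of "1 + ln (1 / \<epsilon>)"] ln0 by linarith
    have Wn: "real W2 \<le> C * ?X" using net2(3) mult_right_mono[OF C(2), of ?X] by simp
    have norm: "Lt_norm (mat_idx d n) t (\<lambda>x. tf_eval n dv LW HS T (curry x) p q - f (curry x) p q) \<le> ereal \<epsilon>"
      if p: "p < d" and q: "q < n" for p q
    proof -
      have "\<exists>X. (\<forall>i\<in>I. X (pos i) = x i) \<and> X (2 * d * n) = real q \<and>
          tf_eval n dv LW HS T (curry x) p q = fnn_eval D d W2 net2 X p" if x: "x \<in> unit_cube I" for x
      proof -
        have "\<exists>X. (\<forall>(p, j)\<in>mat_idx d n. X (d * n + p * n + j) = x (p, j)) \<and> X (2 * d * n) = real q \<and>
          (\<forall>p<d. tf_eval n dv LW HS T (curry x) p q = fnn_eval D d W2 net2 X p)"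
          unfolding dv_def LW_def HS_def T_def
          by (rule transformer_value[OF d1 n1 D1 max.cobounded1 _ _ _ q])
             (use net0(4) net1(3) x in \<open>simp_all add: I_def\<close>)
        then obtain X where X: "\<forall>(p, j)\<in>I. X (d * n + p * n + j) = x (p, j)" "X (2 * d * n) = real q"
          "\<forall>p<d. tf_eval n dv LW HS T (curry x) p q = fnn_eval D d W2 net2 X p"
          unfolding I_def by (elim exE conjE)
        have "\<forall>i\<in>I. X (pos i) = x i" using X(1) by (auto simp: pos_def)
        then show ?thesis using X(2,3) p by (intro exI[of _ X]) simp
      qed
      then have "Lt_norm I t (\<lambda>x. tf_eval n dv LW HS T (curry x) p q - g p q x) \<le> ereal \<epsilon>"
        using net2(6) p q by simp
      then show ?thesis by (simp add: I_def g_def)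
    qed
    have EB: "tf_EB_bound n dv T C"
      using C(4) by (auto simp: tf_EB_bound_def T_def transformer_of_def)
    have FFb: "tf_FF_bound dv LW HS T (C * ?Y)"
      unfolding tf_FF_bound_def lHS
    proof (intro allI impI ballI)
      fix k p assume "k \<le> n" and p: "p \<in> fnn_pos (dv ! (k + 1)) (dv ! (k + 2)) (snd (LW ! k)) (fst (LW ! k))"
      then have sp: "sparse_fnn (C * ?Y) (if k = n then P2 else P0 + P1) (tf_FF T ! k)"
        and len: "length (tf_FF T ! k) = fst (LW ! k)" using FF[of k] by simp_all
      show "\<bar>fnn_val (tf_FF T ! k) p\<bar> \<le> C * ?Y"
        by (rule sparse_fnn_bound[OF sp p[folded len]])
    qed
    have SAb: "tf_SA_bound dv HS T (C * (1 + ln (1 / \<epsilon>)))"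
      unfolding tf_SA_bound_def lHS
    proof (intro allI impI ballI)
      fix k z assume k: "k < n" and z: "z \<in> sa_pos (fst (HS ! k)) (snd (HS ! k)) (dv ! (k + 2))"
      obtain h m r cc where z': "z = (h, m, r, cc)" by (cases z)
      \<comment> \<open>Only these two heads occur, with entries at most \<open>n\<close>, so the
        logarithmic bound is met by a constant.\<close>
      have "tf_SA T ! k ! h \<in> {sum_head n (d * n), zero_head}"
      proof (cases "k = 0")
        case True
        then have "h < (3 * d + 1) * c" using z z' by (simp add: sa_pos_def HS_def)
        then show ?thesis using True by (cases h) (auto simp: SA0)
      next
        case False
        then have "h < 3 * d * c" using z z' k HSk[of k] by (simp add: sa_pos_def)
        then show ?thesis using False k SAk[of k] by simp
      qed
      then have "\<bar>sa_val (tf_SA T ! k) z\<bar> \<le> real n"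
        using n1 by (auto simp: z' sa_val_def sum_head_def zero_head_def)
      also have "\<dots> \<le> C * (1 + ln (1 / \<epsilon>))"
        using C(1,6) ln0 mult_left_mono[of 1 "1 + ln (1 / \<epsilon>)" C] by linarith
      finally show "\<bar>sa_val (tf_SA T ! k) z\<bar> \<le> C * (1 + ln (1 / \<epsilon>))" .
    qed
    have "tf_M_EB n dv T \<le> MEB"
      unfolding tf_M_EB_def MEB_def dv_nth by (intro card_mono finite_eb_pos) auto
    then have MEB: "real (tf_M_EB n dv T) \<le> C" using C(9) by linarith
    have "tf_M_SA dv HS T \<le> MSA"
      unfolding tf_M_SA_def MSA_def lHS by (intro sum_mono card_mono finite_sa_pos) auto
    then have MSA: "real (tf_M_SA dv HS T) \<le> C" using C(8) by linarith
    have MFF: "real (tf_M_FF dv LW HS T) \<le> C * ?X"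
    proof -
      \<comment> \<open>Only the last block grows as \<open>\<epsilon>\<close> decreases; each of
        the \<open>n\<close> others is charged the constant \<open>P0 + P1\<close>.\<close>
      have "tf_M_FF dv LW HS T \<le> (\<Sum>k\<le>n. if k = n then P2 else P0 + P1)"
        unfolding tf_M_FF_def lHS
      proof (rule sum_mono)
        fix k assume "k \<in> {..n}"
        then have sp: "sparse_fnn (C * ?Y) (if k = n then P2 else P0 + P1) (tf_FF T ! k)"
          and len: "length (tf_FF T ! k) = fst (LW ! k)" using FF[of k] by simp_all
        show "card {p \<in> fnn_pos (dv ! (k + 1)) (dv ! (k + 2)) (snd (LW ! k)) (fst (LW ! k)).
            fnn_val (tf_FF T ! k) p \<noteq> 0} \<le> (if k = n then P2 else P0 + P1)"
          unfolding len[symmetric] by (rule sparse_fnn_count[OF sp])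
      qed
      also have "\<dots> = n * (P0 + P1) + P2"
        by (simp add: lessThan_Suc_atMost[symmetric])
      finally have "real (tf_M_FF dv LW HS T) \<le> real (n * (P0 + P1)) + real P2"
        by (simp only: of_nat_add[symmetric] of_nat_le_iff)
      also have "\<dots> \<le> real (n * (P0 + P1)) * ?X + C2 * ?X"
        using net2(4) X1(1) mult_left_mono[of 1 ?X "real (n * (P0 + P1))"] by simp
      also have "\<dots> = (C2 + real (n * (P0 + P1))) * ?X" by (simp add: distrib_right)
      also have "\<dots> \<le> C * ?X" using C(7) by (intro mult_right_mono) auto
      finally show ?thesis .
    qed
    show ?thesis
      by (rule exI[of _ T], rule exI[of _ W0], rule exI[of _ "length net2"], rule exI[of _ W2],
          unfold Let_def LW_def[symmetric])
         (intro conjI allI impI shape W0 Ln Wn EB FFb SAb MEB MFF MSA norm; assumption)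
  qed
  show ?thesis
    unfolding Let_def \<gamma>_def[symmetric] c_def[symmetric] D_def[symmetric] dv_def[symmetric] HS_def[symmetric]
      W1_def[symmetric]
    by (rule exI[of _ C], rule conjI[OF C(1)], rule allI, rule impI) (rule main[unfolded Let_def])
qed

end
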